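(* Let $(G,\theta)$ be a measured group such that $\mathbb{E}_\theta[\mathfrak{m}_\theta]:=\int_G\mathfrak{m}_\theta\,d\theta<+\infty$. Then $(G,\theta)$ admits a universal compact Radon--Nikodym model. That is, there exist a compact $G$-space $\mathbb{G}=\mathbb{G}(G,\theta)$ and a continuous $\theta$-harmonic cocycle $\mathfrak{g}:G\times\mathbb{G}\to\mathbb{R}_{>0}$ such that for every stationary $(G,\theta)$-space $(X,\mu)$ there are a compact $G$-invariant subset $\widehat X\subseteq\mathbb{G}$ and a $\theta$-stationary Borel probability measure $\widehat\mu$ on $\widehat X$ such that $(X,\mu)$ is measurably isomorphic to $(\widehat X,\widehat\mu)$ and the restriction $\mathfrak{g}|_{G\times\widehat X}$ is a (continuous) version of the Radon--Nikodym cocycle of $(\widehat X,\widehat\mu)$.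
   Context: A measured group $(G,\theta)$ is a locally compact second countable (lcsc) group $G$ with an admissible Borel probability measure $\theta$, i.e. $\theta$ is absolutely continuous with respect to Haar measure and is not supported on a closed proper subsemigroup of $G$ (equivalently $G=\overline{\bigcup_{n\ge1}\mathrm{supp}(\theta^{\ast n})}$). A measurable $u:G\to\mathbb{R}$ is $\theta$-harmonic if $\int_G u(gh)\,d\theta(h)=u(g)$ for all $g$. $\mathbb{H}(G,\theta)$ is the set of measurable $\theta$-harmonic $u:G\to\mathbb{R}_{>0}$ with $u(e_G)=1$, and the harmonic majorant is $\mathfrak{m}_\theta(g)=\sup\{u(g):u\in\mathbb{H}(G,\theta)\}\in[1,+\infty]$. A stationary $(G,\theta)$-space is a standard Borel space $X$ with a Borel $G$-action and a Borel probability measure $\mu$ with $\int_G g\mu\,d\theta(g)=\mu$, where $g\mu(A)=\mu(g^{-1}.A)$; then $g\mu\sim\mu$ for all $g$. A version of its Radon--Nikodym cocycle is a measurable $\varrho:G\times X\to\mathbb{R}_{>0}$ with $\varrho_g=\frac{dg^{-1}\mu}{d\mu}$ $\mu$-a.e. for every $g\in G$. A compact $G$-space is a compact metric space with a continuous action $G\times\mathbb{G}\to\mathbb{G}$. A cocycle on it is a map $\eta:G\times\mathbb{G}\to\mathbb{R}_{>0}$ with $\eta_{gh}(x)=\eta_g(h.x)\eta_h(x)$ for all $g,h\in G$ and all $x$; it is $\theta$-harmonic if for every $x$ the function $g\mapsto\eta_{g^{-1}}(x)$ is $\theta$-harmonic. Measurable isomorphism of $(X,\mu)$ with $(\widehat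 X,\widehat\mu)$ means: there are a $\mu$-conull set $X_o\subseteq X$ and an injective measurable $G$-equivariant map $\iota:X_o\to\widehat X$ (i.e. $\iota(g.x)=g.\iota(x)$ whenever $x,g.x\in X_o$) with $\iota_\ast\mu=\widehat\mu$. *)

theory Defs
  imports "HOL-Probability.Probability"
begin

text \<open>
  The group \<open>G\<close> is a type of class \<^class>\<open>topological_group_add\<close>, the library's class of topological
  groups. It is not assumed commutative; only the notation is additive: \<open>g + h\<close> is the
  product \<open>gh\<close>, \<open>0\<close> is \<open>e\<^sub>G\<close> and \<open>- g\<close> is the inverse of \<open>g\<close>. Second countability and the Hausdorff
  property are type classes; local compactness is part of \<open>measured_group\<close>.
\<close>

text \<open>On a second countable locally compact group, a Borel measure that is finite on compact sets
  is automatically Radon.\<close>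

definition left_haar_measure ::
    "'g::{topological_group_add, second_countable_topology, t2_space} measure \<Rightarrow> bool" where
  "left_haar_measure m \<longleftrightarrow>
     sets m = sets borel \<and> emeasure m UNIV \<noteq> 0 \<and>
     (\<forall>K. compact K \<longrightarrow> emeasure m K < \<infinity>) \<and>
     (\<forall>g. \<forall>A\<in>sets borel. emeasure m ((+) g ` A) = emeasure m A)"

definition admissible ::
    "'g::{topological_group_add, second_countable_topology, t2_space} measure \<Rightarrow> bool" where
  "admissible \<theta> \<longleftrightarrow>
     (\<exists>m. left_haar_measure m \<and> absolutely_continuous m \<theta>) \<and>
     (\<forall>S. closed S \<and> (\<forall>g\<in>S. \<forall>h\<in>S. g + h \<in> S) \<and> (AE g in \<theta>. g \<in> S) \<longrightarrow> S = UNIV)"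

definition measured_group ::
    "'g::{topological_group_add, second_countable_topology, t2_space} measure \<Rightarrow> bool" where
  "measured_group \<theta> \<longleftrightarrow>
     locally_compact_space (euclidean :: 'g topology) \<and>
     prob_space \<theta> \<and> sets \<theta> = sets borel \<and> admissible \<theta>"

definition harmonic ::
    "'g::{topological_group_add, second_countable_topology, t2_space} measure
      \<Rightarrow> ('g \<Rightarrow> real) \<Rightarrow> bool" where
  "harmonic \<theta> u \<longleftrightarrow>
     u \<in> borel_measurable borel \<and>
     (\<forall>g. integrable \<theta> (\<lambda>h. u (g + h)) \<and> (\<integral>h. u (g + h) \<partial>\<theta>) = u g)"

definition normalized_positive_harmonic ::
    "'g::{topological_group_add, second_countable_topology, t2_space} measure
      \<Rightarrow> ('g \<Rightarrow> real) set" where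
  "normalized_positive_harmonic \<theta> = {u. harmonic \<theta> u \<and> (\<forall>g. u g > 0) \<and> u 0 = 1}"

definition harmonic_majorant ::
    "'g::{topological_group_add, second_countable_topology, t2_space} measure
      \<Rightarrow> 'g \<Rightarrow> ennreal" where
  "harmonic_majorant \<theta> g = (\<Squnion>u\<in>normalized_positive_harmonic \<theta>. ennreal (u g))"

definition standard_borel :: "'x measure \<Rightarrow> bool" where
  "standard_borel M \<longleftrightarrow>
     (\<exists>T. completely_metrizable_space T \<and> second_countable T \<and> topspace T = space M \<and>
          sets M = sigma_sets (space M) {U. openin T U})"

definition borel_action ::
    "'x measure \<Rightarrow> ('g::{topological_group_add, second_countable_topology, t2_space} \<Rightarrow> 'x \<Rightarrow> 'x)
      \<Rightarrow> bool" where
  "borel_action M a \<longleftrightarrow>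
     (\<lambda>(g, x). a g x) \<in> measurable (borel \<Otimes>\<^sub>M M) M \<and>
     (\<forall>x\<in>space M. a 0 x = x) \<and>
     (\<forall>g h. \<forall>x\<in>space M. a (g + h) x = a g (a h x))"

text \<open>The translate \<open>g\<mu>\<close> is the push-forward \<open>distr M M (a g)\<close>.\<close>

definition stationary_measure ::
    "'g::{topological_group_add, second_countable_topology, t2_space} measure
      \<Rightarrow> 'x measure \<Rightarrow> ('g \<Rightarrow> 'x \<Rightarrow> 'x) \<Rightarrow> bool" where
  "stationary_measure \<theta> M a \<longleftrightarrow>
     prob_space M \<and>
     (\<forall>A\<in>sets M. (\<integral>\<^sup>+g. emeasure (distr M M (a g)) A \<partial>\<theta>) = emeasure M A)"

definition stationary_space ::
    "'g::{topological_group_add, second_countable_topology, t2_space} measure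
      \<Rightarrow> 'x measure \<Rightarrow> ('g \<Rightarrow> 'x \<Rightarrow> 'x) \<Rightarrow> bool" where
  "stationary_space \<theta> M a \<longleftrightarrow> standard_borel M \<and> borel_action M a \<and> stationary_measure \<theta> M a"

definition RN_cocycle_version ::
    "'x measure \<Rightarrow> ('g::{topological_group_add, second_countable_topology, t2_space} \<Rightarrow> 'x \<Rightarrow> 'x)
      \<Rightarrow> ('g \<Rightarrow> 'x \<Rightarrow> real) \<Rightarrow> bool" where
  "RN_cocycle_version M a \<rho> \<longleftrightarrow>
     (\<lambda>(g, x). \<rho> g x) \<in> borel_measurable (borel \<Otimes>\<^sub>M M) \<and>
     (\<forall>g. \<forall>x\<in>space M. \<rho> g x > 0) \<and>
     (\<forall>g. AE x in M. ennreal (\<rho> g x) = RN_deriv M (distr M M (a (- g))) x)"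

definition measurably_isomorphic ::
    "'x measure \<Rightarrow> ('g::{topological_group_add, second_countable_topology, t2_space} \<Rightarrow> 'x \<Rightarrow> 'x)
      \<Rightarrow> 'z measure \<Rightarrow> ('g \<Rightarrow> 'z \<Rightarrow> 'z) \<Rightarrow> bool" where
  "measurably_isomorphic M a N b \<longleftrightarrow>
     (\<exists>X\<^sub>o \<iota>. X\<^sub>o \<in> sets M \<and> (AE x in M. x \<in> X\<^sub>o) \<and>
        \<iota> \<in> measurable (restrict_space M X\<^sub>o) N \<and> inj_on \<iota> X\<^sub>o \<and>
        (\<forall>g. \<forall>x\<in>X\<^sub>o. a g x \<in> X\<^sub>o \<longrightarrow> \<iota> (a g x) = b g (\<iota> x)) \<and>
        distr (restrict_space M X\<^sub>o) N \<iota> = N)"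

definition compact_G_space ::
    "'z topology \<Rightarrow> ('g::{topological_group_add, second_countable_topology, t2_space} \<Rightarrow> 'z \<Rightarrow> 'z)
      \<Rightarrow> bool" where
  "compact_G_space Z b \<longleftrightarrow>
     compact_space Z \<and> metrizable_space Z \<and>
     continuous_map (prod_topology euclidean Z) Z (\<lambda>(g, z). b g z) \<and>
     (\<forall>z\<in>topspace Z. b 0 z = z) \<and>
     (\<forall>g h. \<forall>z\<in>topspace Z. b (g + h) z = b g (b h z))"

definition continuous_harmonic_cocycle ::
    "'g::{topological_group_add, second_countable_topology, t2_space} measure
      \<Rightarrow> 'z topology \<Rightarrow> ('g \<Rightarrow> 'z \<Rightarrow> 'z) \<Rightarrow> ('g \<Rightarrow> 'z \<Rightarrow> real) \<Rightarrow> bool" where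
  "continuous_harmonic_cocycle \<theta> Z b \<eta> \<longleftrightarrow>
     continuous_map (prod_topology euclidean Z) euclideanreal (\<lambda>(g, z). \<eta> g z) \<and>
     (\<forall>g. \<forall>z\<in>topspace Z. \<eta> g z > 0) \<and>
     (\<forall>g h. \<forall>z\<in>topspace Z. \<eta> (g + h) z = \<eta> g (b h z) * \<eta> h z) \<and>
     (\<forall>z\<in>topspace Z. harmonic \<theta> (\<lambda>g. \<eta> (- g) z))"

text \<open>
  \<open>(Z, b, \<eta>)\<close> is a compact Radon-Nikodym model that is universal for all stationary spaces whose
  carrier is a subset of the type \<open>'x\<close>. A formula cannot quantify over types. But the carrier of
  a standard Borel space has at most the cardinality of the continuum, so the instance at
  \<^typ>\<open>real\<close> covers every stationary space up to transport of structure along an injection.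
\<close>

definition universal_compact_RN_model ::
    "'x itself \<Rightarrow> 'g::{topological_group_add, second_countable_topology, t2_space} measure
      \<Rightarrow> 'z topology \<Rightarrow> ('g \<Rightarrow> 'z \<Rightarrow> 'z) \<Rightarrow> ('g \<Rightarrow> 'z \<Rightarrow> real) \<Rightarrow> bool" where
  "universal_compact_RN_model (TYPE('x)) \<theta> Z b \<eta> \<longleftrightarrow>
     compact_G_space Z b \<and> continuous_harmonic_cocycle \<theta> Z b \<eta> \<and>
     (\<forall>(M :: 'x measure) a. stationary_space \<theta> M a \<longrightarrow>
        (\<exists>K N. compactin Z K \<and> (\<forall>g. \<forall>z\<in>K. b g z \<in> K) \<and>
           space N = K \<and> sets N = sigma_sets K {U. openin (subtopology Z K) U} \<and>
           stationary_measure \<theta> N b \<and>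
           measurably_isomorphic M a N b \<and>
           RN_cocycle_version N b \<eta>))"

end

(* A normalized positive harmonic function u satisfies u(gh) <= u(g) w(h), where w is the harmonic
   majorant. So w is submultiplicative and, being a supremum of lower semicontinuous functions, lower
   semicontinuous; a Steinhaus argument makes it locally bounded. Since w is theta-integrable and
   translation is continuous in L1 of Haar measure, the set H of these functions is equicontinuous,
   hence compact and metrizable for pointwise convergence, and G acts on it with the continuous
   harmonic cocycle (g, u) -> u(g^-1).

   For a stationary space the measures g mu have densities at most w(g); averaging a jointly measurable
   version of them over theta gives a point u_x of H for almost every x. The map x -> u_x need not be
   injective, so the model is the product of H with countably many compact spaces of functions on G
   that are Lipschitz for the pseudometrics m(gW symdiff g'W). Such coordinates are given by the Haar measures of
   {h in gW. h^-1 x in A}; with W in a basis and A in a separating sequence they determine x. *)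
theory Submission
  imports Defs
begin

section \<open>Haar measure\<close>

text \<open>Two kinds of exceptional sets shape the argument. Integrability bounds \<open>w\<close>
  only almost everywhere, and each Radon-Nikodym identity holds off a null set that depends on the
  group element, while continuity of the model and the notion of isomorphism concern all elements of
  an uncountable group. For functions the remedy is averaging: \<theta> ignores Haar null sets, and
  a \<theta>-average is lower semicontinuous, so a harmonic function, being its own average, has no
  exceptional points. For the action the remedy is to compare two points of an orbit through a
  third, generic one. The inequality u(gh) <= u(g) w(h) holds because u(gh)/u(g), as a function of
  h, is again in \<open>H\<close>; the same normalisation defines the action on \<open>H\<close>.
  Further coordinates are unavoidable: for an invariant measure almost every u_x is the constant 1.
  The group need not be unimodular, so inversion and right translation are used only through the
  null sets they preserve.\<close>

locale haar_group =
  fixes m :: "'g::{topological_group_add, second_countable_topology, t2_space} measure"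
  assumes locally_compact: "locally_compact_space (euclidean :: 'g topology)"
    and left_haar: "left_haar_measure m"
begin

lemma sets_m [measurable_cong, simp]: "sets m = sets borel"
  using left_haar by (simp add: left_haar_measure_def)

lemma space_m [simp]: "space m = UNIV"
  using sets_eq_imp_space_eq[OF sets_m] by simp

lemma continuous_translate: "continuous_on S (\<lambda>h. g + h :: 'g)"
  by (intro continuous_on_add continuous_on_const continuous_on_id)

lemma measurable_uminus [measurable]: "(uminus :: 'g \<Rightarrow> 'g) \<in> borel_measurable borel"
  by (intro borel_measurable_continuous_onI continuous_on_minus continuous_on_id)

lemma translate_vimage: "(+) g ` A = (+) (- g) -` A" for g :: 'g
proof (intro set_eqI iffI)
  fix x assume "x \<in> (+) (- g) -` A"
  then have "x = g + (- g + x)" "- g + x \<in> A" by (simp_all add: add.assoc[symmetric])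
  then show "x \<in> (+) g ` A" by blast
qed (auto simp: add.assoc[symmetric])

lemma emeasure_translate: "A \<in> sets borel \<Longrightarrow> emeasure m ((+) (- g) -` A) = emeasure m A"
  using left_haar by (simp add: left_haar_measure_def translate_vimage[symmetric])

lemma distr_translate: "distr m borel ((+) g) = m"
proof (rule measure_eqI)
  fix A assume "A \<in> sets (distr m borel ((+) g))"
  then have A: "A \<in> sets borel" by simp
  have "emeasure (distr m borel ((+) g)) A = emeasure m ((+) g -` A)"
    using A by (subst emeasure_distr) auto
  also have "\<dots> = emeasure m A" using emeasure_translate[OF A, of "- g"] by simp
  finally show "emeasure (distr m borel ((+) g)) A = emeasure m A" .
qed simp

lemma nn_integral_translate:
  assumes [measurable]: "F \<in> borel_measurable borel"
  shows "(\<integral>\<^sup>+h. F (g + h) \<partial>m) = (\<integral>\<^sup>+h. F h \<partial>m)"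
proof -
  have "(\<integral>\<^sup>+h. F h \<partial>m) = (\<integral>\<^sup>+h. F h \<partial>distr m borel ((+) g))" by (simp add: distr_translate)
  also have "\<dots> = (\<integral>\<^sup>+h. F (g + h) \<partial>m)" by (subst nn_integral_distr) auto
  finally show ?thesis ..
qed

lemma open_finite_neighbourhood: "\<exists>U. open U \<and> x \<in> U \<and> emeasure m U < \<infinity>"
proof -
  obtain U K where UK: "open U" "compact K" "x \<in> U" "U \<subseteq> K"
    using locally_compact unfolding locally_compact_space_def by simp metis
  have "emeasure m U \<le> emeasure m K"
    using UK by (intro emeasure_mono) (auto intro: borel_compact)
  also have "\<dots> < \<infinity>" using left_haar UK by (auto simp: left_haar_measure_def)
  finally show ?thesis using UK by blast
qed

text \<open>Measures that are finite on the \<open>W i\<close> and agree there are equal, thanks to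
  stability under intersection; \<open>inj_point\<close> recovers sets from measures of pieces in
  this way. Finiteness makes the indicators integrable.\<close>

lemma countable_finite_pi_system:
  obtains W :: "nat \<Rightarrow> 'g set" where
    "\<And>i. open (W i)" "\<And>i. emeasure m (W i) < \<infinity>" "(\<Union>i. W i) = UNIV"
    "sets borel = sigma_sets UNIV (range W)" "Int_stable (range W)"
proof -
  obtain B :: "'g set set" where B: "countable B" "topological_basis B"
    using ex_countable_basis by blast
  \<comment> \<open>Basic sets can be chosen inside neighbourhoods of finite measure, so those of
    finite measure still form a basis.\<close>
  define B' where "B' = {U\<in>B. emeasure m U < \<infinity>}"
  define C where "C = Inter ` {F. F \<noteq> {} \<and> finite F \<and> F \<subseteq> B'}"
  have cB': "countable B'" unfolding B'_def using B(1) by auto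
  have basis: "topological_basis B'"
  proof (rule topological_basisI)
    show "open U" if "U \<in> B'" for U using that B by (auto simp: B'_def topological_basis_open)
    fix O' :: "'g set" and x assume O: "open O'" "x \<in> O'"
    obtain U where U: "open U" "x \<in> U" "emeasure m U < \<infinity>" using open_finite_neighbourhood by blast
    obtain V where V: "V \<in> B" "x \<in> V" "V \<subseteq> O' \<inter> U"
      using topological_basisE[OF B(2), of "O' \<inter> U" x] O U by blast
    have "emeasure m V \<le> emeasure m U" using V U by (intro emeasure_mono) auto
    then have "V \<in> B'" using V U by (auto simp: B'_def)
    then show "\<exists>B''\<in>B'. x \<in> B'' \<and> B'' \<subseteq> O'" using V by blast
  qed
  have opB': "open U" "emeasure m U < \<infinity>" if "U \<in> B'" for U
    using that basis by (auto simp: topological_basis_open B'_def)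
  have B'C: "B' \<subseteq> C"
  proof
    fix U assume "U \<in> B'"
    then have "{U} \<in> {F. F \<noteq> {} \<and> finite F \<and> F \<subseteq> B'}" by auto
    then have "\<Inter>{U} \<in> C" unfolding C_def by (rule imageI)
    then show "U \<in> C" by simp
  qed
  have cover: "\<Union>B' = UNIV"
    using basis by (metis UNIV_I topological_basisE open_UNIV UnionI UNIV_eq_I)
  then have "C \<noteq> {}" using B'C by auto
  have "countable {F. finite F \<and> F \<subseteq> B'}" using countable_Collect_finite_subset[OF cB'] .
  then have "countable {F. F \<noteq> {} \<and> finite F \<and> F \<subseteq> B'}" by (rule countable_subset[rotated]) auto
  then have cC: "countable C" by (simp add: C_def)
  have ranC: "range (from_nat_into C) = C" using range_from_nat_into[OF \<open>C \<noteq> {}\<close> cC] .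
  have opC: "open U" if "U \<in> C" for U using that opB' by (auto simp: C_def intro!: open_Inter)
  have finC: "emeasure m U < \<infinity>" if "U \<in> C" for U
  proof -
    obtain V where V: "V \<in> B'" "U \<subseteq> V" using \<open>U \<in> C\<close> unfolding C_def by blast
    have "emeasure m U \<le> emeasure m V" using V opB' by (intro emeasure_mono) auto
    then show ?thesis using opB'(2)[OF V(1)] by simp
  qed
  have "sigma_sets UNIV C = sigma_sets UNIV B'"
  proof (rule sigma_sets_eqI)
    fix U assume "U \<in> C"
    then obtain F where F: "F \<noteq> {}" "finite F" "F \<subseteq> B'" "U = \<Inter>F" unfolding C_def by blast
    interpret sigma_algebra UNIV "sigma_sets UNIV B'" by (rule sigma_algebra_sigma_sets) auto
    have "(\<Inter>V\<in>F. V) \<in> sigma_sets UNIV B'"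
      by (rule finite_INT) (use F in \<open>auto intro: sigma_sets.Basic\<close>)
    then show "U \<in> sigma_sets UNIV B'" using F by simp
  qed (use B'C in auto)
  also have "\<dots> = sets borel" using arg_cong[OF borel_eq_countable_basis[OF cB' basis], of sets] by simp
  finally have sig: "sets borel = sigma_sets UNIV C" ..
  have "Int_stable C"
  proof (rule Int_stableI)
    fix a b assume "a \<in> C" "b \<in> C"
    then obtain F G where "F \<noteq> {}" "finite F" "F \<subseteq> B'" "a = \<Inter>F" "G \<noteq> {}" "finite G" "G \<subseteq> B'" "b = \<Inter>G"
      unfolding C_def by blast
    then have "F \<union> G \<in> {F. F \<noteq> {} \<and> finite F \<and> F \<subseteq> B'}" "a \<inter> b = \<Inter>(F \<union> G)" by auto
    then show "a \<inter> b \<in> C" unfolding C_def by blast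
  qed
  moreover have "(\<Union>i. from_nat_into C i) = UNIV"
    unfolding ranC using Union_mono[OF B'C] unfolding cover by (rule top.extremum_uniqueI)
  moreover have "from_nat_into C i \<in> C" for i by (rule from_nat_into[OF \<open>C \<noteq> {}\<close>])
  ultimately show ?thesis
    by (intro that[of "from_nat_into C"]) (use ranC opC finC sig in simp_all)
qed

sublocale sigma_finite_measure m
proof
  obtain W :: "nat \<Rightarrow> 'g set" where W: "\<And>i. open (W i)" "\<And>i. emeasure m (W i) < \<infinity>" "(\<Union>i. W i) = UNIV"
    using countable_finite_pi_system by metis
  show "\<exists>A. countable A \<and> A \<subseteq> sets m \<and> \<Union>A = space m \<and> (\<forall>a\<in>A. emeasure m a \<noteq> \<infinity>)"
    by (rule exI[of _ "range W"]) (use W in \<open>auto simp: less_top\<close>)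
qed

section \<open>Continuity of left translation on integrable functions\<close>

definition L1_shift :: "('g \<Rightarrow> real) \<Rightarrow> 'g \<Rightarrow> ennreal" where
  "L1_shift k g = (\<integral>\<^sup>+h. ennreal \<bar>k (- g + h) - k h\<bar> \<partial>m)"

text \<open>Sequences tending to \<open>0\<close> are enough: the group is second countable, and by
  translation invariance continuity elsewhere reduces to continuity at \<open>0\<close>.\<close>

definition L1_continuous :: "('g \<Rightarrow> real) \<Rightarrow> bool" where
  "L1_continuous k \<longleftrightarrow> integrable m k \<and>
     (\<forall>X. X \<longlonglongrightarrow> 0 \<longrightarrow> (\<lambda>n. L1_shift k (X n)) \<longlonglongrightarrow> 0)"

lemma L1_continuous_add:
  assumes "L1_continuous k" "L1_continuous l"
  shows "L1_continuous (\<lambda>h. k h + l h)"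
  unfolding L1_continuous_def
proof (intro conjI allI impI)
  have [measurable]: "k \<in> borel_measurable borel" "l \<in> borel_measurable borel"
    using assms borel_measurable_integrable[of m] by (auto simp: L1_continuous_def)
  show "integrable m (\<lambda>h. k h + l h)" using assms by (auto simp: L1_continuous_def)
  fix X :: "nat \<Rightarrow> 'g" assume X: "X \<longlonglongrightarrow> 0"
  have le: "L1_shift (\<lambda>h. k h + l h) g \<le> L1_shift k g + L1_shift l g" for g
    unfolding L1_shift_def
    by (subst nn_integral_add[symmetric])
       (auto intro!: nn_integral_mono simp: ennreal_plus[symmetric] simp del: ennreal_plus)
  have "(\<lambda>n. L1_shift k (X n) + L1_shift l (X n)) \<longlonglongrightarrow> 0 + 0"
    using assms X by (intro tendsto_add) (auto simp: L1_continuous_def)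
  then show "(\<lambda>n. L1_shift (\<lambda>h. k h + l h) (X n)) \<longlonglongrightarrow> 0"
    unfolding add_0 by (rule tendsto_sandwich[OF _ _ tendsto_const, rotated 2]) (simp_all add: le)
qed

lemma L1_continuous_scale:
  assumes "L1_continuous k"
  shows "L1_continuous (\<lambda>h. k h * c)"
  unfolding L1_continuous_def
proof (intro conjI allI impI)
  have [measurable]: "k \<in> borel_measurable borel"
    using assms borel_measurable_integrable[of m] by (auto simp: L1_continuous_def)
  show "integrable m (\<lambda>h. k h * c)" using assms by (auto simp: L1_continuous_def)
  fix X :: "nat \<Rightarrow> 'g" assume X: "X \<longlonglongrightarrow> 0"
  have eq: "L1_shift (\<lambda>h. k h * c) g = L1_shift k g * ennreal \<bar>c\<bar>" for g
    unfolding L1_shift_def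
    by (subst nn_integral_multc[symmetric])
       (auto simp: ennreal_mult[symmetric] abs_mult[symmetric] left_diff_distrib)
  have "(\<lambda>n. L1_shift k (X n) * ennreal \<bar>c\<bar>) \<longlonglongrightarrow> 0 * ennreal \<bar>c\<bar>"
    using assms X by (intro tendsto_mult_ennreal) (auto simp: L1_continuous_def tendsto_const)
  then show "(\<lambda>n. L1_shift (\<lambda>h. k h * c) (X n)) \<longlonglongrightarrow> 0" by (simp add: eq)
qed

lemma L1_continuous_diff:
  assumes "L1_continuous k" "L1_continuous l"
  shows "L1_continuous (\<lambda>h. k h - l h)"
  using L1_continuous_add[OF assms(1) L1_continuous_scale[OF assms(2), of "-1"]] by simp

text \<open>The hypotheses are those of the limit case of \<open>integrable_induct\<close>, whence
  the factor 2. In the three-term estimate translation invariance makes the two approximation errors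
  equal, which gives \<open>2 * d i\<close>.\<close>

lemma L1_continuous_lim:
  assumes s: "\<And>i. L1_continuous (s i)" and k: "integrable m k"
    and lim: "\<And>h. (\<lambda>i. s i h) \<longlonglongrightarrow> k h" and bound: "\<And>i h. \<bar>s i h\<bar> \<le> 2 * \<bar>k h\<bar>"
  shows "L1_continuous k"
  unfolding L1_continuous_def
proof (intro conjI allI impI)
  have s_int: "integrable m (s i)" for i using s by (simp add: L1_continuous_def)
  have [measurable]: "k \<in> borel_measurable borel" "\<And>i. s i \<in> borel_measurable borel"
    using k s_int borel_measurable_integrable[of m] by auto
  define d where "d i = (\<integral>\<^sup>+h. ennreal \<bar>k h - s i h\<bar> \<partial>m)" for i
  have "(\<lambda>i. \<integral>\<^sup>+h. ennreal \<bar>k h - s i h\<bar> \<partial>m) \<longlonglongrightarrow> (\<integral>\<^sup>+h. ennreal \<bar>k h - k h\<bar> \<partial>m)"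
  \<comment> \<open>The factor 3 is 1 + 2: one for |k|, two for the bound on |s j|.\<close>
  proof (rule nn_integral_dominated_convergence[where w="\<lambda>h. ennreal (3 * \<bar>k h\<bar>)"])
    show "AE h in m. ennreal \<bar>k h - s j h\<bar> \<le> ennreal (3 * \<bar>k h\<bar>)" for j
      by (rule AE_I2, rule ennreal_leI) (use bound[of j] in \<open>smt (verit)\<close>)
    show "(\<integral>\<^sup>+h. ennreal (3 * \<bar>k h\<bar>) \<partial>m) < \<infinity>"
      using k by (simp add: ennreal_mult nn_integral_cmult ennreal_mult_less_top integrable_iff_bounded)
    show "AE h in m. (\<lambda>i. ennreal \<bar>k h - s i h\<bar>) \<longlonglongrightarrow> ennreal \<bar>k h - k h\<bar>"
      by (intro AE_I2 tendsto_ennrealI tendsto_intros lim)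
  qed auto
  then have d0: "d \<longlonglongrightarrow> 0" by (simp add: d_def[abs_def])
  show "integrable m k" by fact
  fix X :: "nat \<Rightarrow> 'g" assume X: "X \<longlonglongrightarrow> 0"
  have le: "L1_shift k g \<le> L1_shift (s i) g + 2 * d i" for i g
  proof -
    have t: "(\<integral>\<^sup>+h. ennreal \<bar>k (- g + h) - s i (- g + h)\<bar> \<partial>m) = d i"
      unfolding d_def by (subst nn_integral_translate[where F="\<lambda>h. ennreal \<bar>k h - s i h\<bar>"]) auto
    have "L1_shift k g \<le> (\<integral>\<^sup>+h. (ennreal \<bar>s i (- g + h) - s i h\<bar> + ennreal \<bar>k (- g + h) - s i (- g + h)\<bar>)
       + ennreal \<bar>k h - s i h\<bar> \<partial>m)"
      unfolding L1_shift_def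
      by (intro nn_integral_mono) (auto simp: ennreal_plus[symmetric] simp del: ennreal_plus)
    also have "\<dots> = L1_shift (s i) g + d i + d i"
      unfolding L1_shift_def by (subst nn_integral_add, simp, simp, subst nn_integral_add) (auto simp: t d_def)
    finally show ?thesis by (simp add: mult_2 add.assoc)
  qed
  show "(\<lambda>n. L1_shift k (X n)) \<longlonglongrightarrow> 0"
  proof (rule order_tendstoI)
    fix e :: ennreal assume e: "0 < e"
    have "(\<lambda>i. 2 * d i) \<longlonglongrightarrow> 2 * 0" using d0 by (intro tendsto_mult_ennreal) auto
    then have "\<forall>\<^sub>F i in sequentially. 2 * d i < e" using e by (intro order_tendstoD(2)) auto
    then obtain i where i: "2 * d i < e" by (auto simp: eventually_sequentially)
    have "(\<lambda>n. L1_shift (s i) (X n) + 2 * d i) \<longlonglongrightarrow> 0 + 2 * d i"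
      using s X by (intro tendsto_add) (auto simp: L1_continuous_def)
    moreover have "0 + 2 * d i < e" using i by simp
    ultimately have "\<forall>\<^sub>F n in sequentially. L1_shift (s i) (X n) + 2 * d i < e" by (rule order_tendstoD)
    then show "\<forall>\<^sub>F n in sequentially. L1_shift k (X n) < e"
      by eventually_elim (rule le_less_trans[OF le])
  qed auto
qed

text \<open>The indicator of an open set is lower semicontinuous and its integral is translation invariant, so
  it suffices to control where it decreases. This replaces an approximation by continuous functions.\<close>

lemma L1_continuous_indicator_open:
  assumes U: "open U" "emeasure m U < \<infinity>"
  shows "L1_continuous (indicator U)"
  unfolding L1_continuous_def
proof (intro conjI allI impI)
  have [measurable]: "U \<in> sets borel" using U by auto
  show "integrable m (indicator U :: 'g \<Rightarrow> real)" using U by simp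
  fix X :: "nat \<Rightarrow> 'g" assume X: "X \<longlonglongrightarrow> 0"
  define p where "p g = (\<integral>\<^sup>+h. ennreal (max 0 (indicator U h - indicator U (- g + h))) \<partial>m)" for g
  \<comment> \<open>Pointwise |s - t| + t = 2 max(0, t - s) + s, with s the translated indicator and
    t the original one. The summand \<open>emeasure m U\<close> replaces a subtraction in
    \<open>ennreal\<close>; being finite, it cancels afterwards.\<close>
  have "L1_shift (indicator U) g + emeasure m U = 2 * p g + emeasure m U" for g
  proof -
    have "L1_shift (indicator U) g + emeasure m U
      = (\<integral>\<^sup>+h. ennreal \<bar>indicator U (- g + h) - indicator U h\<bar> + indicator U h \<partial>m)"
      unfolding L1_shift_def by (subst nn_integral_add) auto
    also have "\<dots> = (\<integral>\<^sup>+h. 2 * ennreal (max 0 (indicator U h - indicator U (- g + h))) + indicator U (- g + h) \<partial>m)"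
      by (intro nn_integral_cong) (auto split: split_indicator simp: ennreal_neg)
    also have "\<dots> = 2 * p g + (\<integral>\<^sup>+h. indicator U (- g + h) \<partial>m)"
      unfolding p_def by (subst nn_integral_add, simp, simp, subst nn_integral_cmult) auto
    also have "(\<integral>\<^sup>+h. indicator U (- g + h) \<partial>m) = emeasure m U"
      by (subst nn_integral_translate) auto
    finally show ?thesis .
  qed
  then have eq: "L1_shift (indicator U) g = 2 * p g" for g
    using U(2) by (metis add.commute ennreal_add_left_cancel less_irrefl infinity_ennreal_def)
  have "(\<lambda>n. p (X n)) \<longlonglongrightarrow> (\<integral>\<^sup>+h. 0 \<partial>m)"
    unfolding p_def
  proof (rule nn_integral_dominated_convergence[where w="indicator U"])
    show "AE h in m. (\<lambda>i. ennreal (max 0 (indicator U h - indicator U (- X i + h)))) \<longlonglongrightarrow> 0"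
    proof (rule AE_I2)
      fix h
      show "(\<lambda>i. ennreal (max 0 (indicator U h - indicator U (- X i + h)))) \<longlonglongrightarrow> 0"
      proof (cases "h \<in> U")
        case True
        have "(\<lambda>i. - X i + h) \<longlonglongrightarrow> - 0 + h" by (intro tendsto_add tendsto_minus X tendsto_const)
        then have "\<forall>\<^sub>F i in sequentially. - X i + h \<in> U"
          using U True by (intro topological_tendstoD) auto
        then have "\<forall>\<^sub>F i in sequentially. ennreal (max 0 (indicator U h - indicator U (- X i + h))) = 0"
          by eventually_elim (use True in auto)
        then show ?thesis by (rule tendsto_eventually)
      qed (auto split: split_indicator)
    qed
  qed (use U in \<open>auto split: split_indicator simp: ennreal_neg\<close>)
  then have "(\<lambda>n. 2 * p (X n)) \<longlonglongrightarrow> 2 * 0" by (intro tendsto_mult_ennreal) auto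
  then show "(\<lambda>n. L1_shift (indicator U) (X n)) \<longlonglongrightarrow> 0" by (simp add: eq)
qed

text \<open>Dynkin induction from the open sets. The fixed \<open>W\<close> keeps complements
  integrable: a complement within \<open>W\<close> is a difference of two indicators already
  treated, and a disjoint union is a dominated limit.\<close>

lemma L1_continuous_indicator_Int:
  assumes W: "open W" "emeasure m W < \<infinity>" and A: "A \<in> sets borel"
  shows "L1_continuous (indicator (A \<inter> W))"
proof -
  have "Int_stable {U :: 'g set. open U}" "{U :: 'g set. open U} \<subseteq> Pow UNIV"
    by (auto simp: Int_stable_def)
  moreover have "A \<in> sigma_sets UNIV {U. open U}" using A by (simp add: borel_def)
  ultimately show ?thesis
  proof (induction rule: sigma_sets_induct_disjoint)
    case (basic A)
    moreover have "emeasure m (A \<inter> W) \<le> emeasure m W" using W by (intro emeasure_mono) auto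
    ultimately show ?case using W by (intro L1_continuous_indicator_open) auto
  next
    case empty
    then show ?case by (intro L1_continuous_indicator_open) auto
  next
    case (compl A)
    have "(indicator ((UNIV - A) \<inter> W) :: 'g \<Rightarrow> real) = (\<lambda>h. indicator W h - indicator (A \<inter> W) h)"
      by (auto simp: fun_eq_iff split: split_indicator)
    then show ?case using L1_continuous_diff[OF L1_continuous_indicator_open[OF W] compl(2)] by simp
  next
    case (union A)
    have fin: "L1_continuous (indicator ((\<Union>i<n. A i) \<inter> W))" for n
    proof (induction n)
      case 0
      then show ?case by (intro L1_continuous_indicator_open) auto
    next
      case (Suc n)
      have "A n \<inter> (\<Union>i<n. A i) = {}" using union(1) by (auto simp: disjoint_family_on_def) (metis IntI emptyE less_irrefl)
      then have "(indicator ((\<Union>i<Suc n. A i) \<inter> W) :: 'g \<Rightarrow> real)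
          = (\<lambda>h. indicator ((\<Union>i<n. A i) \<inter> W) h + indicator (A n \<inter> W) h)"
        by (auto simp: fun_eq_iff less_Suc_eq split: split_indicator)
      then show ?case using L1_continuous_add[OF Suc union(3)[of n]] by simp
    qed
    have [measurable]: "A i \<in> sets borel" for i using union(2) by (auto simp: borel_def)
    have "emeasure m (\<Union> (range A) \<inter> W) \<le> emeasure m W" using W by (intro emeasure_mono) auto
    then have "emeasure m (\<Union> (range A) \<inter> W) < \<infinity>" using W by auto
    moreover have "\<Union> (range A) \<inter> W \<in> sets m" using W by auto
    ultimately have int: "integrable m (indicator (\<Union> (range A) \<inter> W) :: 'g \<Rightarrow> real)" by simp
    show ?case
    proof (rule L1_continuous_lim[OF fin int])
      fix h
      show "(\<lambda>i. indicator ((\<Union>i<i. A i) \<inter> W) h :: real) \<longlonglongrightarrow> indicator (\<Union> (range A) \<inter> W) h"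
      proof (cases "h \<in> \<Union> (range A) \<inter> W")
        case True
        then obtain j where "h \<in> A j" by auto
        then have "\<forall>\<^sub>F i in sequentially. indicator ((\<Union>i<i. A i) \<inter> W) h = (1::real)"
          using True by (intro eventually_sequentiallyI[of "Suc j"]) (force simp: indicator_def)
        then show ?thesis using True by (simp add: tendsto_eventually)
      next
        case False
        then have "indicator ((\<Union>i<i. A i) \<inter> W) h = (0::real)" for i by (auto simp: indicator_def)
        then show ?thesis using False by simp
      qed
    qed (auto split: split_indicator)
  qed
qed

theorem L1_continuous_integrable:
  assumes "integrable m k"
  shows "L1_continuous k"
  using assms
proof (induction rule: integrable_induct)
  case (base A c)
  obtain W :: "nat \<Rightarrow> 'g set" where W: "\<And>i. open (W i)" "\<And>i. emeasure m (W i) < \<infinity>" "(\<Union>i. W i) = UNIV"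
    using countable_finite_pi_system by metis
  have "L1_continuous (indicator (A \<inter> (\<Union>i\<le>n. W i)))" for n
  proof (rule L1_continuous_indicator_Int)
    have "emeasure m (\<Union>i\<le>n. W i) \<le> (\<Sum>i\<le>n. emeasure m (W i))"
      using W by (intro emeasure_subadditive_finite) auto
    also have "\<dots> < \<infinity>" using W(2) by auto
    finally show "emeasure m (\<Union>i\<le>n. W i) < \<infinity>" .
  qed (use W base in auto)
  moreover have "integrable m (indicator A :: 'g \<Rightarrow> real)" using base by simp
  ultimately have "L1_continuous (indicator A)"
  proof (rule L1_continuous_lim)
    fix h
    obtain j where "h \<in> W j" using W(3) by auto
    then have "\<forall>\<^sub>F n in sequentially. indicator (A \<inter> (\<Union>i\<le>n. W i)) h = (indicator A h :: real)"
      by (intro eventually_sequentiallyI[of j]) (auto simp: indicator_def)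
    then show "(\<lambda>n. indicator (A \<inter> (\<Union>i\<le>n. W i)) h :: real) \<longlonglongrightarrow> indicator A h"
      by (rule tendsto_eventually)
  qed (auto split: split_indicator)
  then show ?case using L1_continuous_scale by simp
next
  case (add f g)
  then show ?case by (intro L1_continuous_add)
next
  case (lim f s)
  show ?case by (rule L1_continuous_lim[of s]) (use lim in auto)
qed


text \<open>Left invariance moves both translations from \<open>F\<close> to the kernel
  \<open>k\<close>, and the two kernels differ by \<open>L1_shift k (- g + x)\<close> in norm. The
  bound on \<open>F\<close> is required only where a translated kernel is nonzero, so the estimate
  also serves functions that are not globally bounded.\<close>

lemma nn_integral_shift_le:
  assumes [measurable]: "F \<in> borel_measurable borel" "k \<in> borel_measurable borel"
    and k0: "\<And>h. 0 \<le> k h"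
    and C: "\<And>h. k (- g + h) \<noteq> 0 \<or> k (- x + h) \<noteq> 0 \<Longrightarrow> F h \<le> C"
  shows "(\<integral>\<^sup>+h. F (g + h) * ennreal (k h) \<partial>m) \<le>
    (\<integral>\<^sup>+h. F (x + h) * ennreal (k h) \<partial>m) + C * L1_shift k (- g + x)"
proof -
  have shift: "(\<integral>\<^sup>+h. F (g + h) * ennreal (k h) \<partial>m) = (\<integral>\<^sup>+h. F h * ennreal (k (- g + h)) \<partial>m)" for g
    using nn_integral_translate[of "\<lambda>h. F h * ennreal (k (- g + h))" g]
    by (simp add: add.assoc[symmetric])
  have "(\<integral>\<^sup>+h. F h * ennreal (k (- g + h)) \<partial>m)
      \<le> (\<integral>\<^sup>+h. F h * ennreal (k (- x + h)) + C * ennreal \<bar>k (- x + h) - k (- g + h)\<bar> \<partial>m)"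
  proof (rule nn_integral_mono)
    fix h
    show "F h * ennreal (k (- g + h)) \<le> F h * ennreal (k (- x + h)) + C * ennreal \<bar>k (- x + h) - k (- g + h)\<bar>"
    proof (cases "k (- g + h) \<noteq> 0 \<or> k (- x + h) \<noteq> 0")
      case True
      have "F h * ennreal (k (- g + h)) \<le> F h * (ennreal (k (- x + h)) + ennreal \<bar>k (- x + h) - k (- g + h)\<bar>)"
        using k0 by (intro mult_left_mono) (auto simp: ennreal_plus[symmetric] simp del: ennreal_plus)
      also have "\<dots> \<le> F h * ennreal (k (- x + h)) + C * ennreal \<bar>k (- x + h) - k (- g + h)\<bar>"
        unfolding distrib_left by (intro add_left_mono mult_right_mono C True) auto
      finally show ?thesis .
    qed simp
  qed
  also have "\<dots> = (\<integral>\<^sup>+h. F h * ennreal (k (- x + h)) \<partial>m) + C * (\<integral>\<^sup>+h. ennreal \<bar>k (- x + h) - k (- g + h)\<bar> \<partial>m)"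
    by (subst nn_integral_add, simp, simp, subst nn_integral_cmult) auto
  also have "(\<integral>\<^sup>+h. ennreal \<bar>k (- x + h) - k (- g + h)\<bar> \<partial>m) = L1_shift k (- g + x)"
    unfolding L1_shift_def
    using nn_integral_translate[of "\<lambda>h. ennreal \<bar>k (- x + h) - k (- g + h)\<bar>" g]
    by (simp add: add.assoc[symmetric] minus_add)
  finally show ?thesis unfolding shift .
qed

lemma L1_shift_tendsto:
  assumes "integrable m k" "X \<longlonglongrightarrow> g"
  shows "(\<lambda>n. L1_shift k (- g + X n)) \<longlonglongrightarrow> 0" "(\<lambda>n. L1_shift k (- X n + g)) \<longlonglongrightarrow> 0"
proof -
  have "(\<lambda>n. - g + X n) \<longlonglongrightarrow> - g + g" "(\<lambda>n. - X n + g) \<longlonglongrightarrow> - g + g"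
    by (rule tendsto_add tendsto_minus tendsto_const assms(2))+
  then show "(\<lambda>n. L1_shift k (- g + X n)) \<longlonglongrightarrow> 0" "(\<lambda>n. L1_shift k (- X n + g)) \<longlonglongrightarrow> 0"
    using L1_continuous_integrable[OF assms(1)] by (auto simp: L1_continuous_def)
qed

lemma L1_shift_minus:
  assumes [measurable]: "k \<in> borel_measurable borel"
  shows "L1_shift k (- g) = L1_shift k g"
  unfolding L1_shift_def
  by (subst nn_integral_translate[of _ "- g", symmetric]) (simp_all add: add.assoc[symmetric] abs_minus_commute)

text \<open>For \<open>F\<close> truncated at \<open>n\<close> the shift estimate applies with
  \<open>C = n\<close>; the general case is the supremum over \<open>n\<close>, whose sublevel sets
  are intersections. Averaging alone thus produces lower semicontinuity from measurability.\<close>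

lemma closed_convolution_sublevel:
  assumes F [measurable]: "F \<in> borel_measurable borel" and k: "integrable m k" "\<And>h. 0 \<le> k h"
  shows "closed {g. (\<integral>\<^sup>+h. F (g + h) * ennreal (k h) \<partial>m) \<le> c}"
proof -
  have [measurable]: "k \<in> borel_measurable borel"
    using k borel_measurable_integrable[of m k] by auto
  have bounded: "closed {g. (\<integral>\<^sup>+h. min (F (g + h)) (of_nat n) * ennreal (k h) \<partial>m) \<le> c}" for n
    unfolding closed_sequential_limits
  proof (intro allI impI, elim conjE)
    fix X x assume X: "\<forall>j. X j \<in> {g. (\<integral>\<^sup>+h. min (F (g + h)) (of_nat n) * ennreal (k h) \<partial>m) \<le> c}" "X \<longlonglongrightarrow> x"
    have "(\<integral>\<^sup>+h. min (F (x + h)) (of_nat n) * ennreal (k h) \<partial>m) \<le> c + of_nat n * L1_shift k (- x + X j)" for j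
    proof -
      have "(\<integral>\<^sup>+h. min (F (x + h)) (of_nat n) * ennreal (k h) \<partial>m)
         \<le> (\<integral>\<^sup>+h. min (F (X j + h)) (of_nat n) * ennreal (k h) \<partial>m) + of_nat n * L1_shift k (- x + X j)"
        by (rule nn_integral_shift_le) (use k in auto)
      also have "\<dots> \<le> c + of_nat n * L1_shift k (- x + X j)" using X(1) by (intro add_right_mono) auto
      finally show ?thesis .
    qed
    moreover have "(\<lambda>j. c + of_nat n * L1_shift k (- x + X j)) \<longlonglongrightarrow> c + of_nat n * 0"
      by (intro tendsto_add tendsto_const tendsto_mult_ennreal L1_shift_tendsto k X) auto
    ultimately show "x \<in> {g. (\<integral>\<^sup>+h. min (F (g + h)) (of_nat n) * ennreal (k h) \<partial>m) \<le> c}"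
      using LIMSEQ_le_const by fastforce
  qed
  have sup: "(\<integral>\<^sup>+h. F (g + h) * ennreal (k h) \<partial>m)
      = (SUP n. \<integral>\<^sup>+h. min (F (g + h)) (of_nat n) * ennreal (k h) \<partial>m)" for g
  proof -
    have lim: "(SUP n. min a (of_nat n)) = a" for a :: ennreal
    proof -
      have "(SUP n. min a (of_nat n)) = min a (SUP n. of_nat n)" by (simp add: inf_min[symmetric] inf_SUP)
      then show ?thesis by (simp add: ennreal_SUP_of_nat_eq_top)
    qed
    have "(\<integral>\<^sup>+h. F (g + h) * ennreal (k h) \<partial>m) = (\<integral>\<^sup>+h. (SUP n. min (F (g + h)) (of_nat n) * ennreal (k h)) \<partial>m)"
      by (intro nn_integral_cong) (simp add: SUP_mult_right_ennreal[symmetric] lim)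
    also have "\<dots> = (SUP n. \<integral>\<^sup>+h. min (F (g + h)) (of_nat n) * ennreal (k h) \<partial>m)"
      by (rule nn_integral_monotone_convergence_SUP)
         (auto simp: incseq_def le_fun_def intro!: mult_right_mono min.mono)
    finally show ?thesis .
  qed
  have "{g. (\<integral>\<^sup>+h. F (g + h) * ennreal (k h) \<partial>m) \<le> c}
     = (\<Inter>n. {g. (\<integral>\<^sup>+h. min (F (g + h)) (of_nat n) * ennreal (k h) \<partial>m) \<le> c})"
    by (auto simp: sup SUP_le_iff)
  then show ?thesis using bounded by (auto intro!: closed_INT)
qed

section \<open>Null sets under inversion and right translation; the Steinhaus theorem\<close>

lemma pair_sigma_finite_m: "pair_sigma_finite m m"
  by (intro pair_sigma_finite.intro sigma_finite_measure_axioms)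

text \<open>Integrate \<open>indicator D (- h + g)\<close> in both orders: for fixed
  \<open>g\<close> the set of \<open>h\<close> is a left translate of the inverse of
  \<open>D\<close>, for fixed \<open>h\<close> the set of \<open>g\<close> is a left translate of
  \<open>D\<close>. The measure itself need not be invariant under inversion.\<close>

lemma null_inverse_image:
  assumes D [measurable]: "D \<in> sets borel" and null: "emeasure m (uminus -` D) = 0"
  shows "emeasure m D = 0"
proof -
  interpret P: pair_sigma_finite m m by (rule pair_sigma_finite_m)
  have [measurable]: "uminus -` D \<in> sets borel"
    using measurable_sets[OF measurable_uminus D] by simp
  have "(\<integral>\<^sup>+g. \<integral>\<^sup>+h. indicator D (- h + g) \<partial>m \<partial>m) = (\<integral>\<^sup>+h. \<integral>\<^sup>+g. indicator D (- h + g) \<partial>m \<partial>m)"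
    by (rule P.Fubini') (simp add: case_prod_beta)
  also have "\<dots> = emeasure m D * emeasure m UNIV"
    by (subst nn_integral_translate) auto
  also have "(\<integral>\<^sup>+g. \<integral>\<^sup>+h. indicator D (- h + g) \<partial>m \<partial>m) = 0"
  proof -
    have "(\<integral>\<^sup>+h. indicator D (- h + g) \<partial>m) = (0::ennreal)" for g
    proof -
      have "(\<integral>\<^sup>+h. indicator D (- h + g) \<partial>m) = (\<integral>\<^sup>+h. indicator (uminus -` D) (- g + h) \<partial>m)"
        by (intro nn_integral_cong) (auto simp: minus_add split: split_indicator)
      also have "\<dots> = 0" by (subst nn_integral_translate) (auto simp: null)
      finally show ?thesis .
    qed
    then show ?thesis by simp
  qed
  finally show ?thesis using left_haar by (auto simp: left_haar_measure_def)
qed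

text \<open>Right translation is left translation conjugated by inversion. For null sets this avoids
  the modular function.\<close>

lemma null_right_translate:
  assumes A [measurable]: "A \<in> sets borel"
  shows "emeasure m ((\<lambda>g. g + h) -` A) = 0 \<longleftrightarrow> emeasure m A = 0"
proof -
  have inv: "emeasure m (uminus -` D) = 0 \<longleftrightarrow> emeasure m D = 0" if "D \<in> sets borel" for D :: "'g set"
  proof
    assume "emeasure m D = 0"
    moreover have "uminus -` (uminus -` D) = D" by auto
    ultimately show "emeasure m (uminus -` D) = 0"
      using null_inverse_image[of "uminus -` D"] measurable_sets[OF measurable_uminus that] by auto
  qed (rule null_inverse_image[OF that])
  have B: "uminus -` A \<in> sets borel" using measurable_sets[OF measurable_uminus A] by simp
  have C: "(+) (- h) -` (uminus -` A) \<in> sets borel"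
    using measurable_sets[of "(+) (- h)" borel borel, OF _ B] by simp
  have "(\<lambda>g. g + h) -` A = uminus -` ((+) (- h) -` (uminus -` A))" by (auto simp: minus_add)
  then show ?thesis
    using inv[OF C] inv[OF A] emeasure_translate[OF B] by simp
qed

lemma AE_left_translate:
  assumes "AE k in m. P k"
  shows "AE h in m. P (g + h)"
proof -
  obtain N where N: "{x \<in> space m. \<not> P x} \<subseteq> N" "emeasure m N = 0" "N \<in> sets m"
    using AE_E[OF assms] by metis
  have "(+) g -` N \<in> sets borel" using N measurable_sets[of "(+) g" borel borel N] by auto
  moreover have "emeasure m ((+) g -` N) = 0" using emeasure_translate[of N "- g"] N by simp
  ultimately show ?thesis using N by (intro AE_I[of _ _ "(+) g -` N"]) auto
qed

lemma AE_right_translate: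
  assumes "AE g in m. P g"
  shows "AE g in m. P (g + h)"
proof -
  obtain N where N: "{x \<in> space m. \<not> P x} \<subseteq> N" "emeasure m N = 0" "N \<in> sets m"
    using AE_E[OF assms] by metis
  have "(\<lambda>g. g + h) -` N \<in> sets borel"
    using N measurable_sets[of "\<lambda>g. g + h" borel borel N] by auto
  then show ?thesis
    using N null_right_translate[of N h] by (intro AE_I[of _ _ "(\<lambda>g. g + h) -` N"]) auto
qed

text \<open>The measure \<open>\<psi> g\<close> of those \<open>h\<close> in \<open>D\<close> with
  \<open>g + h\<close> in \<open>A\<close> is lower semicontinuous in \<open>g\<close>, so it is
  positive on an open set; a positive value exhibits \<open>g\<close> as
  \<open>(g + h) + - h\<close>. By Fubini it cannot vanish identically.\<close>

lemma steinhaus: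
  assumes A [measurable]: "A \<in> sets borel" and B [measurable]: "B \<in> sets borel"
    and pos: "emeasure m A \<noteq> 0" "emeasure m B \<noteq> 0"
  obtains U where "open U" "U \<noteq> {}" "\<And>g. g \<in> U \<Longrightarrow> \<exists>a\<in>A. \<exists>b\<in>B. g = a + b"
proof -
  interpret P: pair_sigma_finite m m by (rule pair_sigma_finite_m)
  obtain W :: "nat \<Rightarrow> 'g set" where W: "\<And>i. open (W i)" "\<And>i. emeasure m (W i) < \<infinity>" "(\<Union>i. W i) = UNIV"
    using countable_finite_pi_system by metis
  have B' [measurable]: "uminus -` B \<in> sets borel" using measurable_sets[OF measurable_uminus B] by simp
  have [measurable]: "W i \<in> sets borel" for i using W by auto
  have "\<exists>i. emeasure m (uminus -` B \<inter> W i) \<noteq> 0"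
  proof (rule ccontr)
    assume "\<not> (\<exists>i. emeasure m (uminus -` B \<inter> W i) \<noteq> 0)"
    then have "emeasure m (\<Union>i. uminus -` B \<inter> W i) = 0" by (intro emeasure_UN_eq_0) auto
    also have "(\<Union>i. uminus -` B \<inter> W i) = uminus -` B" using W(3) by auto
    finally show False using null_inverse_image[OF B] pos by simp
  qed
  then obtain i where i: "emeasure m (uminus -` B \<inter> W i) \<noteq> 0" by blast
  \<comment> \<open>Cutting the inverse of \<open>B\<close> down to one \<open>W i\<close> makes its
    indicator an integrable kernel.\<close>
  define D where "D = uminus -` B \<inter> W i"
  have [measurable]: "D \<in> sets borel" unfolding D_def by simp
  have "emeasure m D \<le> emeasure m (W i)" unfolding D_def by (intro emeasure_mono) auto
  then have D: "emeasure m D < \<infinity>" using W(2)[of i] by auto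
  define \<psi> where "\<psi> g = (\<integral>\<^sup>+h. indicator A (g + h) * ennreal (indicator D h) \<partial>m)" for g
  have "closed {g. \<psi> g \<le> 0}"
    unfolding \<psi>_def by (rule closed_convolution_sublevel) (use D in auto)
  then have "open (- {g. \<psi> g \<le> 0})" by (rule open_Compl)
  moreover have "- {g. \<psi> g \<le> 0} \<noteq> {}"
  proof
    assume "- {g. \<psi> g \<le> 0} = {}"
    then have "\<psi> g = 0" for g by auto
    then have "0 = (\<integral>\<^sup>+g. \<integral>\<^sup>+h. indicator A (g + h) * ennreal (indicator D h) \<partial>m \<partial>m)"
      by (simp add: \<psi>_def)
    also have "\<dots> = (\<integral>\<^sup>+h. \<integral>\<^sup>+g. indicator A (g + h) * ennreal (indicator D h) \<partial>m \<partial>m)"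
      by (rule P.Fubini') (simp add: case_prod_beta)
    also have "\<dots> = (\<integral>\<^sup>+h. emeasure m ((\<lambda>g. g + h) -` A) * ennreal (indicator D h) \<partial>m)"
    proof (intro nn_integral_cong)
      fix h
      have S: "(\<lambda>g. g + h) -` A \<in> sets m" using measurable_sets[of "\<lambda>g. g + h" borel borel A] by auto
      have "indicator A (g + h) = (indicator ((\<lambda>g. g + h) -` A) g :: ennreal)" for g
        by (simp add: indicator_def)
      then show "(\<integral>\<^sup>+g. indicator A (g + h) * ennreal (indicator D h) \<partial>m)
         = emeasure m ((\<lambda>g. g + h) -` A) * ennreal (indicator D h)"
        using S by (simp add: nn_integral_multc)
    qed
    finally have "(\<integral>\<^sup>+h. emeasure m ((\<lambda>g. g + h) -` A) * ennreal (indicator D h) \<partial>m) = 0" ..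
    moreover have "(\<lambda>h. emeasure m ((\<lambda>g. g + h) -` A)) \<in> borel_measurable borel"
    proof -
      have "(\<lambda>(h, g). g + h) \<in> measurable (borel \<Otimes>\<^sub>M m) (borel :: 'g measure)" by measurable
      from measurable_sets[OF this A]
      have "{p. snd p + fst p \<in> A} \<in> sets (borel \<Otimes>\<^sub>M m)"
        by (simp add: space_pair_measure vimage_def case_prod_beta)
      then have "(\<lambda>h. emeasure m (Pair h -` {p. snd p + fst p \<in> A})) \<in> borel_measurable borel"
        by (rule measurable_emeasure_Pair)
      then show ?thesis by (simp add: vimage_def)
    qed
    ultimately have "AE h in m. emeasure m ((\<lambda>g. g + h) -` A) * ennreal (indicator D h) = 0"
      by (subst (asm) nn_integral_0_iff_AE) auto
    then have "AE h in m. h \<notin> D"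
      by eventually_elim (auto simp: null_right_translate[OF A] pos split: split_indicator_asm)
    then have "emeasure m D = 0" by (subst (asm) AE_iff_measurable[OF _ refl]) auto
    then show False using i by (simp add: D_def)
  qed
  moreover have "\<exists>a\<in>A. \<exists>b\<in>B. g = a + b" if "g \<in> - {g. \<psi> g \<le> 0}" for g
  proof (rule ccontr)
    assume no: "\<not> (\<exists>a\<in>A. \<exists>b\<in>B. g = a + b)"
    have "indicator A (g + h) * ennreal (indicator D h) = 0" for h
    proof (rule ccontr)
      assume "indicator A (g + h) * ennreal (indicator D h) \<noteq> 0"
      then have "g + h \<in> A" "- h \<in> B" by (auto simp: D_def split: split_indicator_asm)
      moreover have "g = (g + h) + - h" by (simp add: add.assoc)
      ultimately show False using no by blast
    qed
    then have "\<psi> g = (\<integral>\<^sup>+h. 0 \<partial>m)" unfolding \<psi>_def by (intro nn_integral_cong)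
    then show False using that by simp
  qed
  ultimately show ?thesis using that by blast
qed

end

section \<open>Harmonic functions with values in [0, \<infinity>] and the minimum principle\<close>

locale measured_haar_group = haar_group m for m :: "'g::{topological_group_add, second_countable_topology, t2_space} measure" +
  fixes \<theta> :: "'g measure"
  assumes measured: "measured_group \<theta>" and ac: "absolutely_continuous m \<theta>"
begin

sublocale \<theta>: prob_space \<theta> using measured by (simp add: measured_group_def)

lemma sets_\<theta> [measurable_cong, simp]: "sets \<theta> = sets borel"
  using measured by (simp add: measured_group_def)

lemma space_\<theta> [simp]: "space \<theta> = UNIV"
  using sets_eq_imp_space_eq[OF sets_\<theta>] by simp

lemma generating:
  assumes "closed S" "\<And>g h. g \<in> S \<Longrightarrow> h \<in> S \<Longrightarrow> g + h \<in> S" "AE g in \<theta>. g \<in> S"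
  shows "S = UNIV"
  using assms measured unfolding measured_group_def admissible_def by blast

lemma \<theta>_density:
  obtains f where "integrable m f" "\<And>h. 0 \<le> f h" "\<theta> = density m (\<lambda>h. ennreal (f h))"
proof -
  obtain f where f: "f \<in> borel_measurable m" "AE x in m. RN_deriv m \<theta> x = ennreal (f x)" "\<And>x. 0 \<le> f x"
    using real_RN_deriv[OF \<theta>.finite_measure_axioms ac] by (auto simp: sets_m)
  have "\<theta> = density m (RN_deriv m \<theta>)" using ac by (intro density_RN_deriv[symmetric]) auto
  also have "\<dots> = density m (\<lambda>h. ennreal (f h))" using f by (intro density_cong) auto
  finally have eq: "\<theta> = density m (\<lambda>h. ennreal (f h))" .
  have "(\<integral>\<^sup>+h. ennreal (f h) \<partial>m) = emeasure \<theta> UNIV"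
    using f(1) by (subst eq) (simp add: emeasure_density)
  then have "integrable m f" using f \<theta>.emeasure_space_1
    by (intro integrableI_nonneg) auto
  then show ?thesis using that f eq by blast
qed

lemma null_\<theta>: "AE h in m. P h \<Longrightarrow> AE h in \<theta>. P h"
  by (rule absolutely_continuous_AE[OF _ ac]) simp_all

text \<open>Averaging against \<theta> is convolution with its Haar density. Hence harmonic
  functions, merely measurable by definition, are lower semicontinuous.\<close>

lemma closed_average_sublevel:
  assumes [measurable]: "F \<in> borel_measurable borel"
  shows "closed {g. (\<integral>\<^sup>+h. F (g + h) \<partial>\<theta>) \<le> c}"
proof -
  obtain f where f: "integrable m f" "\<And>h. 0 \<le> f h" "\<theta> = density m (\<lambda>h. ennreal (f h))"
    using \<theta>_density by metis
  have [measurable]: "f \<in> borel_measurable borel"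
    using f borel_measurable_integrable[of m f] by auto
  have "(\<integral>\<^sup>+h. F (g + h) \<partial>\<theta>) = (\<integral>\<^sup>+h. F (g + h) * ennreal (f h) \<partial>m)" for g
    unfolding f(3) by (subst nn_integral_density) (auto simp: mult.commute)
  then show ?thesis using closed_convolution_sublevel[OF assms f(1,2)] by simp
qed

text \<open>Values in \<open>ennreal\<close> free the equation from integrability conditions and
  admit 0 and \<infinity>. Both matter: measures of null sets and densities not yet known to be
  finite are treated as harmonic functions.\<close>

definition nn_harmonic :: "('g \<Rightarrow> ennreal) \<Rightarrow> bool" where
  "nn_harmonic F \<longleftrightarrow> F \<in> borel_measurable borel \<and> (\<forall>g. (\<integral>\<^sup>+h. F (g + h) \<partial>\<theta>) = F g)"

lemma closed_nn_harmonic_sublevel: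
  "nn_harmonic F \<Longrightarrow> closed {g. F g \<le> c}"
  using closed_average_sublevel[of F c] by (simp add: nn_harmonic_def)

text \<open>The elements whose right translation preserves the zero set form a closed subsemigroup. It has
  full measure because the zero set is separable.\<close>

lemma nn_harmonic_minimum_principle:
  assumes F: "nn_harmonic F" and g0: "F g0 = 0"
  shows "F g = 0"
proof -
  define P where "P = {g. F g \<le> 0}"
  have [measurable]: "F \<in> borel_measurable borel" using F by (simp add: nn_harmonic_def)
  have cP: "closed P" unfolding P_def by (rule closed_nn_harmonic_sublevel[OF F])
  obtain D where D: "countable D" "D \<subseteq> P" "P \<subseteq> closure D"
  proof -
    obtain B :: "'g set set" where B: "countable B" "topological_basis B"
      using ex_countable_basis by blast
    define c where "c V = (SOME x. x \<in> V \<inter> P)" for V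
    define D where "D = c ` {V\<in>B. V \<inter> P \<noteq> {}}"
    have c: "c V \<in> V \<inter> P" if "V \<inter> P \<noteq> {}" for V using that unfolding c_def by (metis some_in_eq)
    have "x \<in> closure D" if "x \<in> P" for x
      unfolding closure_iff_nhds_not_empty
    proof (intro allI impI)
      fix A V assume AV: "V \<subseteq> A" "open V" "x \<in> V"
      then obtain V' where V': "V' \<in> B" "x \<in> V'" "V' \<subseteq> V" using topological_basisE[OF B(2)] by metis
      then have "c V' \<in> D \<inter> A" using that c[of V'] AV unfolding D_def by blast
      then show "D \<inter> A \<noteq> {}" by blast
    qed
    then have "P \<subseteq> closure D" by blast
    moreover have "countable D" unfolding D_def using B(1) by simp
    moreover have "D \<subseteq> P" unfolding D_def using c by blast
    ultimately show ?thesis using that by blast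
  qed
  define S where "S = {s. \<forall>g\<in>P. g + s \<in> P}"
  have "S = (\<Inter>g\<in>P. (+) g -` P)" by (auto simp: S_def)
  then have "closed S" using cP by (auto intro!: closed_INT closed_vimage continuous_translate)
  moreover have "g + h \<in> S" if "g \<in> S" "h \<in> S" for g h
    using that by (auto simp: S_def add.assoc[symmetric])
  moreover have "AE s in \<theta>. s \<in> S"
  proof -
    have "AE s in \<theta>. g + s \<in> P" if "g \<in> D" for g
    proof -
      have "F g = 0" using that D by (auto simp: P_def)
      then have "(\<integral>\<^sup>+h. F (g + h) \<partial>\<theta>) = 0" using F by (simp add: nn_harmonic_def)
      then show ?thesis by (subst (asm) nn_integral_0_iff_AE) (auto simp: P_def)
    qed
    then have "AE s in \<theta>. \<forall>g\<in>D. g + s \<in> P" using D by (subst AE_ball_countable) auto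
    then show ?thesis
    proof eventually_elim
      fix s assume s: "\<forall>g\<in>D. g + s \<in> P"
      have "closed ((\<lambda>g. g + s) -` P)"
        by (intro closed_vimage cP continuous_on_add continuous_on_id continuous_on_const)
      then have "closure D \<subseteq> (\<lambda>g. g + s) -` P" using s by (intro closure_minimal) auto
      then show "s \<in> S" using D by (auto simp: S_def)
    qed
  qed
  ultimately have "S = UNIV" by (intro generating) auto
  then have "- g0 + g \<in> S" by simp
  moreover have "g0 \<in> P" using g0 by (simp add: P_def)
  ultimately have "g0 + (- g0 + g) \<in> P" unfolding S_def by blast
  then show ?thesis by (simp add: P_def add.assoc[symmetric])
qed

end

section \<open>Positive harmonic functions and their majorant\<close>

context measured_haar_group
begin

abbreviation "H \<equiv> normalized_positive_harmonic \<theta>"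
abbreviation "w \<equiv> harmonic_majorant \<theta>"

lemma H_D:
  assumes "u \<in> H"
  shows "u 0 = 1" "0 < u g" "u \<in> borel_measurable borel" "nn_harmonic (\<lambda>g. ennreal (u g))"
proof -
  have u: "harmonic \<theta> u" "\<And>g. 0 < u g" "u 0 = 1"
    using assms by (auto simp: normalized_positive_harmonic_def)
  then show "u 0 = 1" "0 < u g" "u \<in> borel_measurable borel" by (auto simp: harmonic_def)
  show "nn_harmonic (\<lambda>g. ennreal (u g))"
    unfolding nn_harmonic_def
  proof (intro conjI allI)
    fix g
    have "(\<integral>\<^sup>+h. ennreal (u (g + h)) \<partial>\<theta>) = ennreal (\<integral>h. u (g + h) \<partial>\<theta>)"
      using u by (intro nn_integral_eq_integral) (auto simp: harmonic_def less_imp_le)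
    then show "(\<integral>\<^sup>+h. ennreal (u (g + h)) \<partial>\<theta>) = ennreal (u g)" using u by (simp add: harmonic_def)
  qed (use u in \<open>auto simp: harmonic_def\<close>)
qed

text \<open>Strict positivity is not among the hypotheses: it comes from the minimum principle,
  since \<open>F\<close> does not vanish at \<open>0\<close>.\<close>

lemma H_I:
  assumes F: "nn_harmonic F" and fin: "\<And>g. F g < \<infinity>" and F0: "F 0 = 1"
  shows "(\<lambda>g. enn2real (F g)) \<in> H"
proof -
  have [measurable]: "F \<in> borel_measurable borel" using F by (simp add: nn_harmonic_def)
  have eq: "ennreal (enn2real (F g)) = F g" for g using fin[of g] by simp
  have "F g \<noteq> 0" for g using nn_harmonic_minimum_principle[OF F, of g 0] F0 by auto
  then have "0 < enn2real (F g)" for g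
    using fin[of g] by (simp add: enn2real_positive_iff zero_less_iff_neq_zero less_top)
  moreover have "has_bochner_integral \<theta> (\<lambda>h. enn2real (F (g + h))) (enn2real (F g))" for g
    using F by (intro has_bochner_integral_nn_integral) (auto simp: eq nn_harmonic_def)
  ultimately show ?thesis
    using F0 by (auto simp: normalized_positive_harmonic_def harmonic_def has_bochner_integral_iff)
qed

lemma le_majorant: "u \<in> H \<Longrightarrow> ennreal (u g) \<le> w g"
  unfolding harmonic_majorant_def by (rule SUP_upper)

text \<open>The average acts on the right, so left translates stay harmonic; the division restores
  the value 1 at \<open>0\<close>.\<close>

lemma H_shift:
  assumes "u \<in> H"
  shows "(\<lambda>h. u (g + h) / u g) \<in> H"
  using assms less_imp_neq[OF H_D(2)[OF assms, of g]]
  by (auto simp: normalized_positive_harmonic_def harmonic_def add.assoc[symmetric])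

lemma le_majorant_shift:
  assumes "u \<in> H"
  shows "ennreal (u (g + h)) \<le> ennreal (u g) * w h"
proof -
  have "ennreal (u (g + h)) = ennreal (u g) * ennreal (u (g + h) / u g)"
    using H_D(2)[OF assms, of g] H_D(2)[OF assms, of "g + h"] by (simp add: ennreal_mult[symmetric])
  also have "\<dots> \<le> ennreal (u g) * w h" by (intro mult_left_mono le_majorant H_shift assms) auto
  finally show ?thesis .
qed

lemma majorant_add_le: "w (g + h) \<le> w g * w h"
  unfolding harmonic_majorant_def[of _ "g + h"]
proof (rule SUP_least)
  fix u assume "u \<in> H"
  then show "ennreal (u (g + h)) \<le> w g * w h"
    by (intro order_trans[OF le_majorant_shift] mult_right_mono le_majorant) auto
qed

lemma closed_majorant_sublevel: "closed {g. w g \<le> c}"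
proof -
  have "{g. w g \<le> c} = (\<Inter>u\<in>H. {g. ennreal (u g) \<le> c})"
    by (auto simp: harmonic_majorant_def SUP_le_iff)
  then show ?thesis using closed_nn_harmonic_sublevel[OF H_D(4)] by (auto intro!: closed_INT)
qed

text \<open>The supremum runs over a possibly uncountable family, so measurability of its members
  would not suffice; closed sublevel sets do.\<close>

lemma measurable_majorant [measurable]: "w \<in> borel_measurable borel"
  by (rule borel_measurableI_le) (simp add: closed_majorant_sublevel borel_closed)

end

section \<open>Local boundedness of the majorant; equicontinuity and closedness of the set of
  harmonic functions\<close>

locale finite_majorant = measured_haar_group +
  assumes integral_majorant: "(\<integral>\<^sup>+g. w g \<partial>\<theta>) < \<infinity>"
begin

lemma AE_majorant_finite: "AE g in \<theta>. w g \<noteq> \<infinity>"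
  using integral_majorant by (intro nn_integral_PInf_AE) auto

text \<open>Some \<open>C n\<close> has positive Haar measure, for otherwise \<open>w\<close> would
  be infinite \<theta>-almost everywhere. The Steinhaus theorem puts an open set inside
  \<open>C n + C n\<close>, where submultiplicativity gives the bound \<open>n * n\<close>.\<close>

lemma majorant_bounded_somewhere:
  obtains U n where "open U" "U \<noteq> {}" "\<And>g. g \<in> U \<Longrightarrow> w g \<le> of_nat n"
proof -
  define C where "C n = {g. w g \<le> of_nat n}" for n :: nat
  have [measurable]: "C n \<in> sets borel" for n unfolding C_def by simp
  have "\<exists>n. emeasure m (C n) \<noteq> 0"
  proof (rule ccontr)
    assume "\<not> (\<exists>n. emeasure m (C n) \<noteq> 0)"
    then have "AE g in m. g \<notin> C n" for n by (intro AE_not_in) (auto simp: null_sets_def)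
    then have "AE g in m. \<forall>n. g \<notin> C n" by (simp add: AE_all_countable)
    then have "AE g in \<theta>. \<forall>n. g \<notin> C n" by (rule null_\<theta>)
    with AE_majorant_finite have "AE g in \<theta>. False"
    proof eventually_elim
      fix g assume *: "w g \<noteq> \<infinity>" "\<forall>n. g \<notin> C n"
      then obtain n where "w g < of_nat n" using ennreal_Ex_less_of_nat[of "w g"] by (auto simp: less_top)
      then have "g \<in> C n" by (simp add: C_def)
      then show False using * by blast
    qed
    then show False by simp
  qed
  then obtain n where n: "emeasure m (C n) \<noteq> 0" by blast
  obtain U where U: "open U" "U \<noteq> {}" "\<And>g. g \<in> U \<Longrightarrow> \<exists>a\<in>C n. \<exists>b\<in>C n. g = a + b"
    using steinhaus[OF _ _ n n] by auto
  have "w g \<le> of_nat (n * n)" if g: "g \<in> U" for g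
  proof -
    obtain a b where ab: "a \<in> C n" "b \<in> C n" "g = a + b" using U(3)[OF g] by blast
    have "w g \<le> w a * w b" using ab majorant_add_le by simp
    also have "\<dots> \<le> of_nat n * of_nat n" using ab by (intro mult_mono) (auto simp: C_def)
    finally show ?thesis by simp
  qed
  then show ?thesis using that U by blast
qed

text \<open>The finiteness set is a subsemigroup by submultiplicativity and has full
  \<theta>-measure by integrability. Admissibility speaks of closed subsemigroups, so at this stage
  it yields density only.\<close>

lemma dense_majorant_finite: "closure {g. w g < \<infinity>} = UNIV"
proof (rule generating)
  define S where "S = {g. w g < \<infinity>}"
  have add: "g + h \<in> S" if "g \<in> S" "h \<in> S" for g h
  proof -
    have "w g * w h < \<infinity>" using that by (simp add: S_def ennreal_mult_less_top)
    then show ?thesis using majorant_add_le[of g h] by (auto simp: S_def intro: le_less_trans)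
  qed
  fix g h assume gh: "g \<in> closure {g. w g < \<infinity>}" "h \<in> closure {g. w g < \<infinity>}"
  have 1: "s + h \<in> closure S" if "s \<in> S" for s
  proof -
    have "closure S \<subseteq> (+) s -` closure S"
      using that add closure_subset[of S]
      by (intro closure_minimal closed_vimage closed_closure continuous_translate) auto
    then show ?thesis using gh by (auto simp: S_def)
  qed
  have "closure S \<subseteq> (\<lambda>g. g + h) -` closure S"
    using 1 by (intro closure_minimal closed_vimage closed_closure continuous_on_add
        continuous_on_id continuous_on_const) auto
  then show "g + h \<in> closure {g. w g < \<infinity>}" using gh by (auto simp: S_def)
next
  show "AE g in \<theta>. g \<in> closure {g. w g < \<infinity>}"
    using AE_majorant_finite closure_subset[of "{g. w g < \<infinity>}"] by (auto simp: less_top)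
qed simp

text \<open>Density provides \<open>s\<close> with \<open>w s\<close> finite and
  \<open>- s + g\<close> in the open set \<open>U\<close> of bounded values. Translation by
  \<open>s\<close> carries \<open>U\<close> to a neighbourhood of \<open>g\<close>, on which
  \<open>w x\<close> is at most \<open>w s * w (- s + x)\<close>.\<close>

theorem majorant_locally_bounded:
  obtains V B where "open V" "g \<in> V" "0 < B" "\<And>x. x \<in> V \<Longrightarrow> w x \<le> ennreal B"
proof -
  obtain U n where U: "open U" "U \<noteq> {}" "\<And>g. g \<in> U \<Longrightarrow> w g \<le> of_nat n"
    using majorant_bounded_somewhere by metis
  have "open ((\<lambda>s. - s + g) -` U)"
    by (intro open_vimage U continuous_on_add continuous_on_minus continuous_on_id continuous_on_const)
  moreover have "(\<lambda>s. - s + g) -` U \<noteq> {}"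
  proof -
    obtain x where "x \<in> U" using U by blast
    then have "g + - x \<in> (\<lambda>s. - s + g) -` U" by (simp add: minus_add add.assoc)
    then show ?thesis by blast
  qed
  ultimately have "{g. w g < \<infinity>} \<inter> ((\<lambda>s. - s + g) -` U) \<noteq> {}"
    using dense_majorant_finite open_Int_closure_eq_empty by fastforce
  then obtain s where s: "w s < \<infinity>" "- s + g \<in> U" by auto
  \<comment> \<open>The summand 1 makes \<open>B\<close> positive.\<close>
  define B where "B = enn2real (w s * of_nat n) + 1"
  have fin: "w s * of_nat n < \<infinity>" using s by (simp add: ennreal_mult_less_top of_nat_less_top)
  show ?thesis
  proof (rule that[of "(\<lambda>x. - s + x) -` U" B])
    show "open ((\<lambda>x. - s + x) -` U)" by (intro open_vimage U continuous_translate)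
    show "g \<in> (\<lambda>x. - s + x) -` U" using s by simp
    show "0 < B" by (simp add: B_def add_nonneg_pos)
    fix x assume x: "x \<in> (\<lambda>x. - s + x) -` U"
    have "w x = w (s + (- s + x))" by (simp add: add.assoc[symmetric])
    also have "\<dots> \<le> w s * w (- s + x)" by (rule majorant_add_le)
    also have "\<dots> \<le> w s * of_nat n" using x U(3) by (intro mult_left_mono) auto
    also have "\<dots> = ennreal (enn2real (w s * of_nat n))" using fin by simp
    also have "\<dots> \<le> ennreal B" unfolding B_def by (intro ennreal_leI) simp
    finally show "w x \<le> ennreal B" .
  qed
qed

lemma majorant_finite: "w g < \<infinity>"
proof -
  obtain V B where "g \<in> V" "\<And>x. x \<in> V \<Longrightarrow> w x \<le> ennreal B" using majorant_locally_bounded by metis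
  then have "w g \<le> ennreal B" by blast
  also have "\<dots> < \<infinity>" by simp
  finally show ?thesis .
qed

text \<open>Split the mean value formula at the level \<open>w h \<le> N\<close>. As
  \<open>u (x + h)\<close> is at most \<open>w x * w h\<close>, the tail is small uniformly in
  \<open>u\<close>. The rest is a convolution with the truncated density \<open>k\<close>; where a
  translate of \<open>k\<close> by a point of \<open>V\<close> is nonzero, submultiplicativity
  bounds \<open>u\<close> by \<open>B * N\<close>, so \<open>nn_integral_shift_le\<close>
  applies.\<close>

theorem H_equicontinuous:
  assumes e: "0 < e"
  shows "\<forall>\<^sub>F x in nhds g. \<forall>u\<in>H. \<bar>u x - u g\<bar> < e"
proof -
  obtain f where f: "integrable m f" "\<And>h. 0 \<le> f h" "\<theta> = density m (\<lambda>h. ennreal (f h))"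
    using \<theta>_density by metis
  have [measurable]: "f \<in> borel_measurable borel" using f borel_measurable_integrable[of m f] by auto
  have \<theta>_int: "(\<integral>\<^sup>+h. F h \<partial>\<theta>) = (\<integral>\<^sup>+h. F h * ennreal (f h) \<partial>m)"
    if [measurable]: "F \<in> borel_measurable borel" for F
    by (subst f(3), subst nn_integral_density) (auto simp: mult.commute)
  obtain V B where V: "open V" "g \<in> V" "0 < B" "\<And>x. x \<in> V \<Longrightarrow> w x \<le> ennreal B"
    using majorant_locally_bounded by metis
  define r where "r N = (\<integral>\<^sup>+h. w h * indicator {h. of_nat N < w h} h \<partial>\<theta>)" for N :: nat
  have "r \<longlonglongrightarrow> (\<integral>\<^sup>+h. 0 \<partial>\<theta>)"
    unfolding r_def
  proof (rule nn_integral_dominated_convergence[where w=w])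
    show "AE h in \<theta>. (\<lambda>N. w h * indicator {h. of_nat N < w h} h) \<longlonglongrightarrow> 0"
    proof (rule AE_I2)
      fix h
      obtain N where N: "w h \<le> of_nat N"
        using ennreal_Ex_less_of_nat[of "w h"] majorant_finite[of h] by (auto dest: less_imp_le)
      have "\<forall>\<^sub>F n in sequentially. w h * indicator {h. of_nat n < w h} h = 0"
      proof (rule eventually_sequentiallyI)
        fix n assume "N \<le> n"
        then have "w h \<le> of_nat n" using N order_trans of_nat_mono by blast
        then show "w h * indicator {h. of_nat n < w h} h = 0" by simp
      qed
      then show "(\<lambda>N. w h * indicator {h. of_nat N < w h} h) \<longlonglongrightarrow> 0" by (rule tendsto_eventually)
    qed
  qed (use integral_majorant in \<open>auto split: split_indicator\<close>)
  then have "(\<lambda>N. ennreal B * r N) \<longlonglongrightarrow> ennreal B * 0" by (intro tendsto_mult_ennreal) auto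
  then have "\<forall>\<^sub>F N in sequentially. ennreal B * r N < ennreal e"
    using e by (intro order_tendstoD) auto
  then obtain N where N: "ennreal B * r N < ennreal e" by (auto simp: eventually_sequentially)
  define k where "k h = f h * indicator {h. w h \<le> of_nat N} h" for h
  have k: "integrable m k" "\<And>h. 0 \<le> k h"
  proof -
    show "integrable m k"
      unfolding k_def by (rule Bochner_Integration.integrable_bound[OF f(1)]) (auto split: split_indicator)
  qed (use f(2) in \<open>auto simp: k_def split: split_indicator\<close>)
  have [measurable]: "k \<in> borel_measurable borel" unfolding k_def by measurable
  \<comment> \<open>The error depends on \<open>x\<close> and \<open>y\<close> but not on
    \<open>u\<close>, which gives uniformity over \<open>H\<close>.\<close>
  define t where "t x y = ennreal B * of_nat N * L1_shift k (- x + y) + ennreal B * r N" for x y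
  have key: "ennreal (u x) \<le> ennreal (u y) + t x y" if x: "x \<in> V" and y: "y \<in> V" and u: "u \<in> H" for u x y
  proof -
    have [measurable]: "u \<in> borel_measurable borel" using H_D[OF u] by simp
    have dens: "(\<integral>\<^sup>+h. ennreal (u (z + h)) * indicator {h. w h \<le> of_nat N} h \<partial>\<theta>)
        = (\<integral>\<^sup>+h. ennreal (u (z + h)) * ennreal (k h) \<partial>m)" for z
      unfolding k_def
      by (subst \<theta>_int) (auto intro!: nn_integral_cong split: split_indicator)
    have "ennreal (u x) = (\<integral>\<^sup>+h. ennreal (u (x + h)) \<partial>\<theta>)"
      using H_D(4)[OF u] by (simp add: nn_harmonic_def)
    also have "\<dots> = (\<integral>\<^sup>+h. ennreal (u (x + h)) * indicator {h. w h \<le> of_nat N} h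
        + ennreal (u (x + h)) * indicator {h. of_nat N < w h} h \<partial>\<theta>)"
      by (intro nn_integral_cong) (auto split: split_indicator simp: not_le)
    also have "\<dots> = (\<integral>\<^sup>+h. ennreal (u (x + h)) * indicator {h. w h \<le> of_nat N} h \<partial>\<theta>)
        + (\<integral>\<^sup>+h. ennreal (u (x + h)) * indicator {h. of_nat N < w h} h \<partial>\<theta>)"
      by (rule nn_integral_add) auto
    also have "\<dots> \<le> (ennreal (u y) + ennreal B * of_nat N * L1_shift k (- x + y)) + ennreal B * r N"
    proof (rule add_mono)
      have bound: "ennreal (u h) \<le> ennreal B * of_nat N" if "z \<in> V" "k (- z + h) \<noteq> 0" for z h
      proof -
        have "w (- z + h) \<le> of_nat N" using that by (auto simp: k_def split: split_indicator_asm)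
        moreover have "ennreal (u h) \<le> w (z + (- z + h))"
          using le_majorant[OF u, of h] by (simp add: add.assoc[symmetric])
        ultimately show ?thesis
          using V(4)[OF that(1)] majorant_add_le[of z "- z + h"]
          by (meson mult_mono order_trans zero_le)
      qed
      have "(\<integral>\<^sup>+h. ennreal (u (x + h)) * indicator {h. w h \<le> of_nat N} h \<partial>\<theta>)
        \<le> (\<integral>\<^sup>+h. ennreal (u (y + h)) * ennreal (k h) \<partial>m) + ennreal B * of_nat N * L1_shift k (- x + y)"
        unfolding dens by (rule nn_integral_shift_le) (use k bound x y in auto)
      also have "(\<integral>\<^sup>+h. ennreal (u (y + h)) * ennreal (k h) \<partial>m) \<le> (\<integral>\<^sup>+h. ennreal (u (y + h)) \<partial>\<theta>)"
        unfolding dens[symmetric] by (intro nn_integral_mono) (auto split: split_indicator)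
      also have "\<dots> = ennreal (u y)" using H_D(4)[OF u] by (simp add: nn_harmonic_def)
      finally show "(\<integral>\<^sup>+h. ennreal (u (x + h)) * indicator {h. w h \<le> of_nat N} h \<partial>\<theta>)
        \<le> ennreal (u y) + ennreal B * of_nat N * L1_shift k (- x + y)" by simp
      have "(\<integral>\<^sup>+h. ennreal (u (x + h)) * indicator {h. of_nat N < w h} h \<partial>\<theta>)
        \<le> (\<integral>\<^sup>+h. ennreal B * (w h * indicator {h. of_nat N < w h} h) \<partial>\<theta>)"
        unfolding mult.assoc[symmetric]
      proof (intro nn_integral_mono mult_right_mono)
        fix h
        have "ennreal (u (x + h)) \<le> w x * w h" using le_majorant[OF u] majorant_add_le order_trans by blast
        also have "\<dots> \<le> ennreal B * w h" using V(4)[OF x] by (rule mult_right_mono) auto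
        finally show "ennreal (u (x + h)) \<le> ennreal B * w h" .
      qed auto
      also have "\<dots> = ennreal B * r N" unfolding r_def by (rule nn_integral_cmult) auto
      finally show "(\<integral>\<^sup>+h. ennreal (u (x + h)) * indicator {h. of_nat N < w h} h \<partial>\<theta>) \<le> ennreal B * r N" .
    qed
    finally show ?thesis by (simp add: t_def add.assoc)
  qed
  show ?thesis
    unfolding eventually_nhds_iff_sequentially
  proof (intro allI impI)
    fix X assume X: "X \<longlonglongrightarrow> g"
    have lim: "(\<lambda>n. ennreal B * of_nat N * L n + ennreal B * r N) \<longlonglongrightarrow> ennreal B * of_nat N * 0 + ennreal B * r N"
      if "L \<longlonglongrightarrow> 0" for L
      by (intro tendsto_add tendsto_const tendsto_mult_ennreal that) (auto simp: ennreal_mult_eq_top_iff)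
    have "\<forall>\<^sub>F n in sequentially. t g (X n) < ennreal e" "\<forall>\<^sub>F n in sequentially. t (X n) g < ennreal e"
      unfolding t_def
      by (rule order_tendstoD(2)[OF lim[OF L1_shift_tendsto(1)[OF k(1) X]]], use N in simp)
         (rule order_tendstoD(2)[OF lim[OF L1_shift_tendsto(2)[OF k(1) X]]], use N in simp)
    moreover have "\<forall>\<^sub>F n in sequentially. X n \<in> V" using X V by (intro topological_tendstoD) auto
    ultimately show "\<forall>\<^sub>F n in sequentially. \<forall>u\<in>H. \<bar>u (X n) - u g\<bar> < e"
    proof eventually_elim
      fix n assume *: "t g (X n) < ennreal e" "t (X n) g < ennreal e" "X n \<in> V"
      have less: "u x < u y + e" if "t x y < ennreal e" "x \<in> V" "y \<in> V" "u \<in> H" for x y u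
      proof -
        have "ennreal (u x) \<le> ennreal (u y) + t x y" using key that by blast
        also have "\<dots> < ennreal (u y) + ennreal e" using that by (simp add: ennreal_add_left_cancel_less)
        also have "\<dots> = ennreal (u y + e)" using H_D(2)[OF that(4), of y] e by (simp add: ennreal_plus)
        finally show ?thesis using H_D(2)[OF that(4), of x] by (simp add: ennreal_less_iff)
      qed
      show "\<forall>u\<in>H. \<bar>u (X n) - u g\<bar> < e"
      proof
        fix u assume "u \<in> H"
        then show "\<bar>u (X n) - u g\<bar> < e" using less[of g "X n" u] less[of "X n" g u] * V(2) by auto
      qed
    qed
  qed
qed

text \<open>Dominated convergence with the dominating function \<open>w g * w h\<close> carries the
  mean value equation to the limit. A limit of positive functions might acquire zeros;
  \<open>H_I\<close> excludes them.\<close>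

lemma H_limit:
  assumes u: "\<And>n. u n \<in> H" and lim: "\<And>g. (\<lambda>n. u n g) \<longlonglongrightarrow> v g"
  shows "v \<in> H"
proof -
  have [measurable]: "u n \<in> borel_measurable borel" for n using H_D(3)[OF u] .
  have [measurable]: "v \<in> borel_measurable borel" by (rule borel_measurable_LIMSEQ_real[OF lim]) simp
  have lim': "(\<lambda>n. ennreal (u n g)) \<longlonglongrightarrow> ennreal (v g)" for g by (intro tendsto_ennrealI lim)
  have "nn_harmonic (\<lambda>g. ennreal (v g))"
    unfolding nn_harmonic_def
  proof (intro conjI allI)
    fix g
    have "(\<lambda>n. \<integral>\<^sup>+h. ennreal (u n (g + h)) \<partial>\<theta>) \<longlonglongrightarrow> (\<integral>\<^sup>+h. ennreal (v (g + h)) \<partial>\<theta>)"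
    proof (rule nn_integral_dominated_convergence[where w="\<lambda>h. w g * w h"])
      show "AE h in \<theta>. ennreal (u j (g + h)) \<le> w g * w h" for j
        using le_majorant[OF u] majorant_add_le by (intro AE_I2) (blast intro: order_trans)
      show "(\<integral>\<^sup>+h. w g * w h \<partial>\<theta>) < \<infinity>"
        using integral_majorant majorant_finite[of g] by (simp add: nn_integral_cmult ennreal_mult_less_top)
    qed (auto intro!: lim')
    then have "(\<lambda>n. ennreal (u n g)) \<longlonglongrightarrow> (\<integral>\<^sup>+h. ennreal (v (g + h)) \<partial>\<theta>)"
      using H_D(4)[OF u] by (simp add: nn_harmonic_def)
    then show "(\<integral>\<^sup>+h. ennreal (v (g + h)) \<partial>\<theta>) = ennreal (v g)" using lim' LIMSEQ_unique by blast
  qed simp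
  moreover have v0: "v 0 = 1" using LIMSEQ_unique[OF lim[of 0]] H_D(1)[OF u] by simp
  ultimately have "(\<lambda>g. enn2real (ennreal (v g))) \<in> H" by (intro H_I) auto
  moreover have "0 \<le> v g" for g
    by (rule LIMSEQ_le_const[OF lim]) (use H_D(2)[OF u] in \<open>auto intro: less_imp_le\<close>)
  ultimately show ?thesis by simp
qed

end

section \<open>The compact model\<close>

lemma minus_add_add: "- (g + h) + x = - h + (- g + x)" for g h x :: "'a::group_add"
  by (simp only: minus_add add.assoc)

lemma diff_add_assoc_uminus: "(a - b) + x = a + (- b + x)" for a b x :: "'a::group_add"
  by (simp only: diff_conv_add_uminus add.assoc)

lemma tendsto_fun_iff:
  fixes f :: "'b \<Rightarrow> 'a \<Rightarrow> 'c::topological_space"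
  shows "(f \<longlongrightarrow> l) F \<longleftrightarrow> (\<forall>i. ((\<lambda>n. f n i) \<longlongrightarrow> l i) F)"
proof -
  have "(f \<longlongrightarrow> l) F \<longleftrightarrow> limitin (product_topology (\<lambda>i. euclidean) UNIV) f l F"
    by (simp add: euclidean_product_topology)
  also have "\<dots> \<longleftrightarrow> (\<forall>i. ((\<lambda>n. f n i) \<longlongrightarrow> l i) F)"
    by (subst limitin_componentwise) auto
  finally show ?thesis .
qed

locale rn_model = finite_majorant m \<theta> for m \<theta> :: "'g::{topological_group_add, second_countable_topology, t2_space} measure" +
  fixes W :: "nat \<Rightarrow> 'g set" and q :: "nat \<Rightarrow> 'g"
  assumes W_open: "\<And>i. open (W i)" and W_finite: "\<And>i. emeasure m (W i) < \<infinity>"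
    and W_cover: "(\<Union>i. W i) = UNIV" and W_generate: "sets borel = sigma_sets UNIV (range W)"
    and W_Int_stable: "Int_stable (range W)"
    and q_dense: "\<And>U. open U \<Longrightarrow> U \<noteq> {} \<Longrightarrow> \<exists>j. q j \<in> U"
begin

text \<open>These play the role of the unit ball of \<open>L\<^sup>\<infinity>(G)\<close> with the weak-* topology: a bounded function \<open>F\<close> is
  recorded through its integrals over the translates of \<open>W j\<close>.\<close>

definition V :: "nat \<Rightarrow> ('g \<Rightarrow> real) set" where
  "V j = {v. \<forall>g. 0 \<le> v g \<and> v g \<le> measure m (W j) \<and>
     (\<forall>g'. ennreal \<bar>v g' - v g\<bar> \<le> L1_shift (indicator (W j)) (- g + g'))}"

text \<open>The first component of \<open>prod_decode k\<close> is discarded, so every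
  \<open>V j\<close> is repeated infinitely often: the model must not depend on the stationary
  space, yet needs room for a separating sequence of each.\<close>

definition \<F> :: "nat \<Rightarrow> ('g \<Rightarrow> real) set" where
  "\<F> i = (case i of 0 \<Rightarrow> H | Suc k \<Rightarrow> V (snd (prod_decode k)))"

lemma V_equicontinuous:
  assumes "0 < e"
  shows "\<forall>\<^sub>F x in nhds g. \<forall>v\<in>V j. \<bar>v x - v g\<bar> < e"
  unfolding eventually_nhds_iff_sequentially
proof (intro allI impI)
  fix X assume X: "X \<longlonglongrightarrow> g"
  have "integrable m (indicator (W j) :: 'g \<Rightarrow> real)" using W_open[of j] W_finite[of j] by simp
  from L1_shift_tendsto(1)[OF this X]
  have "\<forall>\<^sub>F n in sequentially. L1_shift (indicator (W j)) (- g + X n) < ennreal e"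
    using assms by (intro order_tendstoD) auto
  then show "\<forall>\<^sub>F n in sequentially. \<forall>v\<in>V j. \<bar>v (X n) - v g\<bar> < e"
  proof eventually_elim
    fix n assume n: "L1_shift (indicator (W j)) (- g + X n) < ennreal e"
    show "\<forall>v\<in>V j. \<bar>v (X n) - v g\<bar> < e"
    proof
      fix v assume "v \<in> V j"
      then have "ennreal \<bar>v (X n) - v g\<bar> < ennreal e" using n by (auto simp: V_def intro: le_less_trans)
      then show "\<bar>v (X n) - v g\<bar> < e" by (simp add: ennreal_less_iff)
    qed
  qed
qed

lemma V_limit:
  assumes v: "\<And>n. v n \<in> V j" and lim: "\<And>g. (\<lambda>n. v n g) \<longlonglongrightarrow> l g"
  shows "l \<in> V j"
  unfolding V_def
proof (intro CollectI allI conjI)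
  fix g g'
  show "0 \<le> l g" by (rule LIMSEQ_le_const[OF lim]) (use v in \<open>auto simp: V_def\<close>)
  show "l g \<le> measure m (W j)" by (rule LIMSEQ_le_const2[OF lim]) (use v in \<open>auto simp: V_def\<close>)
  have "(\<lambda>n. ennreal \<bar>v n g' - v n g\<bar>) \<longlonglongrightarrow> ennreal \<bar>l g' - l g\<bar>"
    by (intro tendsto_ennrealI tendsto_rabs tendsto_diff lim)
  then show "ennreal \<bar>l g' - l g\<bar> \<le> L1_shift (indicator (W j)) (- g + g')"
    by (rule LIMSEQ_le_const2) (use v in \<open>auto simp: V_def\<close>)
qed

text \<open>The modulus of continuity in \<open>V\<close> depends only on \<open>- g + g'\<close>,
  which left translation leaves unchanged.\<close>

lemma V_translate:
  assumes "v \<in> V j"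
  shows "(\<lambda>h. v (g + h)) \<in> V j"
proof -
  have "- (g + h) + (g + h') = - h + h'" for h h'
    by (simp only: minus_add_add minus_add_cancel)
  note eq = this
  show ?thesis
    unfolding V_def
  proof (intro CollectI allI conjI)
    fix h h'
    show "0 \<le> v (g + h)" "v (g + h) \<le> measure m (W j)" using assms by (auto simp: V_def)
    have "ennreal \<bar>v (g + h') - v (g + h)\<bar> \<le> L1_shift (indicator (W j)) (- (g + h) + (g + h'))"
      using assms unfolding V_def by blast
    then show "ennreal \<bar>v (g + h') - v (g + h)\<bar> \<le> L1_shift (indicator (W j)) (- h + h')"
      unfolding eq .
  qed
qed

lemma \<F>_equicontinuous: "0 < e \<Longrightarrow> \<forall>\<^sub>F x in nhds g. \<forall>v\<in>\<F> i. \<bar>v x - v g\<bar> < e"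
  using H_equicontinuous V_equicontinuous by (auto simp: \<F>_def split: nat.split)

lemma \<F>_limit:
  assumes "\<And>n. v n \<in> \<F> i" "\<And>g. (\<lambda>n. v n g) \<longlonglongrightarrow> l g"
  shows "l \<in> \<F> i"
  using assms H_limit[of v l] V_limit[of v _ l] by (auto simp: \<F>_def split: nat.splits)

lemma \<F>_bounded: "\<exists>b. \<forall>v\<in>\<F> i. \<bar>v g\<bar> \<le> b"
proof (cases i)
  case 0
  have "\<bar>u g\<bar> \<le> enn2real (w g)" if "u \<in> H" for u
    using le_majorant[OF that, of g] majorant_finite[of g] H_D(2)[OF that, of g]
    by (metis abs_of_pos enn2real_ennreal enn2real_mono infinity_ennreal_def less_imp_le)
  then show ?thesis using 0 by (auto simp: \<F>_def)
next
  case (Suc k)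
  then show ?thesis by (auto simp: \<F>_def V_def intro!: exI[of _ "measure m (W (snd (prod_decode k)))"])
qed

lemma \<F>_dense_approx:
  assumes "0 < e"
  obtains j where "\<And>v. v \<in> \<F> i \<Longrightarrow> \<bar>v (q j) - v g\<bar> < e"
proof -
  obtain U where U: "open U" "g \<in> U" "\<And>x. x \<in> U \<Longrightarrow> \<forall>v\<in>\<F> i. \<bar>v x - v g\<bar> < e"
    using \<F>_equicontinuous[OF assms, where g=g and i=i] unfolding eventually_nhds by blast
  then obtain j where "q j \<in> U" using q_dense[of U] by blast
  then show ?thesis using that U by blast
qed

lemma \<F>_eqI:
  assumes uv: "u \<in> \<F> i" "v \<in> \<F> i" and eq: "\<And>j. u (q j) = v (q j)"
  shows "u = v"
proof
  fix g
  have "\<bar>u g - v g\<bar> \<le> e" if e: "0 < e" for e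
  proof -
    obtain j where "\<And>v. v \<in> \<F> i \<Longrightarrow> \<bar>v (q j) - v g\<bar> < e / 2" using \<F>_dense_approx[of "e / 2"] e by auto
    from this[OF uv(1)] this[OF uv(2)] eq[of j] show ?thesis by (simp add: abs_if split: if_splits)
  qed
  then have "\<bar>u g - v g\<bar> \<le> 0" by (rule field_le_epsilon) auto
  then show "u g = v g" by simp
qed

text \<open>A suitable \<open>q j\<close> approximates the value at \<open>g\<close> for all members
  of \<open>\<F> i\<close> simultaneously, so the Cauchy property passes from \<open>q j\<close> to
  \<open>g\<close>.\<close>

lemma \<F>_convergent:
  assumes u: "\<And>n. u n \<in> \<F> i" and conv: "\<And>j. convergent (\<lambda>n. u n (q j))"
  shows "convergent (\<lambda>n. u n g)"
proof -
  have "Cauchy (\<lambda>n. u n g)"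
    unfolding Cauchy_def dist_real_def
  proof (intro allI impI)
    fix e :: real assume e: "0 < e"
    obtain j where j: "\<And>v. v \<in> \<F> i \<Longrightarrow> \<bar>v (q j) - v g\<bar> < e / 3"
      using \<F>_dense_approx[of "e / 3"] e by auto
    obtain M where M: "\<And>n k. n \<ge> M \<Longrightarrow> k \<ge> M \<Longrightarrow> \<bar>u n (q j) - u k (q j)\<bar> < e / 3"
      using convergent_Cauchy[OF conv[of j]] e unfolding Cauchy_def dist_real_def
      by (metis divide_pos_pos zero_less_numeral)
    have "\<bar>u n g - u k g\<bar> < e" if "n \<ge> M" "k \<ge> M" for n k
      using M[OF that] j[OF u, of n] j[OF u, of k] by linarith
    then show "\<exists>M. \<forall>n\<ge>M. \<forall>k\<ge>M. \<bar>u n g - u k g\<bar> < e" by blast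
  qed
  then show ?thesis by (rule Cauchy_convergent)
qed

text \<open>The argument \<open>X n\<close> may move together with the function; this is what makes
  the action and the cocycle jointly continuous. Equicontinuity makes the change from
  \<open>X n\<close> to \<open>g\<close> negligible uniformly in the function.\<close>

lemma \<F>_tendsto:
  assumes u: "\<And>n. u n \<in> \<F> i" and v: "v \<in> \<F> i" and lim: "\<And>j. (\<lambda>n. u n (q j)) \<longlonglongrightarrow> v (q j)"
    and X: "X \<longlonglongrightarrow> g"
  shows "(\<lambda>n. u n (X n)) \<longlonglongrightarrow> v g"
proof -
  define l where "l g = lim (\<lambda>n. u n g)" for g
  have "convergent (\<lambda>n. u n g)" for g
    by (rule \<F>_convergent[OF u]) (use lim in \<open>auto simp: convergent_def\<close>)
  then have l: "(\<lambda>n. u n g) \<longlonglongrightarrow> l g" for g by (simp add: l_def convergent_LIMSEQ_iff)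
  have "l = v"
    by (rule \<F>_eqI[OF \<F>_limit[OF u l] v]) (use LIMSEQ_unique[OF l lim] in blast)
  then have ug: "(\<lambda>n. u n g) \<longlonglongrightarrow> v g" using l by simp
  have "(\<lambda>n. u n (X n) - u n g) \<longlonglongrightarrow> 0"
  proof (rule tendstoI)
    fix e :: real assume "0 < e"
    then have "\<forall>\<^sub>F n in sequentially. \<forall>v\<in>\<F> i. \<bar>v (X n) - v g\<bar> < e"
      using \<F>_equicontinuous X unfolding eventually_nhds_iff_sequentially by blast
    then show "\<forall>\<^sub>F n in sequentially. dist (u n (X n) - u n g) 0 < e"
      by eventually_elim (use u in auto)
  qed
  from tendsto_add[OF this ug] show ?thesis by simp
qed

section \<open>Compactness of the product in coordinates along the dense sequence\<close>

definition \<Z> :: "(nat \<Rightarrow> 'g \<Rightarrow> real) set" where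
  "\<Z> = {z. \<forall>i. z i \<in> \<F> i}"

text \<open>The space \<open>\<Z>\<close> is a product of equicontinuous families, so a point is determined by its values on the
  dense sequence \<open>q\<close>, and pointwise convergence is convergence of these coordinates.\<close>

definition code :: "(nat \<Rightarrow> 'g \<Rightarrow> real) \<Rightarrow> nat \<Rightarrow> real" where
  "code z n = z (fst (prod_decode n)) (q (snd (prod_decode n)))"

definition K :: "(nat \<Rightarrow> real) set" where
  "K = code ` \<Z>"

definition decode :: "(nat \<Rightarrow> real) \<Rightarrow> nat \<Rightarrow> 'g \<Rightarrow> real" where
  "decode = inv_into \<Z> code"

lemma code_encode: "code z (prod_encode (i, j)) = z i (q j)"
  by (simp add: code_def)

lemma inj_code: "inj_on code \<Z>"
proof (rule inj_onI)
  fix y z assume yz: "y \<in> \<Z>" "z \<in> \<Z>" "code y = code z"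
  show "y = z"
  proof
    fix i
    show "y i = z i"
      by (rule \<F>_eqI[of _ i]) (use yz code_encode in \<open>auto simp: \<Z>_def, metis\<close>)
  qed
qed

lemma decode_code: "z \<in> \<Z> \<Longrightarrow> decode (code z) = z"
  using inj_code by (simp add: decode_def)

lemma decode_in: "f \<in> K \<Longrightarrow> decode f \<in> \<Z>"
  by (auto simp: K_def decode_code)

lemma code_decode: "f \<in> K \<Longrightarrow> code (decode f) = f"
  by (auto simp: K_def decode_code)

lemma decode_tendsto:
  assumes "\<And>n. f n \<in> K" "f0 \<in> K" "f \<longlonglongrightarrow> f0" "X \<longlonglongrightarrow> g"
  shows "(\<lambda>n. decode (f n) i (X n)) \<longlonglongrightarrow> decode f0 i g"
proof (rule \<F>_tendsto[of _ i])
  show "decode (f n) i \<in> \<F> i" for n using decode_in[OF assms(1)] by (simp add: \<Z>_def)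
  show "decode f0 i \<in> \<F> i" using decode_in[OF assms(2)] by (simp add: \<Z>_def)
  fix j
  have "decode f i (q j) = f (prod_encode (i, j))" if "f \<in> K" for f
    using code_encode[of "decode f" i j] code_decode[OF that] by simp
  then show "(\<lambda>n. decode (f n) i (q j)) \<longlonglongrightarrow> decode f0 i (q j)"
    using assms tendsto_fun_iff[of f f0] by simp
qed fact

text \<open>The coordinates are bounded one by one, so \<open>K\<close> lies in a product of
  intervals. For closedness, convergence along \<open>q\<close> extends to pointwise convergence on
  the group, and each \<open>\<F> i\<close> is closed under pointwise limits.\<close>

theorem compact_K: "compact K"
proof -
  obtain b where b: "\<And>i g v. v \<in> \<F> i \<Longrightarrow> \<bar>v g\<bar> \<le> b i g" using \<F>_bounded by metis
  define c where "c n = b (fst (prod_decode n)) (q (snd (prod_decode n)))" for n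
  have "compactin (product_topology (\<lambda>_. euclidean) UNIV) (PiE UNIV (\<lambda>n. {- c n..c n}))"
    by (subst compactin_PiE) auto
  then have comp: "compact (PiE UNIV (\<lambda>n. {- c n..c n}))" by (simp add: euclidean_product_topology)
  have "K \<subseteq> PiE UNIV (\<lambda>n. {- c n..c n})"
  proof
    fix f assume "f \<in> K"
    then obtain z where z: "z \<in> \<Z>" "f = code z" by (auto simp: K_def)
    have "\<bar>f n\<bar> \<le> c n" for n using z b by (simp add: code_def c_def \<Z>_def)
    then show "f \<in> PiE UNIV (\<lambda>n. {- c n..c n})" by (simp add: abs_le_iff minus_le_iff PiE_iff)
  qed
  moreover have "closed K"
    unfolding closed_sequential_limits
  proof (intro allI impI, elim conjE)
    fix f l assume f: "\<forall>n. f n \<in> K" and lim: "f \<longlonglongrightarrow> l"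
    have F: "decode (f n) i \<in> \<F> i" for n i using decode_in f by (auto simp: \<Z>_def)
    have val: "decode (f n) i (q j) = f n (prod_encode (i, j))" for n i j
      using code_encode[of "decode (f n)" i j] code_decode f by simp
    have limj: "(\<lambda>n. decode (f n) i (q j)) \<longlonglongrightarrow> l (prod_encode (i, j))" for i j
      using lim unfolding val tendsto_fun_iff by blast
    define z where "z i g = lim (\<lambda>n. decode (f n) i g)" for i g
    have "convergent (\<lambda>n. decode (f n) i g)" for i g
      by (rule \<F>_convergent[OF F]) (use limj in \<open>auto simp: convergent_def\<close>)
    then have z: "(\<lambda>n. decode (f n) i g) \<longlonglongrightarrow> z i g" for i g by (simp add: z_def convergent_LIMSEQ_iff)
    have "z i \<in> \<F> i" for i by (rule \<F>_limit[OF F z])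
    then have "z \<in> \<Z>" by (simp add: \<Z>_def)
    moreover have "code z = l"
    proof
      fix n
      have "z i (q j) = l (prod_encode (i, j))" for i j using LIMSEQ_unique[OF z limj] by blast
      then show "code z n = l n" by (simp add: code_def)
    qed
    ultimately show "l \<in> K" unfolding K_def by blast
  qed
  ultimately show ?thesis using compact_Int_closed[OF comp] by (metis inf.absorb2)
qed

text \<open>Translation by \<open>g\<close>, renormalised in coordinate 0 so that the value at the
  identity stays 1. The normalising factor \<open>z 0 (- g)\<close> is the cocycle, and its
  multiplicativity is the associativity of this action.\<close>

definition act :: "'g \<Rightarrow> (nat \<Rightarrow> 'g \<Rightarrow> real) \<Rightarrow> nat \<Rightarrow> 'g \<Rightarrow> real" where
  "act g z = (\<lambda>i h. if i = 0 then z 0 (- g + h) / z 0 (- g) else z i (- g + h))"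

lemma \<Z>_0: "z \<in> \<Z> \<Longrightarrow> z 0 \<in> H"
  by (auto simp: \<Z>_def \<F>_def dest: spec[of _ 0])

lemma act_in: "z \<in> \<Z> \<Longrightarrow> act g z \<in> \<Z>"
  using H_shift[of "z 0" "- g"] V_translate[of _ _ "- g"] \<Z>_0[of z]
  by (auto simp: \<Z>_def \<F>_def act_def split: nat.splits)

lemma act_0: "z \<in> \<Z> \<Longrightarrow> act 0 z = z"
  using H_D(1)[OF \<Z>_0[of z]] by (auto simp: act_def fun_eq_iff)

lemma act_add: "z \<in> \<Z> \<Longrightarrow> act (g + h) z = act g (act h z)"
  using H_D(2)[OF \<Z>_0, of z] by (auto simp: act_def fun_eq_iff minus_add diff_add_assoc_uminus less_imp_neq[symmetric])

definition b :: "'g \<Rightarrow> (nat \<Rightarrow> real) \<Rightarrow> nat \<Rightarrow> real" where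
  "b g f = code (act g (decode f))"

definition \<eta> :: "'g \<Rightarrow> (nat \<Rightarrow> real) \<Rightarrow> real" where
  "\<eta> g f = decode f 0 (- g)"

lemma b_in: "f \<in> K \<Longrightarrow> b g f \<in> K"
  by (simp add: b_def K_def act_in decode_in[unfolded K_def])

lemma b_code: "z \<in> \<Z> \<Longrightarrow> b g (code z) = code (act g z)"
  by (simp add: b_def decode_code)

lemma \<eta>_code: "z \<in> \<Z> \<Longrightarrow> \<eta> g (code z) = z 0 (- g)"
  by (simp add: \<eta>_def decode_code)

lemma decode_b: "f \<in> K \<Longrightarrow> decode (b g f) = act g (decode f)"
  by (simp add: b_def decode_code act_in decode_in)

lemma continuous_\<eta>: "continuous_on (UNIV \<times> K) (\<lambda>(g, f). \<eta> g f)"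
proof (rule continuous_on_sequentiallyI)
  fix u :: "nat \<Rightarrow> 'g \<times> (nat \<Rightarrow> real)" and a assume u: "\<forall>n. u n \<in> UNIV \<times> K" "a \<in> UNIV \<times> K" "u \<longlonglongrightarrow> a"
  have "(\<lambda>n. decode (snd (u n)) 0 (- fst (u n))) \<longlonglongrightarrow> decode (snd a) 0 (- fst a)"
    by (rule decode_tendsto) (use u in \<open>auto intro!: tendsto_minus tendsto_fst tendsto_snd simp: mem_Times_iff\<close>)
  then show "(\<lambda>n. case u n of (g, f) \<Rightarrow> \<eta> g f) \<longlonglongrightarrow> (case a of (g, f) \<Rightarrow> \<eta> g f)"
    by (simp add: case_prod_beta \<eta>_def)
qed

lemma continuous_b: "continuous_on (UNIV \<times> K) (\<lambda>(g, f). b g f)"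
proof (rule continuous_on_sequentiallyI)
  fix u :: "nat \<Rightarrow> 'g \<times> (nat \<Rightarrow> real)" and a assume u: "\<forall>n. u n \<in> UNIV \<times> K" "a \<in> UNIV \<times> K" "u \<longlonglongrightarrow> a"
  have lim: "(\<lambda>n. decode (snd (u n)) i (X n)) \<longlonglongrightarrow> decode (snd a) i x" if "X \<longlonglongrightarrow> x" for X x i
    by (rule decode_tendsto) (use u that in \<open>auto intro!: tendsto_snd simp: mem_Times_iff\<close>)
  have inv: "(\<lambda>n. - fst (u n)) \<longlonglongrightarrow> - fst a" by (intro tendsto_minus tendsto_fst u)
  have inv': "(\<lambda>n. - fst (u n) + h) \<longlonglongrightarrow> - fst a + h" for h by (intro tendsto_add inv tendsto_const)
  \<comment> \<open>The normalising factor is positive at the limit point, so the quotients in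
    coordinate 0 converge.\<close>
  have "decode (snd a) 0 (- fst a) \<noteq> 0"
    using H_D(2)[OF \<Z>_0[OF decode_in], of "snd a" "- fst a"] u(2) by auto
  then have "(\<lambda>n. act (fst (u n)) (decode (snd (u n))) i h) \<longlonglongrightarrow> act (fst a) (decode (snd a)) i h" for i h
    using lim[OF inv] lim[OF inv'] by (auto simp: act_def intro!: tendsto_divide)
  then show "(\<lambda>n. case u n of (g, f) \<Rightarrow> b g f) \<longlonglongrightarrow> (case a of (g, f) \<Rightarrow> b g f)"
    unfolding tendsto_fun_iff case_prod_beta b_def code_def by blast
qed

abbreviation "Z \<equiv> top_of_set K"

lemma prod_topology_Z: "prod_topology euclidean Z = top_of_set (UNIV \<times> K)"
  by (metis euclidean_product_topology prod_topology_subtopology(2) subtopology_UNIV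
      prod_topology_subtopology_eu subtopology_Times)

theorem compact_G_space_Z: "compact_G_space Z b"
  unfolding compact_G_space_def
proof (intro conjI)
  show "compact_space Z" using compact_K by (simp add: compact_space_subtopology)
  show "metrizable_space Z" by (simp add: metrizable_space_subtopology metrizable_space_euclidean)
  show "continuous_map (prod_topology euclidean Z) Z (\<lambda>(g, z). b g z)"
    unfolding prod_topology_Z continuous_map_subtopology_eu using continuous_b b_in
    by (auto simp: continuous_map_in_subtopology)
qed (auto simp: b_def act_0 decode_in code_decode act_add decode_code act_in)

theorem continuous_harmonic_cocycle_Z: "continuous_harmonic_cocycle \<theta> Z b \<eta>"
  unfolding continuous_harmonic_cocycle_def
proof (intro conjI allI ballI)
  show "continuous_map (prod_topology euclidean Z) euclideanreal (\<lambda>(g, z). \<eta> g z)"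
    unfolding prod_topology_Z using continuous_\<eta> by simp
  fix z assume "z \<in> topspace Z"
  then have z: "z \<in> K" by simp
  have H: "decode z 0 \<in> H" using \<Z>_0 decode_in z by blast
  show "0 < \<eta> g z" for g using H_D(2)[OF H] by (simp add: \<eta>_def)
  show "\<eta> (g + h) z = \<eta> g (b h z) * \<eta> h z" for g h
    using H_D(2)[OF H, of "- h"] by (simp add: \<eta>_def decode_b z act_def minus_add)
  show "harmonic \<theta> (\<lambda>g. \<eta> (- g) z)"
    using H by (simp add: \<eta>_def normalized_positive_harmonic_def)
qed

end

section \<open>Radon-Nikodym cocycles of stationary spaces\<close>

locale stationary_system = finite_majorant m \<theta>
  for m \<theta> :: "'g::{topological_group_add, second_countable_topology, t2_space} measure" +
  fixes M :: "'x measure" and a :: "'g \<Rightarrow> 'x \<Rightarrow> 'x"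
  assumes stationary: "stationary_space \<theta> M a"
begin

sublocale M: prob_space M
  using stationary by (simp add: stationary_space_def stationary_measure_def)

lemma measurable_action [measurable]: "(\<lambda>(g, x). a g x) \<in> measurable (borel \<Otimes>\<^sub>M M) M"
  and action_0: "x \<in> space M \<Longrightarrow> a 0 x = x"
  and action_add: "x \<in> space M \<Longrightarrow> a (g + h) x = a g (a h x)"
  using stationary by (auto simp: stationary_space_def borel_action_def)

lemma measurable_action_compose [measurable (raw)]:
  assumes [measurable]: "f \<in> measurable N borel" "k \<in> measurable N M"
  shows "(\<lambda>y. a (f y) (k y)) \<in> measurable N M"
  using measurable_compose[OF measurable_Pair[OF assms] measurable_action] by simp

lemma action_space: "x \<in> space M \<Longrightarrow> a g x \<in> space M"
  by (rule measurable_space[of "a g" M M]) auto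

sublocale mM: pair_sigma_finite m M ..
sublocale \<theta>M: pair_sigma_finite \<theta> M ..

definition T :: "'g \<Rightarrow> 'x measure" where
  "T g = distr M M (a g)"

lemma sets_T [measurable_cong, simp]: "sets (T g) = sets M"
  and space_T [simp]: "space (T g) = space M"
  by (auto simp: T_def)

lemma T_0: "T 0 = M"
proof -
  have "T 0 = distr M M (\<lambda>x. x)" unfolding T_def by (rule distr_cong) (auto simp: action_0)
  then show ?thesis by simp
qed

lemma T_add: "T (g + h) = distr (T h) M (a g)"
  unfolding T_def by (subst distr_distr) (auto intro!: distr_cong simp: action_add)

lemma prob_space_T: "prob_space (T g)"
  unfolding T_def by (rule M.prob_space_distr) simp

lemma measurable_emeasure_T_Pair [measurable]:
  assumes B: "B \<in> sets (borel \<Otimes>\<^sub>M M)"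
  shows "(\<lambda>g. emeasure (T g) (Pair g -` B)) \<in> borel_measurable borel"
proof -
  have \<Phi>: "(\<lambda>(g, x). (g, a g x)) \<in> measurable (borel \<Otimes>\<^sub>M M) (borel \<Otimes>\<^sub>M M)"
    unfolding case_prod_beta by measurable
  have "emeasure (T g) (Pair g -` B)
      = emeasure M (Pair g -` ((\<lambda>(g, x). (g, a g x)) -` B \<inter> space (borel \<Otimes>\<^sub>M M)))" for g
    unfolding T_def using sets_Pair1[OF B, of g]
    by (subst emeasure_distr) (auto intro!: arg_cong[where f="emeasure M"] simp: space_pair_measure)
  then show ?thesis
    using M.measurable_emeasure_Pair[OF measurable_sets[OF \<Phi> B]] by simp
qed

lemma measurable_emeasure_T [measurable]:
  assumes "A \<in> sets M"
  shows "(\<lambda>g. emeasure (T g) A) \<in> borel_measurable borel"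
  using measurable_emeasure_T_Pair[of "UNIV \<times> A"] assms by (simp add: vimage_def)

text \<open>Stationarity applied to the preimage of \<open>A\<close> under \<open>a g\<close>. Here
  harmonic functions arise from the space: \<open>emeasure (T g) A\<close> is one in the variable
  \<open>g\<close>.\<close>

lemma average_T:
  assumes A [measurable]: "A \<in> sets M"
  shows "(\<integral>\<^sup>+h. emeasure (T (g + h)) A \<partial>\<theta>) = emeasure (T g) A"
proof -
  have "(\<integral>\<^sup>+h. emeasure (T (g + h)) A \<partial>\<theta>) = (\<integral>\<^sup>+h. emeasure (T h) (a g -` A \<inter> space M) \<partial>\<theta>)"
    unfolding T_add by (subst emeasure_distr) auto
  also have "\<dots> = emeasure M (a g -` A \<inter> space M)"
    using stationary measurable_sets[of "a g" M M A] A
    by (simp add: stationary_space_def stationary_measure_def T_def)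
  also have "\<dots> = emeasure (T g) A" unfolding T_def by (subst emeasure_distr) auto
  finally show ?thesis .
qed

text \<open>Divided by \<open>emeasure M A\<close>, the harmonic function
  \<open>emeasure (T g) A\<close> lies in \<open>H\<close>. If \<open>A\<close> is null, the minimum
  principle makes it null for every \<open>T g\<close>; quasi-invariance of the measure is contained
  in this case.\<close>

lemma T_le:
  assumes A [measurable]: "A \<in> sets M"
  shows "emeasure (T g) A \<le> w g * emeasure M A"
proof -
  have harm: "nn_harmonic (\<lambda>g. emeasure (T g) A * c)" for c
    by (auto simp: nn_harmonic_def average_T[OF A] nn_integral_multc)
  show ?thesis
  proof (cases "emeasure M A = 0")
    case True
    then show ?thesis
      using nn_harmonic_minimum_principle[OF harm[of 1], of 0 g] by (simp add: T_0)
  next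
    case False
    define c where "c = inverse (emeasure M A)"
    have c: "emeasure M A * c = 1" "c < \<infinity>"
      using ennreal_divide_self[OF False] M.emeasure_finite[of A] False
      by (simp_all add: c_def divide_ennreal_def less_top[symmetric])
    have fin: "emeasure (T g) A * c < \<infinity>" for g
      using c(2) prob_space.emeasure_le_1[OF prob_space_T, of g A]
      by (auto simp: ennreal_mult_less_top intro: le_less_trans)
    have "(\<lambda>g. enn2real (emeasure (T g) A * c)) \<in> H"
      by (rule H_I[OF harm fin]) (simp add: T_0 c)
    from le_majorant[OF this, of g] have "emeasure (T g) A * c \<le> w g" using fin[of g] by simp
    then have "emeasure (T g) A * c * emeasure M A \<le> w g * emeasure M A" by (rule mult_right_mono) simp
    moreover have "emeasure (T g) A * c * emeasure M A = emeasure (T g) A"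
      by (metis c(1) mult.assoc mult.commute mult.right_neutral)
    ultimately show ?thesis by simp
  qed
qed

lemma AE_action:
  assumes "AE x in M. P x"
  shows "AE x in M. P (a g x)"
proof -
  obtain N where N: "{x \<in> space M. \<not> P x} \<subseteq> N" "emeasure M N = 0" "N \<in> sets M"
    using AE_E[OF assms] by metis
  then have "emeasure (T g) N = 0" using T_le[of N g] by simp
  then have "emeasure M (a g -` N \<inter> space M) = 0"
    using N(3) by (simp add: T_def emeasure_distr)
  then show ?thesis
    using N action_space by (intro AE_I[of _ _ "a g -` N \<inter> space M"]) auto
qed

text \<open>The fibre of \<open>\<nu>\<close> over \<open>g\<close> is \<open>T g\<close>. One
  derivative on the product replaces the separate derivatives of the \<open>T g\<close>, whose joint
  measurability would be unclear.\<close>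

definition \<nu> :: "('g \<times> 'x) measure" where
  "\<nu> = distr (m \<Otimes>\<^sub>M M) (m \<Otimes>\<^sub>M M) (\<lambda>(g, x). (g, a g x))"

lemma emeasure_\<nu>:
  assumes B: "B \<in> sets (m \<Otimes>\<^sub>M M)"
  shows "emeasure \<nu> B = (\<integral>\<^sup>+g. emeasure (T g) (Pair g -` B) \<partial>m)"
proof -
  have \<Phi> [measurable]: "(\<lambda>(g, x). (g, a g x)) \<in> measurable (m \<Otimes>\<^sub>M M) (m \<Otimes>\<^sub>M M)"
    unfolding case_prod_beta by measurable
  have eq: "emeasure (T g) (Pair g -` B)
      = emeasure M (Pair g -` ((\<lambda>(g, x). (g, a g x)) -` B \<inter> space (m \<Otimes>\<^sub>M M)))" for g
    unfolding T_def using sets_Pair1[OF B, of g]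
    by (subst emeasure_distr) (auto intro!: arg_cong[where f="emeasure M"] simp: space_pair_measure)
  show ?thesis
    unfolding \<nu>_def eq emeasure_distr[OF \<Phi> B]
    by (rule M.emeasure_pair_measure_alt) (rule measurable_sets[OF \<Phi> B])
qed

lemma sets_\<nu>: "sets \<nu> = sets (m \<Otimes>\<^sub>M M)"
  by (simp add: \<nu>_def)

lemma ac_\<nu>: "absolutely_continuous (m \<Otimes>\<^sub>M M) \<nu>"
  unfolding absolutely_continuous_def
proof
  fix B assume B: "B \<in> null_sets (m \<Otimes>\<^sub>M M)"
  then have Bs [measurable]: "B \<in> sets (m \<Otimes>\<^sub>M M)" by auto
  have "(\<integral>\<^sup>+g. emeasure M (Pair g -` B) \<partial>m) = 0"
    using B M.emeasure_pair_measure_alt[OF Bs] by auto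
  then have "AE g in m. emeasure M (Pair g -` B) = 0"
    by (subst (asm) nn_integral_0_iff_AE) (auto intro: M.measurable_emeasure_Pair[OF Bs])
  then have "AE g in m. emeasure (T g) (Pair g -` B) = 0"
  proof eventually_elim
    fix g assume "emeasure M (Pair g -` B) = 0"
    then show "emeasure (T g) (Pair g -` B) = 0" using T_le[OF sets_Pair1[OF Bs, of g], of g] by simp
  qed
  then have "emeasure \<nu> B = 0"
    unfolding emeasure_\<nu>[OF Bs] by (subst nn_integral_cong_AE[where v="\<lambda>_. 0"]) auto
  then show "B \<in> null_sets \<nu>" using Bs by (auto simp: null_sets_def sets_\<nu>)
qed

definition R :: "'g \<times> 'x \<Rightarrow> ennreal" where
  "R = RN_deriv (m \<Otimes>\<^sub>M M) \<nu>"

lemma sets_mM: "sets (m \<Otimes>\<^sub>M M) = sets (borel \<Otimes>\<^sub>M M)"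
  by (intro sets_pair_measure_cong) auto

lemma measurable_R [measurable]: "R \<in> borel_measurable (borel \<Otimes>\<^sub>M M)"
proof -
  have "R \<in> borel_measurable (m \<Otimes>\<^sub>M M)" by (simp add: R_def)
  also have "measurable (m \<Otimes>\<^sub>M M) borel = measurable (borel \<Otimes>\<^sub>M M) (borel :: ennreal measure)"
    by (intro measurable_cong_sets sets_mM) auto
  finally show ?thesis .
qed

lemma density_R: "density (m \<Otimes>\<^sub>M M) R = \<nu>"
  unfolding R_def by (rule mM.P.density_RN_deriv[OF ac_\<nu> sets_\<nu>])

text \<open>\<open>R\<close> represents \<open>T g\<close> only for almost every \<open>g\<close>.
  Averaging repairs all \<open>g\<close> at once, because \<theta> ignores Haar null sets and
  \<open>T g\<close> is the \<theta>-average of the \<open>T (g + h)\<close>.\<close>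

definition \<rho> :: "'g \<Rightarrow> 'x \<Rightarrow> ennreal" where
  "\<rho> g x = (\<integral>\<^sup>+h. R (g + h, x) \<partial>\<theta>)"

lemma measurable_\<rho> [measurable]: "(\<lambda>(g, x). \<rho> g x) \<in> borel_measurable (borel \<Otimes>\<^sub>M M)"
  unfolding \<rho>_def case_prod_beta by measurable

lemma measurable_\<rho>_compose [measurable (raw)]:
  assumes [measurable]: "f \<in> measurable N borel" "k \<in> measurable N M"
  shows "(\<lambda>y. \<rho> (f y) (k y)) \<in> borel_measurable N"
  using measurable_compose[OF measurable_Pair[OF assms] measurable_\<rho>] by simp

lemma AE_R:
  assumes A [measurable]: "A \<in> sets M"
  shows "AE g in m. (\<integral>\<^sup>+x. R (g, x) * indicator A x \<partial>M) = emeasure (T g) A"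
proof (rule density_unique)
  show "density m (\<lambda>g. \<integral>\<^sup>+x. R (g, x) * indicator A x \<partial>M) = density m (\<lambda>g. emeasure (T g) A)"
  proof (rule measure_eqI)
    fix B assume "B \<in> sets (density m (\<lambda>g. \<integral>\<^sup>+x. R (g, x) * indicator A x \<partial>M))"
    then have B [measurable]: "B \<in> sets borel" by simp
    have BA: "B \<times> A \<in> sets (m \<Otimes>\<^sub>M M)" by (rule pair_measureI) auto
    have "emeasure (density m (\<lambda>g. \<integral>\<^sup>+x. R (g, x) * indicator A x \<partial>M)) B
        = (\<integral>\<^sup>+g. (\<integral>\<^sup>+x. R (g, x) * indicator A x \<partial>M) * indicator B g \<partial>m)"
      by (rule emeasure_density) auto
    also have "\<dots> = (\<integral>\<^sup>+g. (\<integral>\<^sup>+x. R (g, x) * indicator (B \<times> A) (g, x) \<partial>M) \<partial>m)"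
      by (subst nn_integral_multc[symmetric]) (auto intro!: nn_integral_cong split: split_indicator)
    also have "\<dots> = (\<integral>\<^sup>+p. R p * indicator (B \<times> A) p \<partial>(m \<Otimes>\<^sub>M M))"
      by (rule M.nn_integral_fst) measurable
    also have "\<dots> = emeasure \<nu> (B \<times> A)"
      unfolding density_R[symmetric] by (rule emeasure_density[symmetric]) (use BA in auto)
    also have "\<dots> = (\<integral>\<^sup>+g. emeasure (T g) A * indicator B g \<partial>m)"
      unfolding emeasure_\<nu>[OF BA] by (intro nn_integral_cong) (auto split: split_indicator)
    also have "\<dots> = emeasure (density m (\<lambda>g. emeasure (T g) A)) B"
      by (rule emeasure_density[symmetric]) auto
    finally show "emeasure (density m (\<lambda>g. \<integral>\<^sup>+x. R (g, x) * indicator A x \<partial>M)) B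
      = emeasure (density m (\<lambda>g. emeasure (T g) A)) B" .
  qed simp
qed measurable

text \<open>The exceptional group elements in \<open>AE_R\<close> depend on \<open>A\<close>. This
  is harmless, as \<open>A\<close> is fixed before the average is taken.\<close>

lemma density_\<rho>: "density M (\<rho> g) = T g"
proof (rule measure_eqI)
  fix A assume "A \<in> sets (density M (\<rho> g))"
  then have A [measurable]: "A \<in> sets M" by simp
  have "emeasure (density M (\<rho> g)) A = (\<integral>\<^sup>+x. \<rho> g x * indicator A x \<partial>M)"
    by (rule emeasure_density) auto
  also have "\<dots> = (\<integral>\<^sup>+x. (\<integral>\<^sup>+h. R (g + h, x) * indicator A x \<partial>\<theta>) \<partial>M)"
    unfolding \<rho>_def by (intro nn_integral_cong nn_integral_multc[symmetric]) auto
  also have "\<dots> = (\<integral>\<^sup>+h. (\<integral>\<^sup>+x. R (g + h, x) * indicator A x \<partial>M) \<partial>\<theta>)"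
    by (rule \<theta>M.Fubini') (simp add: case_prod_beta)
  also have "\<dots> = (\<integral>\<^sup>+h. emeasure (T (g + h)) A \<partial>\<theta>)"
    by (intro nn_integral_cong_AE null_\<theta> AE_left_translate AE_R A)
  also have "\<dots> = emeasure (T g) A" by (rule average_T[OF A])
  finally show "emeasure (density M (\<rho> g)) A = emeasure (T g) A" .
qed simp

lemma AE_\<rho>_eq_R: "AE p in m \<Otimes>\<^sub>M M. (case p of (g, x) \<Rightarrow> \<rho> g x) = R p"
proof (rule mM.P.density_unique)
  show "density (m \<Otimes>\<^sub>M M) (\<lambda>(g, x). \<rho> g x) = density (m \<Otimes>\<^sub>M M) R"
    unfolding density_R
  proof (rule measure_eqI)
    fix B assume "B \<in> sets (density (m \<Otimes>\<^sub>M M) (\<lambda>(g, x). \<rho> g x))"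
    then have B: "B \<in> sets (m \<Otimes>\<^sub>M M)" by simp
    then have [measurable]: "B \<in> sets (borel \<Otimes>\<^sub>M M)" by (simp add: sets_mM)
    have "emeasure (density (m \<Otimes>\<^sub>M M) (\<lambda>(g, x). \<rho> g x)) B
        = (\<integral>\<^sup>+p. (case p of (g, x) \<Rightarrow> \<rho> g x) * indicator B p \<partial>(m \<Otimes>\<^sub>M M))"
      by (rule emeasure_density) (auto simp: case_prod_beta)
    also have "\<dots> = (\<integral>\<^sup>+g. \<integral>\<^sup>+x. \<rho> g x * indicator B (g, x) \<partial>M \<partial>m)"
      by (subst M.nn_integral_fst[symmetric]) (auto simp: case_prod_beta)
    also have "\<dots> = (\<integral>\<^sup>+g. emeasure (T g) (Pair g -` B) \<partial>m)"
    proof (intro nn_integral_cong)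
      fix g
      have "emeasure (density M (\<rho> g)) (Pair g -` B) = (\<integral>\<^sup>+x. \<rho> g x * indicator (Pair g -` B) x \<partial>M)"
        by (rule emeasure_density) (auto intro: sets_Pair1[OF B])
      then show "(\<integral>\<^sup>+x. \<rho> g x * indicator B (g, x) \<partial>M) = emeasure (T g) (Pair g -` B)"
        by (simp add: density_\<rho> indicator_def)
    qed
    also have "\<dots> = emeasure \<nu> B" by (rule emeasure_\<nu>[OF B, symmetric])
    finally show "emeasure (density (m \<Otimes>\<^sub>M M) (\<lambda>(g, x). \<rho> g x)) B = emeasure \<nu> B" .
  qed (simp add: sets_\<nu>)
qed (auto simp: case_prod_beta)

text \<open>On the product \<open>\<rho>\<close> and \<open>R\<close> are densities of the same
  measure, so for almost every \<open>x\<close> they agree at Haar almost every \<open>g\<close>.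
  Averaging \<open>\<rho>\<close> then equals averaging \<open>R\<close>, which is
  \<open>\<rho>\<close> again, now at every \<open>g\<close>.\<close>

lemma AE_\<rho>_harmonic: "AE x in M. nn_harmonic (\<lambda>g. \<rho> g x)"
proof -
  have "AE g in m. AE x in M. \<rho> g x = R (g, x)"
    using mM.AE_pair[OF AE_\<rho>_eq_R] by simp
  moreover have "{p \<in> space (m \<Otimes>\<^sub>M M). \<rho> (fst p) (snd p) = R (fst p, snd p)} \<in> sets (m \<Otimes>\<^sub>M M)"
    by measurable
  ultimately have "AE x in M. AE g in m. \<rho> g x = R (g, x)"
    using mM.AE_commute[of "\<lambda>g x. \<rho> g x = R (g, x)"] by blast
  with AE_space show ?thesis
  proof eventually_elim
    fix x assume x [measurable]: "x \<in> space M" and eq: "AE g in m. \<rho> g x = R (g, x)"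
    have "(\<integral>\<^sup>+h. \<rho> (g + h) x \<partial>\<theta>) = (\<integral>\<^sup>+h. R (g + h, x) \<partial>\<theta>)" for g
      by (intro nn_integral_cong_AE null_\<theta> AE_left_translate[OF eq])
    then show "nn_harmonic (\<lambda>g. \<rho> g x)" by (auto simp: nn_harmonic_def \<rho>_def[symmetric])
  qed
qed

lemma AE_\<rho>_0: "AE x in M. \<rho> 0 x = 1"
proof (rule M.density_unique)
  show "density M (\<rho> 0) = density M (\<lambda>_. 1)" by (simp add: density_\<rho> T_0 density_1)
qed measurable

lemma AE_\<rho>_le: "AE x in M. \<rho> g x \<le> w g"
proof -
  \<comment> \<open>The margin \<open>1 / Suc n\<close> makes the density exceed \<open>w g\<close>
    by a fixed amount on \<open>A n\<close>, which contradicts \<open>T_le\<close> unless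
    \<open>A n\<close> is null.\<close>
  define A where "A n = {x \<in> space M. w g + ennreal (1 / Suc n) \<le> \<rho> g x}" for n :: nat
  have A [measurable]: "A n \<in> sets M" for n unfolding A_def by measurable
  have "emeasure M (A n) = 0" for n
  proof (rule ccontr)
    assume n: "emeasure M (A n) \<noteq> 0"
    have "(w g + ennreal (1 / Suc n)) * emeasure M (A n)
        = (\<integral>\<^sup>+x. (w g + ennreal (1 / Suc n)) * indicator (A n) x \<partial>M)"
      by (simp add: nn_integral_cmult_indicator)
    also have "\<dots> \<le> (\<integral>\<^sup>+x. \<rho> g x * indicator (A n) x \<partial>M)"
      by (intro nn_integral_mono) (auto simp: A_def split: split_indicator)
    also have "\<dots> = emeasure (T g) (A n)" by (subst emeasure_density[symmetric]) (auto simp: density_\<rho>)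
    also have "\<dots> \<le> w g * emeasure M (A n)" by (rule T_le[OF A])
    finally have "w g * emeasure M (A n) + ennreal (1 / Suc n) * emeasure M (A n) \<le> w g * emeasure M (A n) + 0"
      by (simp only: distrib_right add_0_right)
    moreover have "w g * emeasure M (A n) \<noteq> \<infinity>"
      using majorant_finite[of g] M.emeasure_finite[of "A n"] by (auto simp: ennreal_mult_eq_top_iff)
    ultimately have "ennreal (1 / Suc n) * emeasure M (A n) \<le> 0"
      unfolding ennreal_add_left_cancel_le by blast
    then show False using n by (simp add: ennreal_eq_0_iff)
  qed
  then have "AE x in M. x \<notin> A n" for n by (intro AE_not_in) (auto simp: null_sets_def)
  then have "AE x in M. \<forall>n. x \<notin> A n" by (simp add: AE_all_countable)
  with AE_space show ?thesis
  proof eventually_elim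
    fix x assume x: "x \<in> space M" "\<forall>n. x \<notin> A n"
    have "\<rho> g x \<le> w g + ennreal (1 / Suc n)" for n using x by (auto simp: A_def not_le less_imp_le)
    moreover have "(\<lambda>n. w g + ennreal (1 / Suc n)) \<longlonglongrightarrow> w g + ennreal 0"
      by (intro tendsto_add tendsto_const tendsto_ennrealI LIMSEQ_Suc lim_1_over_n)
    ultimately show "\<rho> g x \<le> w g" using LIMSEQ_le_const by fastforce
  qed
qed

text \<open>The null set in \<open>AE_\<rho>_le\<close> depends on \<open>g\<close>. Fubini gives
  that bound, for almost every \<open>x\<close>, at almost every \<open>g\<close>; harmonicity turns
  it into the bound \<open>w g\<close> times the integral of \<open>w\<close> at every
  \<open>g\<close>, larger by a constant factor but free of exceptions.\<close>

lemma AE_\<rho>_finite: "AE x in M. \<forall>g. \<rho> g x < \<infinity>"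
proof -
  have "AE g in m. AE x in M. \<rho> g x \<le> w g" using AE_\<rho>_le by simp
  moreover have "{p \<in> space (m \<Otimes>\<^sub>M M). \<rho> (fst p) (snd p) \<le> w (fst p)} \<in> sets (m \<Otimes>\<^sub>M M)"
    by measurable
  ultimately have "AE x in M. AE g in m. \<rho> g x \<le> w g"
    using mM.AE_commute[of "\<lambda>g x. \<rho> g x \<le> w g"] by blast
  with AE_\<rho>_harmonic show ?thesis
  proof eventually_elim
    fix x assume harm: "nn_harmonic (\<lambda>g. \<rho> g x)" and le: "AE g in m. \<rho> g x \<le> w g"
    show "\<forall>g. \<rho> g x < \<infinity>"
    proof
      fix g
      have "\<rho> g x = (\<integral>\<^sup>+h. \<rho> (g + h) x \<partial>\<theta>)" using harm by (simp add: nn_harmonic_def)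
      also have "\<dots> \<le> (\<integral>\<^sup>+h. w (g + h) \<partial>\<theta>)"
        by (intro nn_integral_mono_AE null_\<theta> AE_left_translate[OF le])
      also have "\<dots> \<le> (\<integral>\<^sup>+h. w g * w h \<partial>\<theta>)" by (intro nn_integral_mono majorant_add_le)
      also have "\<dots> = w g * (\<integral>\<^sup>+h. w h \<partial>\<theta>)" by (rule nn_integral_cmult) auto
      also have "\<dots> < \<infinity>" using majorant_finite[of g] integral_majorant by (simp add: ennreal_mult_less_top)
      finally show "\<rho> g x < \<infinity>" .
    qed
  qed
qed

definition U :: "'x \<Rightarrow> 'g \<Rightarrow> real" where
  "U x g = enn2real (\<rho> g x)"

lemma measurable_U [measurable (raw)]:
  assumes [measurable]: "f \<in> measurable N borel" "k \<in> measurable N M"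
  shows "(\<lambda>y. U (k y) (f y)) \<in> borel_measurable N"
  unfolding U_def by measurable

lemma AE_U_H: "AE x in M. U x \<in> H"
  using AE_\<rho>_harmonic AE_\<rho>_0 AE_\<rho>_finite
  by eventually_elim (auto simp: U_def[abs_def] intro: H_I)

lemma density_U: "density M (\<lambda>x. ennreal (U x g)) = T g"
proof -
  have "density M (\<lambda>x. ennreal (U x g)) = density M (\<rho> g)"
  proof (rule density_cong)
    show "AE x in M. ennreal (U x g) = \<rho> g x"
      using AE_\<rho>_finite by eventually_elim (simp add: U_def)
  qed measurable
  then show ?thesis by (simp add: density_\<rho>)
qed

text \<open>Both sides are densities of \<open>T (- k + h)\<close> with respect to \<open>M\<close>,
  the left one by the chain rule. The null set depends on \<open>k\<close> and
  \<open>h\<close>.\<close>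

lemma AE_U_cocycle: "AE x in M. ennreal (U (a k x) h) * ennreal (U x (- k)) = ennreal (U x (- k + h))"
proof (rule M.density_unique)
  show "density M (\<lambda>x. ennreal (U (a k x) h) * ennreal (U x (- k))) = density M (\<lambda>x. ennreal (U x (- k + h)))"
    unfolding density_U
  proof (rule measure_eqI)
    fix A assume "A \<in> sets (density M (\<lambda>x. ennreal (U (a k x) h) * ennreal (U x (- k))))"
    then have A [measurable]: "A \<in> sets M" by simp
    have "emeasure (density M (\<lambda>x. ennreal (U (a k x) h) * ennreal (U x (- k)))) A
        = (\<integral>\<^sup>+x. ennreal (U x (- k)) * (ennreal (U (a k x) h) * indicator A x) \<partial>M)"
      by (subst emeasure_density) (auto intro!: nn_integral_cong simp: mult_ac)
    also have "\<dots> = (\<integral>\<^sup>+x. ennreal (U (a k x) h) * indicator A x \<partial>T (- k))"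
      unfolding density_U[symmetric] by (rule nn_integral_density[symmetric]) measurable
    also have "\<dots> = (\<integral>\<^sup>+x. ennreal (U (a k (a (- k) x)) h) * indicator A (a (- k) x) \<partial>M)"
      unfolding T_def by (rule nn_integral_distr) measurable
    also have "\<dots> = (\<integral>\<^sup>+x. ennreal (U x h) * indicator (a (- k) -` A \<inter> space M) x \<partial>M)"
      by (intro nn_integral_cong) (auto simp: action_add[symmetric] action_0 split: split_indicator)
    also have "\<dots> = emeasure (T h) (a (- k) -` A \<inter> space M)"
      unfolding density_U[symmetric] by (rule emeasure_density[symmetric]) measurable
    also have "\<dots> = emeasure (T (- k + h)) A" unfolding T_add by (subst emeasure_distr) auto
    finally show "emeasure (density M (\<lambda>x. ennreal (U (a k x) h) * ennreal (U x (- k)))) A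
      = emeasure (T (- k + h)) A" .
  qed simp
qed measurable

end

section \<open>The cocycle identity off a single null set\<close>

locale coded_system = stationary_system m \<theta> M a + rn_model m \<theta> W q
  for m \<theta> :: "'g::{topological_group_add, second_countable_topology, t2_space} measure"
    and M :: "'x measure" and a :: "'g \<Rightarrow> 'x \<Rightarrow> 'x" and W :: "nat \<Rightarrow> 'g set" and q :: "nat \<Rightarrow> 'g"
begin

text \<open>Both sides lie in \<open>H\<close> as functions of \<open>h\<close>, so equality along
  the dense sequence decides. This reduces the cocycle identity for one group element to countably
  many instances.\<close>

lemma H_shift_eqI:
  assumes "u \<in> H" "v \<in> H" "\<And>j. u (q j) * v g = v (g + q j)"
  shows "u h = v (g + h) / v g"
proof -
  have "u = (\<lambda>h. v (g + h) / v g)"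
  proof (rule \<F>_eqI[of _ 0])
    show "u (q j) = v (g + q j) / v g" for j
      using assms(3)[of j] H_D(2)[OF assms(2), of g] by (simp add: field_simps)
  qed (use assms H_shift in \<open>auto simp: \<F>_def\<close>)
  then show ?thesis by metis
qed

text \<open>The cocycle identity holds almost everywhere for each pair of group elements. By Fubini it
  holds on a conull set for almost every translate, and two points of that set in the same orbit
  share such a translate, which makes it hold there without exception.\<close>

theorem exact_cocycle_on_conull_set:
  obtains X where "X \<in> sets M" "AE x in M. x \<in> X" "\<And>x. x \<in> X \<Longrightarrow> U x \<in> H"
    "\<And>g x h. x \<in> X \<Longrightarrow> a g x \<in> X \<Longrightarrow> U (a g x) h = U x (- g + h) / U x (- g)"
proof -
  obtain N where N: "{x \<in> space M. U x \<notin> H} \<subseteq> N" "emeasure M N = 0" "N \<in> sets M"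
    using AE_E[OF AE_U_H] by metis
  define X1 where "X1 = space M - N"
  have X1 [measurable]: "X1 \<in> sets M" using N by (auto simp: X1_def)
  have X1H: "U x \<in> H" if "x \<in> X1" for x using that N by (auto simp: X1_def)
  have "AE x in M. x \<notin> N" using N by (intro AE_not_in) (auto simp: null_sets_def)
  with AE_space have AE_X1: "AE x in M. x \<in> X1" by eventually_elim (simp add: X1_def)
  define Q where "Q k x \<longleftrightarrow> a k x \<in> X1 \<and>
    (\<forall>j. ennreal (U (a k x) (q j)) * ennreal (U x (- k)) = ennreal (U x (- k + q j)))" for k x
  have "AE x in M. Q k x" for k
  proof -
    have "AE x in M. \<forall>j. ennreal (U (a k x) (q j)) * ennreal (U x (- k)) = ennreal (U x (- k + q j))"
      using AE_U_cocycle by (simp add: AE_all_countable)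
    with AE_action[OF AE_X1, of k] show ?thesis by eventually_elim (simp add: Q_def)
  qed
  then have "AE k in m. AE x in M. Q k x" by simp
  moreover have "{p \<in> space (m \<Otimes>\<^sub>M M). Q (fst p) (snd p)} \<in> sets (m \<Otimes>\<^sub>M M)"
    unfolding Q_def by measurable
  ultimately have "AE x in M. AE k in m. Q k x" using mM.AE_commute[of Q] by blast
  then obtain N' where N': "{x \<in> space M. \<not> (AE k in m. Q k x)} \<subseteq> N'" "emeasure M N' = 0" "N' \<in> sets M"
    using AE_E by metis
  define X where "X = X1 - N'"
  have XQ: "AE k in m. Q k x" if "x \<in> X" for x
    using that N' sets.sets_into_space[OF X1] by (auto simp: X_def)
  have Q_shift: "U (a k x) h = U x (- k + h) / U x (- k)" if "Q k x" "U x \<in> H" for k x h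
  proof (rule H_shift_eqI)
    show "U (a k x) (q j) * U x (- k) = U x (- k + q j)" for j
    proof -
      have "ennreal (U (a k x) (q j) * U x (- k)) = ennreal (U x (- k + q j))"
        using that(1) by (simp add: Q_def ennreal_mult' U_def)
      then show ?thesis by (subst (asm) ennreal_inj) (auto simp: U_def)
    qed
  qed (use that X1H in \<open>auto simp: Q_def\<close>)
  have cocycle: "U (a g x) h = U x (- g + h) / U x (- g)" if x: "x \<in> X" "a g x \<in> X" for g x h
  proof -
    have xs: "x \<in> space M" using x(1) sets.sets_into_space[OF X1] by (auto simp: X_def)
    have Hx: "U x \<in> H" "U (a g x) \<in> H" using x X1H by (auto simp: X_def)
    \<comment> \<open>Acting by \<open>k\<close> on \<open>a g x\<close> and by \<open>k + g\<close>
      on \<open>x\<close> leads to the same point. The second condition is right translated by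
      \<open>g\<close>, which preserves Haar null sets.\<close>
    have "AE k in m. Q k (a g x) \<and> Q (k + g) x"
      using XQ[OF x(2)] AE_right_translate[OF XQ[OF x(1)], of g] by eventually_elim simp
    then have "(AE k in m. False)" if "\<nexists>k. Q k (a g x) \<and> Q (k + g) x"
      by eventually_elim (use that in blast)
    moreover have "\<not> (AE k in m. False)"
      using left_haar AE_E2[of "\<lambda>_. False" m] by (auto simp: left_haar_measure_def)
    ultimately obtain k where k: "Q k (a g x)" "Q (k + g) x"
      by blast
    have eq: "U (a g x) (- k + h') / U (a g x) (- k) = U x (- (k + g) + h') / U x (- (k + g))" for h'
      using Q_shift[OF k(1) Hx(2), of h'] Q_shift[OF k(2) Hx(1), of h'] by (simp add: action_add[OF xs])
    have 1: "U (a g x) h / U (a g x) (- k) = U x (- g + h) / U x (- (k + g))" for h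
      using eq[of "k + h"] by (simp add: minus_add_add add.assoc[symmetric])
    \<comment> \<open>At \<open>h = 0\<close> the numerator on the left is 1, which determines the
      auxiliary factor; dividing by it eliminates \<open>k\<close>.\<close>
    have "1 / U (a g x) (- k) = U x (- g) / U x (- (k + g))" using 1[of 0] H_D(1)[OF Hx(2)] by simp
    then show ?thesis
      using 1[of h] H_D(2)[OF Hx(1), of "- g"] H_D(2)[OF Hx(1), of "- (k + g)"] H_D(2)[OF Hx(2), of "- k"]
      by (simp add: field_simps)
  qed
  have "AE x in M. x \<notin> N'" using N' by (intro AE_not_in) (auto simp: null_sets_def)
  with AE_X1 have AE_X: "AE x in M. x \<in> X" by eventually_elim (simp add: X_def)
  have X: "X \<in> sets M" using N' by (auto simp: X_def)
  show ?thesis by (rule that[OF X AE_X _ cocycle]) (simp_all add: X_def X1H)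
qed

end

section \<open>Embedding a stationary space into the model\<close>

lemma separating_sequence:
  assumes "standard_borel M"
  obtains A :: "nat \<Rightarrow> 'x set" where "\<And>n. A n \<in> sets M"
    "\<And>x y. x \<in> space M \<Longrightarrow> y \<in> space M \<Longrightarrow> (\<And>n. x \<in> A n \<longleftrightarrow> y \<in> A n) \<Longrightarrow> x = y"
proof -
  obtain T where T: "completely_metrizable_space T" "second_countable T" "topspace T = space M"
    "sets M = sigma_sets (space M) {U. openin T U}"
    using assms by (auto simp: standard_borel_def)
  obtain B where B: "countable B" "\<And>V. V \<in> B \<Longrightarrow> openin T V"
    "\<And>U x. openin T U \<Longrightarrow> x \<in> U \<Longrightarrow> \<exists>V\<in>B. x \<in> V \<and> V \<subseteq> U"
    using T(2) unfolding second_countable_def by metis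
  \<comment> \<open>The added empty set keeps the enumerated family nonempty, even for an empty
    carrier.\<close>
  have ran: "range (from_nat_into (insert {} B)) = insert {} B"
    using B(1) by (intro range_from_nat_into) auto
  show ?thesis
  proof (rule that[of "from_nat_into (insert {} B)"])
    fix n
    have "from_nat_into (insert {} B) n \<in> insert {} B" by (rule from_nat_into) simp
    then show "from_nat_into (insert {} B) n \<in> sets M"
      using B(2) by (auto simp: T(4) intro: sigma_sets.Basic)
  next
    fix x y assume xy: "x \<in> space M" "y \<in> space M"
      and eq: "\<And>n. x \<in> from_nat_into (insert {} B) n \<longleftrightarrow> y \<in> from_nat_into (insert {} B) n"
    have "x \<in> V \<longleftrightarrow> y \<in> V" if "V \<in> B" for V
    proof -
      have "V \<in> range (from_nat_into (insert {} B))" using that by (simp add: ran)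
      then show ?thesis using eq by auto
    qed
    then have "x \<in> U \<longleftrightarrow> y \<in> U" if "openin T U" for U using B(3)[OF that] by blast
    moreover have "Hausdorff_space T"
      using T(1) completely_metrizable_imp_metrizable_space metrizable_imp_Hausdorff_space by blast
    ultimately show "x = y"
      using xy unfolding Hausdorff_space_def T(3) disjnt_iff by metis
  qed
qed

locale embedded_system = coded_system m \<theta> M a W q
  for m \<theta> :: "'g::{topological_group_add, second_countable_topology, t2_space} measure"
    and M :: "'x measure" and a :: "'g \<Rightarrow> 'x \<Rightarrow> 'x" and W :: "nat \<Rightarrow> 'g set" and q :: "nat \<Rightarrow> 'g" +
  fixes A :: "nat \<Rightarrow> 'x set" and X :: "'x set"
  assumes A_sets [measurable]: "\<And>n. A n \<in> sets M"
    and A_separate: "\<And>x y. x \<in> space M \<Longrightarrow> y \<in> space M \<Longrightarrow> (\<And>n. x \<in> A n \<longleftrightarrow> y \<in> A n) \<Longrightarrow> x = y"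
    and X_sets [measurable]: "X \<in> sets M" and AE_X: "AE x in M. x \<in> X"
    and X_H: "\<And>x. x \<in> X \<Longrightarrow> U x \<in> H"
    and X_cocycle: "\<And>g x h. x \<in> X \<Longrightarrow> a g x \<in> X \<Longrightarrow> U (a g x) h = U x (- g + h) / U x (- g)"
begin

lemma X_space: "x \<in> X \<Longrightarrow> x \<in> space M"
  using sets.sets_into_space[OF X_sets] by blast

lemma W_borel [measurable]: "W j \<in> sets borel"
  using W_open by auto

text \<open>For a label \<open>i = Suc (prod_encode (n, j))\<close> the coordinate \<open>point x i\<close> belongs to \<open>V j\<close>; the index \<open>n\<close>
  provides one copy of \<open>V j\<close> for each set \<open>A n\<close>.\<close>

definition visits :: "nat \<Rightarrow> nat \<Rightarrow> 'x \<Rightarrow> 'g \<Rightarrow> 'g set" where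
  "visits n j x g = {h. - g + h \<in> W j \<and> a (- h) x \<in> A n}"

definition point :: "'x \<Rightarrow> nat \<Rightarrow> 'g \<Rightarrow> real" where
  "point x i = (case i of 0 \<Rightarrow> U x
     | Suc k \<Rightarrow> (\<lambda>g. measure m (visits (fst (prod_decode k)) (snd (prod_decode k)) x g)))"

lemma visits_sets: "x \<in> space M \<Longrightarrow> visits n j x g \<in> sets borel"
  unfolding visits_def
proof -
  assume [measurable]: "x \<in> space M"
  have "{h \<in> space borel. - g + h \<in> W j \<and> a (- h) x \<in> A n} \<in> sets borel" by measurable
  then show "{h. - g + h \<in> W j \<and> a (- h) x \<in> A n} \<in> sets borel" by simp
qed

text \<open>In this form the measure is a convolution with the kernel
  \<open>indicator (W j)\<close>, ready for the shift estimate.\<close>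

lemma emeasure_visits:
  assumes x [measurable]: "x \<in> space M"
  shows "emeasure m (visits n j x g)
    = (\<integral>\<^sup>+h. indicator {h. a (- h) x \<in> A n} (g + h) * ennreal (indicator (W j) h) \<partial>m)"
proof -
  have [measurable]: "{h. a (- h) x \<in> A n} \<in> sets borel"
  proof -
    have "{h \<in> space borel. a (- h) x \<in> A n} \<in> sets borel" by measurable
    then show ?thesis by simp
  qed
  have "emeasure m (visits n j x g) = (\<integral>\<^sup>+h. indicator (visits n j x g) h \<partial>m)"
    using visits_sets[OF x] by simp
  also have "\<dots> = (\<integral>\<^sup>+h. indicator {h. a (- h) x \<in> A n} h * ennreal (indicator (W j) (- g + h)) \<partial>m)"
    by (intro nn_integral_cong) (auto simp: visits_def split: split_indicator)
  also have "\<dots> = (\<integral>\<^sup>+h. indicator {h. a (- h) x \<in> A n} (g + h) * ennreal (indicator (W j) h) \<partial>m)"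
    by (subst nn_integral_translate[of _ g, symmetric]) (simp_all add: add.assoc[symmetric])
  finally show ?thesis .
qed

lemma emeasure_visits_le_W:
  assumes "x \<in> space M"
  shows "emeasure m (visits n j x g) \<le> emeasure m (W j)"
proof -
  have "emeasure m (visits n j x g) \<le> emeasure m ((+) (- g) -` W j)"
    using measurable_sets[of "(+) (- g)" borel borel "W j"]
    by (intro emeasure_mono) (auto simp: visits_def)
  then show ?thesis by (simp add: emeasure_translate)
qed

lemma emeasure_visits_finite: "x \<in> space M \<Longrightarrow> emeasure m (visits n j x g) = ennreal (measure m (visits n j x g))"
  using emeasure_visits_le_W[of x n j g] W_finite[of j]
  by (intro emeasure_eq_ennreal_measure) (auto simp: top_unique)

text \<open>\<open>nn_integral_shift_le\<close> with the bound 1 on an indicator, used in both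
  directions; \<open>L1_shift\<close> does not change when its group argument is inverted.\<close>

lemma visits_V:
  assumes x [measurable]: "x \<in> space M"
  shows "(\<lambda>g. measure m (visits n j x g)) \<in> V j"
  unfolding V_def
proof (intro CollectI allI conjI)
  fix g g'
  show "0 \<le> measure m (visits n j x g)" by simp
  have "ennreal (measure m (W j)) = emeasure m (W j)"
    using W_finite[of j] by (simp add: emeasure_eq_ennreal_measure)
  then show "measure m (visits n j x g) \<le> measure m (W j)"
    using emeasure_visits_le_W[OF x, of n j g] emeasure_visits_finite[OF x, of n j g]
    by (metis ennreal_le_iff measure_nonneg)
  have [measurable]: "{h. a (- h) x \<in> A n} \<in> sets borel"
  proof -
    have "{h \<in> space borel. a (- h) x \<in> A n} \<in> sets borel" by measurable
    then show ?thesis by simp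
  qed
  have le: "emeasure m (visits n j x g) \<le> emeasure m (visits n j x g') + L1_shift (indicator (W j)) (- g + g')" for g g'
  proof -
    have "emeasure m (visits n j x g) \<le> emeasure m (visits n j x g') + 1 * L1_shift (indicator (W j)) (- g + g')"
      unfolding emeasure_visits[OF x] by (rule nn_integral_shift_le) (auto split: split_indicator)
    then show ?thesis by simp
  qed
  have sym: "L1_shift (indicator (W j)) (- g' + g) = L1_shift (indicator (W j)) (- g + g')"
    using L1_shift_minus[of "indicator (W j)" "- g + g'"] by (simp add: minus_add)
  have abs: "ennreal \<bar>r - s\<bar> \<le> c" if "ennreal r \<le> ennreal s + c" "ennreal s \<le> ennreal r + c" "0 \<le> r" "0 \<le> s"
    for r s :: real and c
  proof (cases c)
    case (real c')
    then have "r \<le> s + c'" "s \<le> r + c'"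
      using that by (auto simp: ennreal_plus[symmetric] simp del: ennreal_plus)
    then show ?thesis using real by (auto intro!: ennreal_leI)
  qed simp
  show "ennreal \<bar>measure m (visits n j x g') - measure m (visits n j x g)\<bar> \<le> L1_shift (indicator (W j)) (- g + g')"
    using le[of g g'] le[of g' g] unfolding sym emeasure_visits_finite[OF x]
    by (intro abs) auto
qed

lemma point_in: "x \<in> X \<Longrightarrow> point x \<in> \<Z>"
  by (auto simp: \<Z>_def \<F>_def point_def X_H X_space intro!: visits_V split: nat.split)

text \<open>The two sets differ by left translation by \<open>g\<close>, which preserves
  \<open>m\<close>. These coordinates are therefore equivariant at every point of the space, without
  exceptional sets.\<close>

lemma visits_action:
  assumes x: "x \<in> space M"
  shows "measure m (visits n j (a g x) h) = measure m (visits n j x (- g + h))"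
proof -
  have "- (- g + h) + (- g + k) = - h + k" for k
    by (simp only: minus_add_add minus_minus minus_add_cancel add_minus_cancel)
  moreover have "a (- k) (a g x) = a (- (- g + k)) x" for k
    by (simp add: action_add[OF x, symmetric] minus_add)
  ultimately have "visits n j (a g x) h = (+) (- g) -` visits n j x (- g + h)"
    by (simp add: visits_def vimage_def)
  then show ?thesis
    using emeasure_translate[OF visits_sets[OF x], of g] by (simp add: measure_def)
qed

lemma point_action:
  assumes "x \<in> X" "a g x \<in> X"
  shows "point (a g x) = act g (point x)"
  using assms
  by (auto simp: point_def act_def fun_eq_iff X_cocycle visits_action X_space split: nat.split)

text \<open>The measures of \<open>E n x \<inter> W j\<close> determine each \<open>E n x\<close> up
  to a null set. As there are countably many \<open>n\<close>, some \<open>h\<close> satisfies all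
  conditions at once; then no \<open>A n\<close> separates the translates of \<open>x\<close> and
  \<open>y\<close> by \<open>- h\<close>, so these coincide, and acting by \<open>h\<close> gives
  \<open>x = y\<close>.\<close>

lemma inj_point: "inj_on point X"
proof (rule inj_onI)
  fix x y assume x: "x \<in> X" and y: "y \<in> X" and eq: "point x = point y"
  note [measurable] = X_space[OF x] X_space[OF y]
  define E where "E n z = {h. a (- h) z \<in> A n}" for n z
  have E [measurable]: "E n z \<in> sets borel" if [measurable]: "z \<in> space M" for n z
  proof -
    have "{h \<in> space borel. a (- h) z \<in> A n} \<in> sets borel" by measurable
    then show ?thesis by (simp add: E_def)
  qed
  have emeasure_E: "emeasure (density m (indicator (E n z))) (W j) = emeasure m (visits n j z 0)"
    if z [measurable]: "z \<in> space M" for n j z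
  proof -
    have "emeasure (density m (indicator (E n z))) (W j) = (\<integral>\<^sup>+h. indicator (E n z) h * indicator (W j) h \<partial>m)"
      using E[OF z] by (intro emeasure_density) auto
    also have "\<dots> = (\<integral>\<^sup>+h. indicator (visits n j z 0) h \<partial>m)"
      by (intro nn_integral_cong) (auto simp: visits_def E_def split: split_indicator)
    finally show ?thesis using visits_sets[OF z] by simp
  qed
  have "AE h in m. h \<in> E n x \<longleftrightarrow> h \<in> E n y" for n
  proof -
    have "density m (indicator (E n x)) = density m (indicator (E n y))"
    proof (rule measure_eqI_generator_eq[OF W_Int_stable, of UNIV _ _ W])
      fix V assume "V \<in> range W"
      then obtain j where j: "V = W j" by blast
      have "measure m (visits n j x 0) = measure m (visits n j y 0)"
        using fun_cong[OF fun_cong[OF eq], of "Suc (prod_encode (n, j))" 0] by (simp add: point_def)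
      then show "emeasure (density m (indicator (E n x))) V = emeasure (density m (indicator (E n y))) V"
        unfolding j using emeasure_visits_finite[OF X_space[OF x]] emeasure_visits_finite[OF X_space[OF y]]
        by (simp add: emeasure_E X_space x y)
    next
      fix j
      show "emeasure (density m (indicator (E n x))) (W j) \<noteq> \<infinity>"
        using emeasure_visits_finite[OF X_space[OF x]] by (simp add: emeasure_E X_space x)
    qed (auto simp: W_generate W_cover)
    then have "AE h in m. indicator (E n x) h = (indicator (E n y) h :: ennreal)"
      by (intro density_unique) auto
    then show ?thesis by eventually_elim (auto split: split_indicator_asm)
  qed
  then have "AE h in m. \<forall>n. h \<in> E n x \<longleftrightarrow> h \<in> E n y" by (simp add: AE_all_countable)
  then have "(AE h in m. False)" if "\<nexists>h. \<forall>n. h \<in> E n x \<longleftrightarrow> h \<in> E n y"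
    by eventually_elim (use that in blast)
  moreover have "\<not> (AE h in m. False)"
    using left_haar AE_E2[of "\<lambda>_. False" m] by (auto simp: left_haar_measure_def)
  ultimately obtain h where h: "\<And>n. h \<in> E n x \<longleftrightarrow> h \<in> E n y" by blast
  have "a (- h) x = a (- h) y"
    by (rule A_separate) (use h X_space x y action_space in \<open>auto simp: E_def\<close>)
  then have "a h (a (- h) x) = a h (a (- h) y)" by simp
  then show "x = y" using X_space x y by (simp add: action_add[symmetric] action_0)
qed

section \<open>The embedding and the image measure on the model\<close>

lemma X_nonempty: "X \<noteq> {}"
  using AE_X by auto

text \<open>Off \<open>X\<close> the map is constant, with the code of a chosen point of
  \<open>X\<close> as value, so that it sends every point into \<open>K\<close> and stays
  measurable.\<close>

definition \<iota> :: "'x \<Rightarrow> nat \<Rightarrow> real" where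
  "\<iota> x = code (point (if x \<in> X then x else (SOME x. x \<in> X)))"

lemma \<iota>_X: "x \<in> X \<Longrightarrow> \<iota> x = code (point x)"
  by (simp add: \<iota>_def)

lemma \<iota>_in: "\<iota> x \<in> K"
  using point_in X_nonempty some_in_eq[of X] by (auto simp: \<iota>_def K_def)

lemma inj_\<iota>: "inj_on \<iota> X"
  using inj_point inj_code point_in by (auto simp: inj_on_def \<iota>_X)

lemma \<iota>_action: "x \<in> X \<Longrightarrow> a g x \<in> X \<Longrightarrow> \<iota> (a g x) = b g (\<iota> x)"
  by (simp add: \<iota>_X point_action b_code point_in)

lemma measurable_point: "(\<lambda>x. point x i g) \<in> borel_measurable M"
proof (cases i)
  case 0
  then show ?thesis by (simp add: point_def)
next
  case (Suc k)
  have "(\<lambda>x. emeasure m (visits n j x g)) \<in> borel_measurable M" for n j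
  proof (rule measurable_emeasure)
    have "{p \<in> space (M \<Otimes>\<^sub>M borel). - g + snd p \<in> W j \<and> a (- snd p) (fst p) \<in> A n} \<in> sets (M \<Otimes>\<^sub>M borel)"
      by measurable
    moreover have "sets (M \<Otimes>\<^sub>M m) = sets (M \<Otimes>\<^sub>M borel)" by (intro sets_pair_measure_cong) auto
    ultimately show "{p \<in> space (M \<Otimes>\<^sub>M m). snd p \<in> visits n j (fst p) g} \<in> sets (M \<Otimes>\<^sub>M m)"
      by (simp add: visits_def space_pair_measure)
  qed auto
  then show ?thesis using Suc by (simp add: point_def measure_def)
qed

abbreviation "BK \<equiv> restrict_space (borel :: (nat \<Rightarrow> real) measure) K"

lemma measurable_\<iota> [measurable]: "\<iota> \<in> measurable M BK"
proof (rule measurable_restrict_space2)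
  show "\<iota> \<in> borel_measurable M"
  proof (rule measurable_coordinatewise_then_product)
    fix n
    have "(\<lambda>x. if x \<in> X then code (point x) n else code (point (SOME x. x \<in> X)) n) \<in> borel_measurable M"
      unfolding code_def by (intro measurable_If_set measurable_point) auto
    also have "(\<lambda>x. if x \<in> X then code (point x) n else code (point (SOME x. x \<in> X)) n) = (\<lambda>x. \<iota> x n)"
      by (auto simp: \<iota>_def fun_eq_iff)
    finally show "(\<lambda>x. \<iota> x n) \<in> borel_measurable M" .
  qed
qed (simp add: \<iota>_in)

definition N :: "(nat \<Rightarrow> real) measure" where
  "N = distr M BK \<iota>"

lemma sets_N [measurable_cong, simp]: "sets N = sets BK"
  and space_N [simp]: "space N = K"
  by (simp_all add: N_def space_restrict_space)

sublocale N: prob_space N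
  unfolding N_def by (rule M.prob_space_distr) simp

lemma sets_N_sigma: "sets N = sigma_sets K {U. openin (subtopology Z K) U}"
proof -
  have "sets BK = {(\<lambda>x. x) -` A \<inter> K |A. A \<in> sigma_sets UNIV {S. open S}}"
    by (auto simp: sets_restrict_space borel_def)
  also have "\<dots> = sigma_sets K {(\<lambda>x. x) -` A \<inter> K |A. A \<in> {S. open S}}"
    by (rule sigma_sets_vimage_commute) auto
  also have "{(\<lambda>x. x) -` A \<inter> K |A. A \<in> {S. open S}} = {U. openin (subtopology Z K) U}"
    by (auto simp: openin_open subtopology_subtopology)
  finally show ?thesis by simp
qed

lemma measurable_b [measurable]: "b g \<in> measurable BK BK"
proof (rule measurable_restrict_space2)
  have "continuous_on K (\<lambda>f. case (g, f) of (g, f) \<Rightarrow> b g f)"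
    by (rule continuous_on_compose2[OF continuous_b]) (auto intro!: continuous_intros)
  then show "b g \<in> borel_measurable BK" by (simp add: borel_measurable_continuous_on_restrict)
qed (auto simp: space_restrict_space b_in)

lemma measurable_\<eta> [measurable]: "(\<lambda>(g, f). \<eta> g f) \<in> borel_measurable (borel \<Otimes>\<^sub>M BK)"
proof -
  have "(\<lambda>f. f) \<in> measurable BK borel" by (rule measurable_restrict_space1) simp
  then have "(\<lambda>p. (fst p, snd p)) \<in> measurable ((borel :: 'g measure) \<Otimes>\<^sub>M BK) (borel \<Otimes>\<^sub>M borel)"
    by (intro measurable_Pair measurable_fst) (rule measurable_compose[OF measurable_snd])
  then have "(\<lambda>p. p) \<in> measurable (borel \<Otimes>\<^sub>M BK) (borel :: ('g \<times> (nat \<Rightarrow> real)) measure)"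
    by (simp add: borel_prod)
  then have "(\<lambda>p. p) \<in> measurable (borel \<Otimes>\<^sub>M BK) (restrict_space (borel :: ('g \<times> (nat \<Rightarrow> real)) measure) (UNIV \<times> K))"
    by (rule measurable_restrict_space2[rotated]) (auto simp: space_pair_measure space_restrict_space)
  from measurable_compose[OF this borel_measurable_continuous_on_restrict[OF continuous_\<eta>]]
  show ?thesis by simp
qed

text \<open>For fixed \<open>g\<close>, quasi-invariance puts both \<open>x\<close> and
  \<open>a g x\<close> in \<open>X\<close> for almost every \<open>x\<close>, and there
  \<open>\<iota>\<close> is equivariant.\<close>

lemma distr_N_b: "distr N N (b g) = distr (T g) BK \<iota>"
proof -
  have "distr N N (b g) = distr (distr M BK \<iota>) BK (b g)" by (intro distr_cong) (simp_all add: N_def)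
  also have "\<dots> = distr M BK (b g \<circ> \<iota>)" by (rule distr_distr) simp_all
  also have "\<dots> = distr M BK (\<iota> \<circ> a g)"
  proof (rule distr_cong_AE)
    show "AE x in M. (b g \<circ> \<iota>) x = (\<iota> \<circ> a g) x"
      using AE_X AE_action[OF AE_X, of g] by eventually_elim (simp add: \<iota>_action)
  qed (auto intro!: measurable_comp)
  also have "\<dots> = distr (T g) BK \<iota>" unfolding T_def by (rule distr_distr[symmetric]) simp_all
  finally show ?thesis .
qed

lemma stationary_N: "stationary_measure \<theta> N b"
  unfolding stationary_measure_def
proof (intro conjI ballI)
  show "prob_space N" by (rule N.prob_space_axioms)
  fix B assume "B \<in> sets N"
  then have B [measurable]: "B \<in> sets BK" by simp
  have "(\<integral>\<^sup>+g. emeasure (distr N N (b g)) B \<partial>\<theta>) = (\<integral>\<^sup>+g. emeasure (T (0 + g)) (\<iota> -` B \<inter> space M) \<partial>\<theta>)"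
    unfolding distr_N_b by (subst emeasure_distr) (auto simp: T_def)
  also have "\<dots> = emeasure (T 0) (\<iota> -` B \<inter> space M)" by (rule average_T) simp
  also have "\<dots> = emeasure N B" unfolding N_def T_0 by (rule emeasure_distr[symmetric]) simp_all
  finally show "(\<integral>\<^sup>+g. emeasure (distr N N (b g)) B \<partial>\<theta>) = emeasure N B" .
qed

lemma isomorphic_N: "measurably_isomorphic M a N b"
  unfolding measurably_isomorphic_def
proof (intro exI conjI allI ballI impI)
  show \<iota>: "\<iota> \<in> measurable (restrict_space M X) N"
    using measurable_restrict_space1[OF measurable_\<iota>, of X]
    by (simp add: measurable_cong_sets[OF refl sets_N])
  show "distr (restrict_space M X) N \<iota> = N"
  proof (rule measure_eqI)
    fix B assume "B \<in> sets (distr (restrict_space M X) N \<iota>)"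
    then have B [measurable]: "B \<in> sets BK" by simp
    have "emeasure (distr (restrict_space M X) N \<iota>) B = emeasure (restrict_space M X) (\<iota> -` B \<inter> X)"
      using \<iota> X_space by (subst emeasure_distr) (auto simp: space_restrict_space intro!: arg_cong[where f="emeasure _"])
    also have "\<dots> = emeasure M (\<iota> -` B \<inter> X)" by (rule emeasure_restrict_space) (use X_space in auto)
    also have "\<dots> = emeasure M (\<iota> -` B \<inter> space M)"
    proof (rule emeasure_eq_AE)
      show "AE x in M. x \<in> \<iota> -` B \<inter> X \<longleftrightarrow> x \<in> \<iota> -` B \<inter> space M"
        using AE_X by eventually_elim (auto simp: X_space)
      have "\<iota> -` B \<inter> space M \<inter> X \<in> sets M" by measurable
      also have "\<iota> -` B \<inter> space M \<inter> X = \<iota> -` B \<inter> X" using X_space by auto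
      finally show "\<iota> -` B \<inter> X \<in> sets M" .
    qed simp
    also have "\<dots> = emeasure N B" unfolding N_def by (rule emeasure_distr[symmetric]) simp_all
    finally show "emeasure (distr (restrict_space M X) N \<iota>) B = emeasure N B" .
  qed simp
qed (use AE_X \<iota>_action inj_\<iota> in simp_all)

text \<open>The density \<open>U x (- g)\<close> of \<open>T (- g)\<close> is a function of the
  image point: \<open>\<eta> g\<close> reads it off coordinate 0. It therefore passes to the image
  measure unchanged.\<close>

lemma cocycle_N: "RN_cocycle_version N b \<eta>"
  unfolding RN_cocycle_version_def
proof (intro conjI allI ballI)
  show "(\<lambda>(g, x). \<eta> g x) \<in> borel_measurable (borel \<Otimes>\<^sub>M N)" by measurable
  show "0 < \<eta> g x" if "x \<in> space N" for g x
    using that H_D(2)[OF \<Z>_0[OF decode_in]] by (simp add: \<eta>_def)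
  fix g
  have [measurable]: "\<eta> g \<in> borel_measurable BK"
    using measurable_compose[OF measurable_Pair1'[of g borel BK] measurable_\<eta>] by simp
  have "distr N N (b (- g)) = distr (density M (\<lambda>x. ennreal (U x (- g)))) BK \<iota>"
    by (simp add: distr_N_b density_U)
  also have "density M (\<lambda>x. ennreal (U x (- g))) = density M (\<lambda>x. ennreal (\<eta> g (\<iota> x)))"
  proof (rule density_cong)
    show "AE x in M. ennreal (U x (- g)) = ennreal (\<eta> g (\<iota> x))"
      using AE_X by eventually_elim (simp add: \<iota>_X \<eta>_code point_in point_def)
  qed measurable
  also have "distr \<dots> BK \<iota> = density N (\<lambda>f. ennreal (\<eta> g f))"
    unfolding N_def by (rule density_distr[symmetric]) measurable
  finally show "AE x in N. ennreal (\<eta> g x) = RN_deriv N (distr N N (b (- g))) x"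
    by (intro N.RN_deriv_unique) (simp_all add: measurable_cong_sets[OF sets_N refl])
qed

end

theorem (in rn_model) universal: "universal_compact_RN_model TYPE('x) \<theta> Z b \<eta>"
  unfolding universal_compact_RN_model_def
proof (intro conjI allI impI)
  show "compact_G_space Z b" "continuous_harmonic_cocycle \<theta> Z b \<eta>"
    by (rule compact_G_space_Z continuous_harmonic_cocycle_Z)+
  fix M :: "'x measure" and a :: "'g \<Rightarrow> 'x \<Rightarrow> 'x"
  assume M: "stationary_space \<theta> M a"
  interpret coded_system m \<theta> M a W q by unfold_locales (rule M)
  obtain A :: "nat \<Rightarrow> 'x set" where A: "\<And>n. A n \<in> sets M"
    "\<And>x y. x \<in> space M \<Longrightarrow> y \<in> space M \<Longrightarrow> (\<And>n. x \<in> A n \<longleftrightarrow> y \<in> A n) \<Longrightarrow> x = y"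
    using separating_sequence[of M] M by (auto simp: stationary_space_def)
  obtain X where X: "X \<in> sets M" "AE x in M. x \<in> X" "\<And>x. x \<in> X \<Longrightarrow> U x \<in> H"
    "\<And>g x h. x \<in> X \<Longrightarrow> a g x \<in> X \<Longrightarrow> U (a g x) h = U x (- g + h) / U x (- g)"
    using exact_cocycle_on_conull_set by metis
  interpret embedded_system m \<theta> M a W q A X by unfold_locales (fact A X)+
  \<comment> \<open>All of \<open>K\<close> serves as the compact invariant subset for every
    stationary space; only the measure varies.\<close>
  show "\<exists>K N. compactin Z K \<and> (\<forall>g. \<forall>z\<in>K. b g z \<in> K) \<and> space N = K \<and>
      sets N = sigma_sets K {U. openin (subtopology Z K) U} \<and>
      stationary_measure \<theta> N b \<and> measurably_isomorphic M a N b \<and> RN_cocycle_version N b \<eta>"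
    using compact_K b_in sets_N_sigma stationary_N isomorphic_N cocycle_N
    by (intro exI[of _ K] exI[of _ N]) (auto simp: compactin_subtopology)
qed

section \<open>Transport to arbitrary carriers\<close>

text \<open>A point of the carrier is determined by the set of \<open>n\<close> with
  \<open>x\<close> in \<open>A n\<close>, and sets of naturals are equinumerous with the reals. The
  type itself may be larger.\<close>

lemma standard_borel_injection:
  assumes "standard_borel (M :: 'x measure)"
  obtains \<phi> :: "'x \<Rightarrow> real" where "inj_on \<phi> (space M)"
proof -
  obtain A :: "nat \<Rightarrow> 'x set" where
    A: "\<And>x y. x \<in> space M \<Longrightarrow> y \<in> space M \<Longrightarrow> (\<And>n. x \<in> A n \<longleftrightarrow> y \<in> A n) \<Longrightarrow> x = y"
    using separating_sequence[OF assms] by metis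
  obtain f :: "nat set \<Rightarrow> real" where f: "inj f"
    using nat_sets_eqpoll_reals unfolding eqpoll_def bij_betw_def by blast
  have "inj_on (\<lambda>x. f {n. x \<in> A n}) (space M)"
  proof (rule inj_onI)
    fix x y assume xy: "x \<in> space M" "y \<in> space M" "f {n. x \<in> A n} = f {n. y \<in> A n}"
    then have "{n. x \<in> A n} = {n. y \<in> A n}" using f by (simp add: inj_eq)
    then show "x = y" using A xy by blast
  qed
  then show ?thesis by (rule that)
qed

locale measure_transport =
  fixes M :: "'x measure" and \<phi> :: "'x \<Rightarrow> 'y"
  assumes inj: "inj_on \<phi> (space M)"
begin

definition \<psi> :: "'y \<Rightarrow> 'x" where
  "\<psi> = inv_into (space M) \<phi>"

lemma \<psi>_\<phi>: "x \<in> space M \<Longrightarrow> \<psi> (\<phi> x) = x"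
  using inj by (simp add: \<psi>_def)

lemma \<psi>_space: "\<psi> \<in> \<phi> ` space M \<rightarrow> space M"
  by (auto simp: \<psi>_\<phi>)

text \<open>The \<sigma>-algebra is carried over along \<open>\<phi>\<close>, not induced from the
  target type, so \<open>\<phi>\<close> is an isomorphism onto its image by construction, whatever
  subset that image is.\<close>

definition M' :: "'y measure" where
  "M' = distr M (vimage_algebra (\<phi> ` space M) \<psi> M) \<phi>"

lemma space_M': "space M' = \<phi> ` space M"
  by (simp add: M'_def)

lemma sets_M': "sets M' = {\<psi> -` A \<inter> \<phi> ` space M |A. A \<in> sets M}"
  by (simp add: M'_def sets_vimage_algebra2[OF \<psi>_space])

lemma measurable_\<psi> [measurable]: "\<psi> \<in> measurable M' M"
proof -
  have "sets M' = sets (vimage_algebra (\<phi> ` space M) \<psi> M)" by (simp add: M'_def)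
  then show ?thesis
    using measurable_vimage_algebra1[OF \<psi>_space] measurable_cong_sets[of M' _ M M] by blast
qed

lemma measurable_\<phi> [measurable]: "\<phi> \<in> measurable M M'"
proof -
  have "(\<lambda>x. \<psi> (\<phi> x)) \<in> measurable M M"
    by (subst measurable_cong[where g="\<lambda>x. x"]) (auto simp: \<psi>_\<phi>)
  then have "\<phi> \<in> measurable M (vimage_algebra (\<phi> ` space M) \<psi> M)"
    by (intro measurable_vimage_algebra2) auto
  moreover have "sets M' = sets (vimage_algebra (\<phi> ` space M) \<psi> M)" by (simp add: M'_def)
  ultimately show ?thesis using measurable_cong_sets[of M M M'] by blast
qed

lemma distr_M': "distr M M' \<phi> = M'"
  by (subst (2) M'_def) (intro distr_cong, simp_all add: M'_def)

lemma standard_borel_M':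
  assumes "standard_borel M"
  shows "standard_borel M'"
proof -
  obtain T where T: "completely_metrizable_space T" "second_countable T" "topspace T = space M"
    "sets M = sigma_sets (space M) {U. openin T U}"
    using assms by (auto simp: standard_borel_def)
  \<comment> \<open>On the image \<open>\<psi>\<close> is a bijection onto the carrier, so the
    pulled back topology makes it a homeomorphism and complete metrizability is inherited.\<close>
  define T' where "T' = pullback_topology (\<phi> ` space M) \<psi> T"
  have top: "topspace T' = \<phi> ` space M"
    using \<psi>_space by (auto simp: T'_def topspace_pullback_topology T(3))
  have op: "openin T' U \<longleftrightarrow> (\<exists>V. openin T V \<and> U = \<psi> -` V \<inter> \<phi> ` space M)" for U
    by (simp add: T'_def openin_pullback_topology)
  have "homeomorphic_maps T T' \<phi> \<psi>"
    unfolding homeomorphic_maps_def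
  proof (intro conjI ballI)
    show "continuous_map T T' \<phi>"
      unfolding continuous_map_def
    proof (intro conjI allI impI)
      fix U assume "openin T' U"
      then obtain V where V: "openin T V" "U = \<psi> -` V \<inter> \<phi> ` space M" using op by blast
      have "{x \<in> topspace T. \<phi> x \<in> U} = V"
        using openin_subset[OF V(1)] by (auto simp: V(2) \<psi>_\<phi> T(3) dest: inj_onD[OF inj])
      then show "openin T {x \<in> topspace T. \<phi> x \<in> U}" using V by simp
    qed (simp add: top T(3))
    show "continuous_map T' T \<psi>"
      unfolding continuous_map_def
    proof (intro conjI allI impI)
      fix U assume "openin T U"
      moreover have "{x \<in> topspace T'. \<psi> x \<in> U} = \<psi> -` U \<inter> \<phi> ` space M" by (auto simp: top)
      ultimately show "openin T' {x \<in> topspace T'. \<psi> x \<in> U}" using op by blast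
    qed (use \<psi>_space in \<open>simp add: top T(3)\<close>)
  qed (auto simp: T(3) top \<psi>_\<phi>)
  then have hom: "T homeomorphic_space T'" by (auto simp: homeomorphic_space_def)
  have "sets M' = {\<psi> -` A \<inter> \<phi> ` space M |A. A \<in> sigma_sets (space M) {U. openin T U}}"
    by (simp add: sets_M' T(4))
  also have "\<dots> = sigma_sets (\<phi> ` space M) {\<psi> -` A \<inter> \<phi> ` space M |A. A \<in> {U. openin T U}}"
    by (rule sigma_sets_vimage_commute[OF \<psi>_space])
  also have "{\<psi> -` A \<inter> \<phi> ` space M |A. A \<in> {U. openin T U}} = {U. openin T' U}"
    by (auto simp: op)
  finally have "sets M' = sigma_sets (space M') {U. openin T' U}" by (simp add: space_M')
  then show ?thesis
    unfolding standard_borel_def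
    using homeomorphic_completely_metrizable_space[OF hom] homeomorphic_space_second_countability[OF hom]
      T(1,2) top by (intro exI[of _ T']) (simp add: space_M')
qed

lemma stationary_space_M':
  fixes \<theta> :: "'g::{topological_group_add, second_countable_topology, t2_space} measure"
  assumes "stationary_space \<theta> M a"
  shows "stationary_space \<theta> M' (\<lambda>g y. \<phi> (a g (\<psi> y)))"
proof -
  have sb: "standard_borel M" and act: "borel_action M a" and st: "stationary_measure \<theta> M a"
    using assms by (auto simp: stationary_space_def)
  interpret prob_space M using st by (simp add: stationary_measure_def)
  have [measurable]: "(\<lambda>(g, x). a g x) \<in> measurable (borel \<Otimes>\<^sub>M M) M"
    using act by (simp add: borel_action_def)
  have [measurable]: "a g \<in> measurable M M" for g
    using measurable_compose[OF measurable_Pair1'[of g borel M], of "\<lambda>(g, x). a g x" M] by simp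
  have a_space: "a g x \<in> space M" if "x \<in> space M" for g x
    using that by (rule measurable_space[rotated]) measurable
  have "borel_action M' (\<lambda>g y. \<phi> (a g (\<psi> y)))"
    unfolding borel_action_def
  proof (intro conjI ballI allI)
    have "(\<lambda>p. \<phi> ((\<lambda>(g, x). a g x) (fst p, \<psi> (snd p)))) \<in> measurable (borel \<Otimes>\<^sub>M M') M'" by measurable
    then show "(\<lambda>(g, y). \<phi> (a g (\<psi> y))) \<in> measurable (borel \<Otimes>\<^sub>M M') M'" by (simp add: case_prod_beta)
  qed (use act a_space in \<open>auto simp: space_M' \<psi>_\<phi> borel_action_def\<close>)
  moreover have "stationary_measure \<theta> M' (\<lambda>g y. \<phi> (a g (\<psi> y)))"
    unfolding stationary_measure_def
  proof (intro conjI ballI)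
    show "prob_space M'" by (subst distr_M'[symmetric]) (rule prob_space_distr, measurable)
    fix A assume A [measurable]: "A \<in> sets M'"
    have "distr M' M' (\<lambda>y. \<phi> (a g (\<psi> y))) = distr (distr M M (a g)) M' \<phi>" for g
    proof -
      have "distr M' M' (\<lambda>y. \<phi> (a g (\<psi> y))) = distr (distr M M' \<phi>) M' (\<lambda>y. \<phi> (a g (\<psi> y)))"
        by (simp add: distr_M')
      also have "\<dots> = distr M M' ((\<lambda>y. \<phi> (a g (\<psi> y))) \<circ> \<phi>)" by (rule distr_distr) measurable
      also have "\<dots> = distr M M' (\<phi> \<circ> a g)" by (rule distr_cong) (auto simp: \<psi>_\<phi>)
      also have "\<dots> = distr (distr M M (a g)) M' \<phi>" by (rule distr_distr[symmetric]) measurable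
      finally show ?thesis .
    qed
    then have "emeasure (distr M' M' (\<lambda>y. \<phi> (a g (\<psi> y)))) A = emeasure (distr M M (a g)) (\<phi> -` A \<inter> space M)" for g
      by (simp add: emeasure_distr)
    moreover have "emeasure M' A = emeasure M (\<phi> -` A \<inter> space M)"
      by (subst distr_M'[symmetric]) (rule emeasure_distr, measurable)
    moreover have "\<phi> -` A \<inter> space M \<in> sets M" by measurable
    ultimately show "(\<integral>\<^sup>+g. emeasure (distr M' M' (\<lambda>y. \<phi> (a g (\<psi> y)))) A \<partial>\<theta>) = emeasure M' A"
      using st by (simp add: stationary_measure_def)
  qed
  ultimately show ?thesis using standard_borel_M'[OF sb] by (simp add: stationary_space_def)
qed

lemma measurably_isomorphic_M':
  fixes a :: "'g::{topological_group_add, second_countable_topology, t2_space} \<Rightarrow> 'x \<Rightarrow> 'x"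
  assumes act: "borel_action M a" and iso: "measurably_isomorphic M' (\<lambda>g y. \<phi> (a g (\<psi> y))) N b"
  shows "measurably_isomorphic M a N b"
proof -
  obtain X \<iota> where X: "X \<in> sets M'" "AE y in M'. y \<in> X" "\<iota> \<in> measurable (restrict_space M' X) N" "inj_on \<iota> X"
    "\<And>g y. y \<in> X \<Longrightarrow> \<phi> (a g (\<psi> y)) \<in> X \<Longrightarrow> \<iota> (\<phi> (a g (\<psi> y))) = b g (\<iota> y)"
    "distr (restrict_space M' X) N \<iota> = N"
    using iso unfolding measurably_isomorphic_def by blast
  define Y where "Y = \<phi> -` X \<inter> space M"
  have Y: "Y \<in> sets M" unfolding Y_def using measurable_sets[OF measurable_\<phi> X(1)] .
  have XM: "X \<subseteq> \<phi> ` space M" using sets.sets_into_space[OF X(1)] by (simp add: space_M')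
  have \<phi>_restrict: "\<phi> \<in> measurable (restrict_space M Y) (restrict_space M' X)"
    by (intro measurable_restrict_space2 measurable_restrict_space1 measurable_\<phi>)
       (auto simp: space_restrict_space Y_def)
  have comp: "\<iota> \<circ> \<phi> \<in> measurable (restrict_space M Y) N"
    using \<phi>_restrict X(3) by (rule measurable_comp)
  have "distr (restrict_space M Y) N (\<iota> \<circ> \<phi>) = distr (restrict_space M' X) N \<iota>"
  proof (rule measure_eqI)
    fix B assume "B \<in> sets (distr (restrict_space M Y) N (\<iota> \<circ> \<phi>))"
    then have B: "B \<in> sets N" by simp
    have sX: "space (restrict_space M' X) = X" and sY: "space (restrict_space M Y) = Y"
      using XM by (auto simp: space_restrict_space space_M' Y_def)
    have S: "\<iota> -` B \<inter> X \<in> sets (restrict_space M' X)"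
      using measurable_sets[OF X(3) B] by (simp add: sX)
    then have S': "\<iota> -` B \<inter> X \<in> sets M'" using X(1) by (simp add: sets_restrict_space_iff)
    have "emeasure (distr (restrict_space M Y) N (\<iota> \<circ> \<phi>)) B = emeasure (restrict_space M Y) ((\<iota> \<circ> \<phi>) -` B \<inter> Y)"
      using emeasure_distr[OF comp B] by (simp add: sY)
    also have "\<dots> = emeasure M ((\<iota> \<circ> \<phi>) -` B \<inter> Y)"
      by (rule emeasure_restrict_space) (use Y sets.sets_into_space[OF Y] in auto)
    also have "(\<iota> \<circ> \<phi>) -` B \<inter> Y = \<phi> -` (\<iota> -` B \<inter> X) \<inter> space M" by (auto simp: Y_def)
    also have "emeasure M \<dots> = emeasure M' (\<iota> -` B \<inter> X)"
      using emeasure_distr[OF measurable_\<phi> S'] by (simp add: distr_M')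
    also have "\<dots> = emeasure (restrict_space M' X) (\<iota> -` B \<inter> X)"
      by (rule emeasure_restrict_space[symmetric]) (use X(1) in auto)
    also have "\<dots> = emeasure (distr (restrict_space M' X) N \<iota>) B"
      using emeasure_distr[OF X(3) B] by (simp add: sX)
    finally show "emeasure (distr (restrict_space M Y) N (\<iota> \<circ> \<phi>)) B = emeasure (distr (restrict_space M' X) N \<iota>) B" .
  qed simp
  then have "distr (restrict_space M Y) N (\<iota> \<circ> \<phi>) = N" by (simp add: X(6))
  moreover have "AE x in M. x \<in> Y"
  proof -
    have "AE y in distr M M' \<phi>. y \<in> X" unfolding distr_M' by (rule X(2))
    moreover have "{y \<in> space M'. y \<in> X} \<in> sets M'" using X(1) by (simp add: Collect_conj_eq)
    ultimately have "AE x in M. \<phi> x \<in> X" by (simp add: AE_distr_iff[OF measurable_\<phi>])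
    with AE_space show ?thesis by eventually_elim (simp add: Y_def)
  qed
  moreover have "inj_on (\<iota> \<circ> \<phi>) Y"
  proof (rule comp_inj_on)
    show "inj_on \<phi> Y" using inj by (rule inj_on_subset) (auto simp: Y_def)
    show "inj_on \<iota> (\<phi> ` Y)" using X(4) by (rule inj_on_subset) (auto simp: Y_def)
  qed
  moreover have "(\<iota> \<circ> \<phi>) (a g x) = b g ((\<iota> \<circ> \<phi>) x)" if "x \<in> Y" "a g x \<in> Y" for g x
    using X(5)[of "\<phi> x" g] that by (simp add: Y_def \<psi>_\<phi>)
  ultimately show ?thesis
    unfolding measurably_isomorphic_def using Y comp by (intro exI[of _ Y] exI[of _ "\<iota> \<circ> \<phi>"]) auto
qed

end

text \<open>The subset and the measure found for the transported copy are kept, and its isomorphism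
  is precomposed with \<open>\<phi>\<close>.\<close>

lemma universal_transport:
  fixes \<theta> :: "'g::{topological_group_add, second_countable_topology, t2_space} measure"
  assumes univ: "universal_compact_RN_model TYPE(real) \<theta> Z b \<eta>"
  shows "universal_compact_RN_model TYPE('x) \<theta> Z b \<eta>"
  unfolding universal_compact_RN_model_def
proof (intro conjI allI impI)
  show "compact_G_space Z b" "continuous_harmonic_cocycle \<theta> Z b \<eta>"
    using univ by (auto simp: universal_compact_RN_model_def)
  fix M :: "'x measure" and a :: "'g \<Rightarrow> 'x \<Rightarrow> 'x"
  assume M: "stationary_space \<theta> M a"
  then obtain \<phi> :: "'x \<Rightarrow> real" where \<phi>: "inj_on \<phi> (space M)"
    using standard_borel_injection[of M] by (auto simp: stationary_space_def)
  interpret measure_transport M \<phi> by unfold_locales (rule \<phi>)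
  have act: "borel_action M a" using M by (simp add: stationary_space_def)
  show "\<exists>K N. compactin Z K \<and> (\<forall>g. \<forall>z\<in>K. b g z \<in> K) \<and> space N = K \<and>
      sets N = sigma_sets K {U. openin (subtopology Z K) U} \<and>
      stationary_measure \<theta> N b \<and> measurably_isomorphic M a N b \<and> RN_cocycle_version N b \<eta>"
  proof -
    from univ[unfolded universal_compact_RN_model_def, THEN conjunct2, THEN conjunct2, rule_format,
        OF stationary_space_M'[OF M]]
    obtain K N where KN: "compactin Z K" "\<forall>g. \<forall>z\<in>K. b g z \<in> K" "space N = K"
      "sets N = sigma_sets K {U. openin (subtopology Z K) U}" "stationary_measure \<theta> N b"
      "measurably_isomorphic M' (\<lambda>g y. \<phi> (a g (\<psi> y))) N b" "RN_cocycle_version N b \<eta>"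
      by blast
    then show ?thesis using measurably_isomorphic_M'[OF act KN(6)] by blast
  qed
qed

(* The model lives on a compact metrizable space carried by nat => real, a type into which every
   compact metric space embeds. The first conjunct is existence, with universality over all carriers
   in the reals; the second says that any such model is universal over the carriers in an
   arbitrary type 'x. Hence a single model, not depending on 'x, serves every stationary space. *)
theorem theorem1p4:
  fixes \<theta> :: "'g::{topological_group_add, second_countable_topology, t2_space} measure"
  assumes "measured_group \<theta>"
    and "(\<integral>\<^sup>+g. harmonic_majorant \<theta> g \<partial>\<theta>) < \<infinity>"
  shows "(\<exists>(Z :: (nat \<Rightarrow> real) topology) b \<eta>. universal_compact_RN_model TYPE(real) \<theta> Z b \<eta>) \<and>
         (\<forall>(Z :: (nat \<Rightarrow> real) topology) b \<eta>.
            universal_compact_RN_model TYPE(real) \<theta> Z b \<eta> \<longrightarrow>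
            universal_compact_RN_model TYPE('x) \<theta> Z b \<eta>)"
proof (intro conjI allI impI)
  obtain m where m: "left_haar_measure m" "absolutely_continuous m \<theta>"
    using assms(1) by (auto simp: measured_group_def admissible_def)
  interpret finite_majorant m \<theta>
    using assms m by unfold_locales (auto simp: measured_group_def)
  obtain W :: "nat \<Rightarrow> 'g set" where W: "\<And>i. open (W i)" "\<And>i. emeasure m (W i) < \<infinity>" "(\<Union>i. W i) = UNIV"
    "sets borel = sigma_sets UNIV (range W)" "Int_stable (range W)"
    using countable_finite_pi_system by metis
  obtain D :: "'g set" where D: "countable D" "\<forall>U. open U \<longrightarrow> U \<noteq> {} \<longrightarrow> (\<exists>d\<in>D. d \<in> U)"
    using countable_dense_exists by (elim exE conjE) (rule that)
  then have "D \<noteq> {}" using open_UNIV by blast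
  have "\<exists>j. from_nat_into D j \<in> U" if "open U" "U \<noteq> {}" for U
  proof -
    obtain d where d: "d \<in> D" "d \<in> U" using D(2) \<open>open U\<close> \<open>U \<noteq> {}\<close> by blast
    then have "d \<in> range (from_nat_into D)" using range_from_nat_into[OF \<open>D \<noteq> {}\<close> D(1)] by simp
    then show ?thesis using d by blast
  qed
  then interpret rn_model m \<theta> W "from_nat_into D"
    by unfold_locales (use W in auto)
  show "\<exists>(Z :: (nat \<Rightarrow> real) topology) b \<eta>. universal_compact_RN_model TYPE(real) \<theta> Z b \<eta>"
    using universal by blast
qed (rule universal_transport)

end
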